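(* Suppose that $(E,\kappa,\omega,\zeta)\in\Omega$, that the function $F(x)$ is linearly independent from the functions $1,\ x,\ \tfrac1x$, and that the amplitude $A(y)$ is non-constant. Let $\mathcal L=\mathcal J\delta^2\tilde H$ be the linearized operator subject to $T$-periodic boundary conditions, and let $T,\eta,M,K$ be the functions of $(\kappa,E,\omega,\zeta)$ defined in the context. Put $$\sigma=\{T,\eta\}_{E,\kappa}=T_E\eta_\kappa-T_\kappa\eta_E,\qquad \mathbf D=\begin{pmatrix}K_{\kappa\kappa}&K_{\kappa E}&K_{\kappa\omega}&T\\ K_{\kappa E}&K_{EE}&K_{E\omega}&0\\ K_{\kappa\omega}&K_{E\omega}&K_{\omega\omega}&0\\ T&0&0&-M\end{pmatrix},$$ and $$\mathbf u_0=\{T,\eta\}_{E,\kappa}\begin{pmatrix}0\\ A\end{pmatrix},\qquad \mathbf u_2=\{T,\eta\}_{E,\kappa}\begin{pmatrix}A_y\\ A S_y\end{pmatrix},$$ $$\mathbf u_1=\{T,\eta\}_{E,\kappa}\begin{pmatrix}A_\omega\\ A S_\omega\end{pmatrix}+\{T,\eta\}_{\kappa,\omega}\begin{pmatrix}A_E\\ A S_E\end{pmatrix}+\{T,\eta\}_{\omega,E}\begin{pmatrix}A_\kappa\\ A S_\kappa\end{pmatrix},$$ $$\mathbf u_3=\{T,\eta\}_{E,\kappa}\begin{pmatrix}0\\ y A/2\end{pmatrix}+\frac{TT_\kappa}{2}\begin{pmatrix}A_E\\ A S_E\end{pmatrix}-\frac{TT_E}{2}\begin{pmatrix}A_\kappa\\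 A S_\kappa\end{pmatrix},$$ $$\mathbf v_0=\mathbf u_1^t\mathcal J,\quad \mathbf v_1=-\mathbf u_0^t\mathcal J,\quad \mathbf v_2=\mathbf u_3^t\mathcal J,\quad \mathbf v_3=-\mathbf u_2^t\mathcal J .$$ Then: (1) The functions $\mathbf u_0,\dots,\mathbf u_3$ satisfy the $T$-periodic boundary conditions and $$\mathcal L\mathbf u_0=\mathcal L\mathbf u_2=0,\quad \mathcal L\mathbf u_1=\mathbf u_0,\quad \mathcal L\mathbf u_3=\mathbf u_2,\qquad \mathbf v_1\mathcal L=\mathbf v_3\mathcal L=0,\quad \mathbf v_0\mathcal L=\mathbf v_1,\quad \mathbf v_2\mathcal L=\mathbf v_3 .$$ Generically, namely when $\sigma\neq0$ and $\det\mathbf D\neq0$, the generalized kernel of $\mathcal L$ is the direct sum of two Jordan chains of length two, given by $(\mathbf u_0,\mathbf u_1)$ and $(\mathbf u_2,\mathbf u_3)$. (2) The kernel of $\mathcal L$ is exactly two dimensional unless $\sigma=0$, in which case it is higher dimensional. More specifically, $$\dim\ker(\mathcal L)=2+\dim\ker\begin{pmatrix}T_E&T_\kappa\\ \eta_E&\eta_\kappa\end{pmatrix}=2+\dim\ker\begin{pmatrix}K_{EE}&K_{\kappa E}\\ K_{\kappa E}&K_{\kappa\kappa}\end{pmatrix}.$$ (3) If $\sigma\neq0$, there are no Jordan chains (for the eigenvalue $0$ of $\mathcal L$) of length greater than two as long as $\det\mathbf D\neq0$. More specifically, if $\sigma\ne0$, $$\dim\ker(\mathcal L^3)-\dim\ker(\mathcal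 L^2)=\dim\ker\mathbf D .$$
   Context: Equation. Consider $i w_t=w_{xx}+\zeta f(|w|^2)w$, where $f$ is a real-valued smooth function and $F$ is an antiderivative, $F'=f$. After using Galilean, translation and $U(1)$ invariance, traveling waves have the form $w=e^{i\omega t}e^{iS(y)}A(y)$ (with $y=x$), with real $A,S$ satisfying $$S_y=\frac{\kappa}{A^2},\qquad A_{yy}=-\omega A+A S_y^2-\zeta f(A^2)A,\qquad A_y^2=R(A):=2E-\omega A^2-\frac{\kappa^2}{A^2}-\zeta F(A^2).$$ Parameter domain. $\Omega$ is the open set of real parameter values $(E,\kappa,\omega,\zeta)$ with $\kappa>0$ such that $R$ is real and positive on some interval $(a_-,a_+)$ of the positive real axis and has simple roots at $a_\pm$. Such an interval is fixed, and its endpoints vary smoothly with the parameters. $A(y)=A(y;E,\kappa,\omega,\zeta)$ is the periodic solution oscillating between $a_-$ and $a_+$, translated so that $A(0)=a_-$ (so $A_y(0)=0$); $T$ is its period, $A(T/2)=a_+$, and $S$ is normalized by $S(0)=0$. Moments. With $\oint g\,dA$ denoting the integral over a simple closed contour encircling $[a_-,a_+]$ (equivalently $2\int_{a_-}^{a_+}g\,dA$, with the positive square root), $$T=\oint\frac{dA}{\sqrt{R(A)}},\quad \eta=\oint\frac{\kappa\,dA}{A^2\sqrt{R(A)}},\quad M=\oint\frac{A^2dA}{\sqrt{R(A)}},\quad K=\oint\sqrt{R(A)}\,dA .$$ These are functions of the independent parameters $(\kappa,E,\omega,\zeta)$; $\eta=S(T)-S(0)$. Subscripts $E,\kappa,\omega$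 denote partial derivatives in these parameters (for $A,S$: at fixed $y$), and $\{P,Q\}_{a,b}=\frac{\partial P}{\partial a}\frac{\partial Q}{\partial b}-\frac{\partial P}{\partial b}\frac{\partial Q}{\partial a}$. Linearized operator. Linearizing with $w=e^{i\omega t}e^{iS(y)}(A(y)+\epsilon(R+iI))$ (here $R,I$ are the real and imaginary parts of the perturbation) gives $\partial_t(R,I)^t=\mathcal L(R,I)^t$ with $$\mathcal L=\mathcal J\delta^2\tilde H=\begin{pmatrix}\mathcal K&-\mathcal L_-\\ \mathcal L_+&\mathcal K\end{pmatrix}=\begin{pmatrix}0&-1\\ 1&0\end{pmatrix}\begin{pmatrix}\mathcal L_+&\mathcal K\\ \mathcal K^T&\mathcal L_-\end{pmatrix},\qquad \mathcal J=\begin{pmatrix}0&-1\\ 1&0\end{pmatrix},$$ $$\mathcal K=S_{yy}+2S_y\partial_y,\quad \mathcal L_-=-\omega-\partial_{yy}+S_y^2-\zeta f(A^2),\quad \mathcal L_+=\mathcal L_--2\zeta f'(A^2)A^2 ,$$ acting on two-component $T$-periodic functions, i.e. on $L^2$ of one period with periodic boundary conditions. A left vector $\mathbf v$ is a row vector of $T$-periodic functions acting by $\mathbf v\mathbf u=\int_0^T\mathbf v(y)\mathbf u(y)\,dy$ (no complex conjugation), and $\mathbf v\mathcal L$ is defined by $(\mathbf v\mathcal L)\mathbf u=\mathbf v(\mathcal L\mathbf u)$. The generalized kernel of $\mathcal L$ is $\bigcup_k\ker(\mathcal L^k)$. *)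

theory Defs
  imports "HOL-Analysis.Analysis" "HOL-Library.Function_Algebras"
begin

text \<open>Parameters are quadruples \<open>(E, \<kappa>, \<omega>, \<zeta>)\<close>.\<close>

type_synonym params = "real \<times> real \<times> real \<times> real"

definition d\<^sub>E :: "(params \<Rightarrow> real) \<Rightarrow> params \<Rightarrow> real" where
  "d\<^sub>E P = (\<lambda>(E, \<kappa>, \<omega>, \<zeta>). deriv (\<lambda>e. P (e, \<kappa>, \<omega>, \<zeta>)) E)"

definition d\<^sub>\<kappa> :: "(params \<Rightarrow> real) \<Rightarrow> params \<Rightarrow> real" where
  "d\<^sub>\<kappa> P = (\<lambda>(E, \<kappa>, \<omega>, \<zeta>). deriv (\<lambda>k. P (E, k, \<omega>, \<zeta>)) \<kappa>)"

definition d\<^sub>\<omega> :: "(params \<Rightarrow> real) \<Rightarrow> params \<Rightarrow> real" where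
  "d\<^sub>\<omega> P = (\<lambda>(E, \<kappa>, \<omega>, \<zeta>). deriv (\<lambda>w. P (E, \<kappa>, w, \<zeta>)) \<omega>)"

text \<open>The bracket \<open>{P, Q}\<^sub>a\<^sub>,\<^sub>b\<close>, with \<open>da\<close>, \<open>db\<close> the partial derivative operators.\<close>

definition bracket ::
  "(params \<Rightarrow> real) \<Rightarrow> (params \<Rightarrow> real) \<Rightarrow>
   ((params \<Rightarrow> real) \<Rightarrow> params \<Rightarrow> real) \<Rightarrow> ((params \<Rightarrow> real) \<Rightarrow> params \<Rightarrow> real) \<Rightarrow> params \<Rightarrow> real"
  where "bracket P Q da db p = da P p * db Q p - db P p * da Q p"

text \<open>\<open>C\<^sup>k\<close> and \<open>C\<^sup>\<infinity>\<close> on open sets. The same notion is used for functions of one real variable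
  and for functions of the parameters.\<close>

primrec Ck_on :: "nat \<Rightarrow> 'a::euclidean_space set \<Rightarrow> ('a \<Rightarrow> real) \<Rightarrow> bool" where
  "Ck_on 0 U g \<longleftrightarrow> continuous_on U g"
| "Ck_on (Suc k) U g \<longleftrightarrow>
     (\<forall>x\<in>U. g differentiable (at x)) \<and>
     (\<forall>i\<in>Basis. Ck_on k U (\<lambda>x. frechet_derivative g (at x) i))"

definition smooth_on :: "'a::euclidean_space set \<Rightarrow> ('a \<Rightarrow> real) \<Rightarrow> bool" where
  "smooth_on U g \<longleftrightarrow> (\<forall>k. Ck_on k U g)"

text \<open>Only the values of \<open>f\<close> and \<open>F\<close> on \<open>(0, \<infinity>)\<close> matter, since \<open>\<bar>w\<bar>\<^sup>2 = A\<^sup>2 > 0\<close> when \<open>\<kappa> > 0\<close>.\<close>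

definition indep_from_1_x_inverse :: "(real \<Rightarrow> real) \<Rightarrow> bool" where
  "indep_from_1_x_inverse F \<longleftrightarrow>
     (\<forall>c0 c1 c2 c3. (\<forall>x>0. c0 * F x + c1 * 1 + c2 * x + c3 * (1 / x) = 0)
        \<longrightarrow> c0 = 0 \<and> c1 = 0 \<and> c2 = 0 \<and> c3 = 0)"

definition Rfun :: "(real \<Rightarrow> real) \<Rightarrow> params \<Rightarrow> real \<Rightarrow> real" where
  "Rfun F = (\<lambda>(E, \<kappa>, \<omega>, \<zeta>) a. 2 * E - \<omega> * a\<^sup>2 - \<kappa>\<^sup>2 / a\<^sup>2 - \<zeta> * F (a\<^sup>2))"

definition turning_points :: "(real \<Rightarrow> real) \<Rightarrow> params \<Rightarrow> real \<Rightarrow> real \<Rightarrow> bool" where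
  "turning_points F q a b \<longleftrightarrow>
     0 < a \<and> a < b \<and> (\<forall>x. a < x \<and> x < b \<longrightarrow> Rfun F q x > 0) \<and>
     Rfun F q a = 0 \<and> deriv (Rfun F q) a \<noteq> 0 \<and>
     Rfun F q b = 0 \<and> deriv (Rfun F q) b \<noteq> 0"

definition Omega :: "(real \<Rightarrow> real) \<Rightarrow> params set" where
  "Omega F = {(E, \<kappa>, \<omega>, \<zeta>). \<kappa> > 0 \<and> (\<exists>a b. turning_points F (E, \<kappa>, \<omega>, \<zeta>) a b)}"

text \<open>The contour integral of \<open>g\<close> is \<open>2 \<integral> g dA\<close> over \<open>[a\<^sub>-, a\<^sub>+]\<close>, with the positive square root;
  \<open>am\<close>, \<open>ap\<close> are the endpoints as functions of the parameters.\<close>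

definition T_moment :: "(real \<Rightarrow> real) \<Rightarrow> (params \<Rightarrow> real) \<Rightarrow> (params \<Rightarrow> real) \<Rightarrow> params \<Rightarrow> real" where
  "T_moment F am ap q = 2 * integral {am q..ap q} (\<lambda>a. 1 / sqrt (Rfun F q a))"

definition \<eta>_moment :: "(real \<Rightarrow> real) \<Rightarrow> (params \<Rightarrow> real) \<Rightarrow> (params \<Rightarrow> real) \<Rightarrow> params \<Rightarrow> real" where
  "\<eta>_moment F am ap = (\<lambda>(E, \<kappa>, \<omega>, \<zeta>).
     2 * integral {am (E, \<kappa>, \<omega>, \<zeta>)..ap (E, \<kappa>, \<omega>, \<zeta>)}
           (\<lambda>a. \<kappa> / (a\<^sup>2 * sqrt (Rfun F (E, \<kappa>, \<omega>, \<zeta>) a))))"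

definition M_moment :: "(real \<Rightarrow> real) \<Rightarrow> (params \<Rightarrow> real) \<Rightarrow> (params \<Rightarrow> real) \<Rightarrow> params \<Rightarrow> real" where
  "M_moment F am ap q = 2 * integral {am q..ap q} (\<lambda>a. a\<^sup>2 / sqrt (Rfun F q a))"

definition K_moment :: "(real \<Rightarrow> real) \<Rightarrow> (params \<Rightarrow> real) \<Rightarrow> (params \<Rightarrow> real) \<Rightarrow> params \<Rightarrow> real" where
  "K_moment F am ap q = 2 * integral {am q..ap q} (\<lambda>a. sqrt (Rfun F q a))"

text \<open>\<open>A\<close>, \<open>S\<close> are the amplitude and phase of the travelling wave with parameters \<open>q\<close>, turning
  points \<open>a < b\<close> and period \<open>T\<close>. The second-order equation excludes solutions of
  \<open>A\<^sub>y\<^sup>2 = R(A)\<close> that rest at a turning point.\<close>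

definition wave_profile ::
  "(real \<Rightarrow> real) \<Rightarrow> (real \<Rightarrow> real) \<Rightarrow> params \<Rightarrow> real \<Rightarrow> real \<Rightarrow> real \<Rightarrow>
   (real \<Rightarrow> real) \<Rightarrow> (real \<Rightarrow> real) \<Rightarrow> bool" where
  "wave_profile f F = (\<lambda>(E, \<kappa>, \<omega>, \<zeta>) a b T A S.
     (\<forall>y. a \<le> A y \<and> A y \<le> b) \<and> A 0 = a \<and> A (T / 2) = b \<and> (\<forall>y. A (y + T) = A y) \<and>
     S 0 = 0 \<and>
     (\<forall>y. (S has_real_derivative \<kappa> / (A y)\<^sup>2) (at y)) \<and>
     (\<forall>y. (A has_real_derivative deriv A y) (at y)) \<and>
     (\<forall>y. (deriv A has_real_derivative
             - \<omega> * A y + A y * (deriv S y)\<^sup>2 - \<zeta> * f ((A y)\<^sup>2) * A y) (at y)) \<and>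
     (\<forall>y. (deriv A y)\<^sup>2 = Rfun F (E, \<kappa>, \<omega>, \<zeta>) (A y)))"

text \<open>The complex vector space of functions \<open>real \<Rightarrow> complex^2\<close>. The names \<open>cfun.span\<close>,
  \<open>cfun.dim\<close> and \<open>cfun.independent\<close> refer to complex coefficients; \<open>cfun.dim\<close> is \<open>0\<close> on
  infinite-dimensional spaces.\<close>

interpretation cfun: vector_space "\<lambda>(c::complex) (u :: real \<Rightarrow> complex^2) y. c *s u y"
  by unfold_locales
    (auto simp: fun_eq_iff vec_eq_iff algebra_simps)

definition L2_per :: "real \<Rightarrow> (real \<Rightarrow> complex^2) \<Rightarrow> bool" where
  "L2_per T v \<longleftrightarrow> v \<in> borel_measurable borel \<and> (\<forall>y. v (y + T) = v y) \<and>
     set_integrable lborel {0..T} (\<lambda>y. (norm (v y))\<^sup>2)"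

text \<open>\<open>u\<close> is the continuous representative of a \<open>T\<close>-periodic \<open>H\<^sup>2\<close> function with derivative \<open>u'\<close>
  and weak second derivative \<open>u''\<close>, i.e. \<open>u'\<close> is absolutely continuous with \<open>u''\<close> in \<open>L\<^sup>2\<close>.\<close>

definition H2_per :: "real \<Rightarrow> (real \<Rightarrow> complex^2) \<Rightarrow> (real \<Rightarrow> complex^2) \<Rightarrow> (real \<Rightarrow> complex^2) \<Rightarrow> bool" where
  "H2_per T u u' u'' \<longleftrightarrow>
     (\<forall>y. u (y + T) = u y) \<and> (\<forall>y. u' (y + T) = u' y) \<and> L2_per T u'' \<and>
     (\<forall>y. (u has_vector_derivative u' y) (at y)) \<and>
     (\<forall>a b. a \<le> b \<longrightarrow> (u'' has_integral (u' b - u' a)) {a..b})"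

text \<open>The scalar operators act on a function through the values \<open>r, r', r''\<close> at \<open>y\<close> of the function
  and its first two derivatives.\<close>

definition K_op :: "(real \<Rightarrow> real) \<Rightarrow> real \<Rightarrow> complex \<Rightarrow> complex \<Rightarrow> complex" where
  "K_op S y r r' = of_real (deriv (deriv S) y) * r + 2 * of_real (deriv S y) * r'"

definition Lminus_op ::
  "(real \<Rightarrow> real) \<Rightarrow> real \<Rightarrow> real \<Rightarrow> (real \<Rightarrow> real) \<Rightarrow> (real \<Rightarrow> real) \<Rightarrow> real \<Rightarrow> complex \<Rightarrow> complex \<Rightarrow> complex"
  where "Lminus_op f \<omega> \<zeta> A S y r r'' =
    - of_real \<omega> * r - r'' + of_real ((deriv S y)\<^sup>2) * r - of_real (\<zeta> * f ((A y)\<^sup>2)) * r"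

definition Lplus_op ::
  "(real \<Rightarrow> real) \<Rightarrow> real \<Rightarrow> real \<Rightarrow> (real \<Rightarrow> real) \<Rightarrow> (real \<Rightarrow> real) \<Rightarrow> real \<Rightarrow> complex \<Rightarrow> complex \<Rightarrow> complex"
  where "Lplus_op f \<omega> \<zeta> A S y r r'' =
    Lminus_op f \<omega> \<zeta> A S y r r'' - of_real (2 * \<zeta> * deriv f ((A y)\<^sup>2) * (A y)\<^sup>2) * r"

text \<open>The graph of the unbounded operator \<open>L\<close> on \<open>L\<^sup>2\<close> with domain \<open>H\<^sup>2\<close> (periodic): \<open>(u, v)\<close> belongs
  to it iff \<open>u\<close> is in the domain and \<open>v = L u\<close> almost everywhere.\<close>

definition lin_op ::
  "(real \<Rightarrow> real) \<Rightarrow> real \<Rightarrow> real \<Rightarrow> real \<Rightarrow> (real \<Rightarrow> real) \<Rightarrow> (real \<Rightarrow> real) \<Rightarrow>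
   ((real \<Rightarrow> complex^2) \<times> (real \<Rightarrow> complex^2)) set" where
  "lin_op f T \<omega> \<zeta> A S = {(u, v). L2_per T v \<and>
     (\<exists>u' u''. H2_per T u u' u'' \<and>
       (AE y in lborel. v y = vector
          [K_op S y (u y $ 1) (u' y $ 1) - Lminus_op f \<omega> \<zeta> A S y (u y $ 2) (u'' y $ 2),
           Lplus_op f \<omega> \<zeta> A S y (u y $ 1) (u'' y $ 1) + K_op S y (u y $ 2) (u' y $ 2)]))}"

text \<open>The powers of \<open>L\<close> are the relational powers of its graph. Elements of the domain are continuous,
  so the members of \<open>ker_pow L k\<close> (for \<open>k > 0\<close>) represent distinct \<open>L\<^sup>2\<close> classes.\<close>

definition ker_pow :: "((real \<Rightarrow> complex^2) \<times> (real \<Rightarrow> complex^2)) set \<Rightarrow> nat \<Rightarrow> (real \<Rightarrow> complex^2) set" where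
  "ker_pow L k = {u. (u, 0) \<in> L ^^ k}"

definition gen_kernel :: "((real \<Rightarrow> complex^2) \<times> (real \<Rightarrow> complex^2)) set \<Rightarrow> (real \<Rightarrow> complex^2) set" where
  "gen_kernel L = (\<Union>k. ker_pow L k)"

text \<open>Jordan chains for the eigenvalue \<open>0\<close>, listed from the eigenvector upwards.\<close>

definition jordan_chain ::
  "((real \<Rightarrow> complex^2) \<times> (real \<Rightarrow> complex^2)) set \<Rightarrow> (real \<Rightarrow> complex^2) list \<Rightarrow> bool" where
  "jordan_chain L us \<longleftrightarrow> us \<noteq> [] \<and> us ! 0 \<noteq> 0 \<and> (us ! 0, 0) \<in> L \<and>
     (\<forall>i. Suc i < length us \<longrightarrow> (us ! Suc i, us ! i) \<in> L)"

text \<open>A row vector \<open>v\<close> acts on column vectors without complex conjugation.\<close>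

definition row_pairing :: "real \<Rightarrow> (real \<Rightarrow> complex^2) \<Rightarrow> (real \<Rightarrow> complex^2) \<Rightarrow> complex" where
  "row_pairing T v u = integral {0..T} (\<lambda>y. \<Sum>i\<in>UNIV. v y $ i * u y $ i)"

text \<open>The relation \<open>v L = w\<close> for row vectors \<open>v\<close>, \<open>w\<close>.\<close>

definition left_mult ::
  "real \<Rightarrow> (real \<Rightarrow> complex^2) \<Rightarrow> ((real \<Rightarrow> complex^2) \<times> (real \<Rightarrow> complex^2)) set \<Rightarrow>
   (real \<Rightarrow> complex^2) \<Rightarrow> bool" where
  "left_mult T v L w \<longleftrightarrow> L2_per T v \<and> L2_per T w \<and>
     (\<forall>(u, z) \<in> L. row_pairing T v z = row_pairing T w u)"

definition cvec :: "real \<Rightarrow> real \<Rightarrow> complex^2" where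
  "cvec a b = vector [of_real a, of_real b]"

definition Jmat :: "complex^2^2" where
  "Jmat = vector [vector [0, -1], vector [1, 0]]"

definition ker_mat :: "real^'n^'n \<Rightarrow> (real^'n) set" where
  "ker_mat B = {x. B *v x = 0}"

end

theory Submission
  imports Defs "HOL-Library.Periodic_Fun"
begin

text \<open>The derivatives \<open>\<phi>\<^sub>a = (A\<^sub>a, A S\<^sub>a)\<close> of the wave in a parameter \<open>a\<close> solve \<open>L \<phi>\<^sub>E = L \<phi>\<^sub>\<kappa> = 0\<close> and
  \<open>L \<phi>\<^sub>\<omega> = p\<^sub>0\<close> on the line, where \<open>p\<^sub>0 = (0, A)\<close> and \<open>p\<^sub>2 = (A\<^sub>y, A S\<^sub>y)\<close> are the symmetry modes, and they fail
  to be periodic by \<open>\<phi>\<^sub>a(y + T) - \<phi>\<^sub>a(y) = - T\<^sub>a p\<^sub>2 + \<eta>\<^sub>a p\<^sub>0\<close>. Since \<open>p\<^sub>0, p\<^sub>2, \<phi>\<^sub>E, \<phi>\<^sub>\<kappa>\<close> span the solutions of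
  \<open>L u = 0\<close> on the line and \<open>L (0, y A / 2) = p\<^sub>2\<close>, the kernels of \<open>L\<close> and \<open>L\<^sup>2\<close> consist of those combinations
  of \<open>p\<^sub>0, p\<^sub>2, \<phi>\<^sub>E, \<phi>\<^sub>\<kappa>, \<phi>\<^sub>\<omega>, (0, y A / 2)\<close> whose defect vanishes. For periodic \<open>g\<close> the equation \<open>L u = g\<close> has a
  solution on the line, and by Green's identity the components of its defect along \<open>\<phi>\<^sub>E, \<phi>\<^sub>\<kappa>\<close> are the pairings of
  \<open>g\<close> with \<open>p\<^sub>2, p\<^sub>0\<close>; the remaining defect can be removed when \<open>\<sigma> \<noteq> 0\<close>. The first two rows of \<open>D\<close>
  express that \<open>g\<close> is periodic and the last two that these pairings vanish. The second derivatives
  of \<open>K\<close> enter through \<open>K\<^sub>E = T\<close>, \<open>K\<^sub>\<kappa> = - \<eta>\<close>, \<open>K\<^sub>\<omega> = - M / 2\<close>.\<close>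

subsection \<open>Linear differential equations\<close>

text \<open>Three of the four moments have integrands that blow up at endpoints moving with the
  parameters, so no moment is differentiated as an integral over \<open>[a, b]\<close>. Each is
  rewritten as the value at \<open>y = T\<close> of an antiderivative along the wave, and the waves
  are differentiated as solutions of initial value problems. The rewriting needs \<open>A\<close> to
  increase on the whole half period; the profile conditions do not say so, and it is recovered from
  the definition of \<open>T\<close> as an integral. The derivative of \<open>T\<close> comes from
  \<open>A_y = 0\<close> at \<open>T / 2\<close>, where \<open>A_yy\<close> is nonzero because the
  root of \<open>R\<close> is simple; continuity of \<open>T\<close> has to be shown first.

  The first derivatives of \<open>K\<close> have their simple form because the integrand
  \<open>2 A_y z_y\<close> of its variation is, by the varied energy identity, an exact derivative
  plus half the explicit variation of \<open>R\<close>.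

  The operator is given on weakly differentiable functions, with equality almost everywhere. Along
  the kernels of its powers all right-hand sides are continuous, so the solutions are classical;
  weak second derivatives matter only for the row vectors, which are tested on the whole
  domain.\<close>

lemma gronwall:
  fixes x :: "real \<Rightarrow> 'a::real_inner"
  assumes der: "\<And>t. \<bar>t\<bar> \<le> Y \<Longrightarrow> (x has_vector_derivative x' t) (at t)"
    and bnd: "\<And>t. \<bar>t\<bar> \<le> Y \<Longrightarrow> norm (x' t) \<le> C * norm (x t) + e"
    and C: "0 \<le> C" and e: "0 \<le> e" and x0: "norm (x 0) \<le> d" and y: "\<bar>y\<bar> \<le> Y"
  shows "norm (x y) \<le> (d + e) * exp ((C + 1) * Y)"
proof -
  have main: "norm (u y) \<le> (d + e) * exp ((C + 1) * Y)"
    if der: "\<And>t. \<bar>t\<bar> \<le> Y \<Longrightarrow> (u has_vector_derivative u' t) (at t)"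
      and bnd: "\<And>t. \<bar>t\<bar> \<le> Y \<Longrightarrow> norm (u' t) \<le> C * norm (u t) + e"
      and u0: "norm (u 0) \<le> d" and y: "0 \<le> y" "y \<le> Y" for u u' :: "real \<Rightarrow> 'a" and y
  proof -
    \<comment> \<open>The summand \<open>e\<^sup>2\<close> absorbs the inhomogeneity: since
      \<open>2 * e * n \<le> n\<^sup>2 + e\<^sup>2\<close>, the derivative of
      \<open>u \<bullet> u + e\<^sup>2\<close> is at most \<open>k\<close> times that function, so
      the weighted function decreases. Negative times are treated by reflection.\<close>
    define k where "k = 2 * (C + 1)"
    define \<phi> where "\<phi> = (\<lambda>t. (u t \<bullet> u t + e\<^sup>2) * exp (- k * t))"
    have d\<phi>: "(\<phi> has_real_derivative
        ((2 * (u t \<bullet> u' t) - k * (u t \<bullet> u t + e\<^sup>2)) * exp (- k * t))) (at t)" if "\<bar>t\<bar> \<le> Y" for t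
    proof -
      have "((\<lambda>t. u t \<bullet> u t) has_derivative (\<lambda>h. u t \<bullet> (h *\<^sub>R u' t) + (h *\<^sub>R u' t) \<bullet> u t)) (at t)"
        using der[OF that] unfolding has_vector_derivative_def
        by (rule has_derivative_inner[OF _ der[OF that, unfolded has_vector_derivative_def]])
      then have "((\<lambda>t. u t \<bullet> u t) has_real_derivative 2 * (u t \<bullet> u' t)) (at t)"
        unfolding has_field_derivative_def
        by (rule back_subst[of "\<lambda>D. (_ has_derivative D) _"])
           (auto simp: fun_eq_iff inner_commute algebra_simps)
      note this[derivative_intros]
      show ?thesis unfolding \<phi>_def
        by (auto intro!: derivative_eq_intros simp: algebra_simps)
    qed
    have "\<phi> y \<le> \<phi> 0"
    proof (rule DERIV_nonpos_imp_nonincreasing[OF y(1)])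
      fix t assume t: "0 \<le> t" "t \<le> y"
      then have tY: "\<bar>t\<bar> \<le> Y" using y by auto
      let ?n = "norm (u t)"
      have "u t \<bullet> u' t \<le> ?n * norm (u' t)" by (rule norm_cauchy_schwarz)
      also have "\<dots> \<le> ?n * (C * ?n + e)" using bnd[OF tY] by (simp add: mult_left_mono)
      finally have 1: "2 * (u t \<bullet> u' t) \<le> 2 * C * ?n\<^sup>2 + 2 * e * ?n"
        by (simp add: algebra_simps power2_eq_square)
      have 2: "2 * e * ?n \<le> ?n\<^sup>2 + e\<^sup>2"
        using sum_squares_bound[of e ?n] by (simp add: power2_eq_square)
      have 3: "0 \<le> C * e\<^sup>2" "0 \<le> ?n\<^sup>2" "0 \<le> e\<^sup>2" using C by auto
      have "2 * (u t \<bullet> u' t) - k * (u t \<bullet> u t + e\<^sup>2) \<le> 0"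
      proof -
        have "2 * (u t \<bullet> u' t) - k * (u t \<bullet> u t + e\<^sup>2) =
            2 * (u t \<bullet> u' t) - (2 * C * ?n\<^sup>2 + 2 * (C * e\<^sup>2) + 2 * ?n\<^sup>2 + 2 * e\<^sup>2)"
          unfolding k_def by (simp add: power2_norm_eq_inner[symmetric] algebra_simps)
        then show ?thesis using 1 2 3 by linarith
      qed
      then show "\<exists>D. (\<phi> has_real_derivative D) (at t) \<and> D \<le> 0"
        using d\<phi>[OF tY] by (meson exp_ge_zero mult_nonpos_nonneg)
    qed
    then have "(u y \<bullet> u y + e\<^sup>2) * exp (- k * y) \<le> u 0 \<bullet> u 0 + e\<^sup>2"
      by (simp add: \<phi>_def)
    then have "u y \<bullet> u y + e\<^sup>2 \<le> (u 0 \<bullet> u 0 + e\<^sup>2) * exp (k * y)"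
      by (simp add: exp_minus field_simps)
    also have "\<dots> \<le> (d + e)\<^sup>2 * exp (k * Y)"
    proof (rule mult_mono)
      have "d \<ge> 0" using u0 norm_ge_zero order_trans by blast
      have "u 0 \<bullet> u 0 \<le> d\<^sup>2" using u0 by (simp add: power2_norm_eq_inner[symmetric] power_mono)
      then show "u 0 \<bullet> u 0 + e\<^sup>2 \<le> (d + e)\<^sup>2"
        using mult_nonneg_nonneg[OF \<open>d \<ge> 0\<close> e] by (simp add: power2_sum)
      show "exp (k * y) \<le> exp (k * Y)" using y C by (simp add: k_def)
    qed auto
    also have "\<dots> = ((d + e) * exp ((C + 1) * Y))\<^sup>2"
      by (simp add: k_def power_mult_distrib exp_double[symmetric] mult.assoc)
    finally have "(norm (u y))\<^sup>2 \<le> ((d + e) * exp ((C + 1) * Y))\<^sup>2"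
      by (simp add: power2_norm_eq_inner) (smt (verit) zero_le_power2)
    moreover have "0 \<le> (d + e) * exp ((C + 1) * Y)"
      using u0 e by (smt (verit) exp_ge_zero mult_nonneg_nonneg norm_ge_zero)
    ultimately show ?thesis by (rule power2_le_imp_le)
  qed
  show ?thesis
  proof (cases "0 \<le> y")
    case True
    show ?thesis by (rule main[OF der bnd x0 True]) (use y in auto)
  next
    case False
    have "norm ((x \<circ> uminus) (- y)) \<le> (d + e) * exp ((C + 1) * Y)"
    proof (rule main[where u' = "\<lambda>t. - x' (- t)"])
      fix t :: real assume t: "\<bar>t\<bar> \<le> Y"
      then have "(x has_vector_derivative x' (- t)) (at (- t))" using der by auto
      then have "((x \<circ> uminus) has_vector_derivative (-1) *\<^sub>R x' (- t)) (at t)"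
        by (intro vector_diff_chain_at) (auto intro!: derivative_eq_intros)
      then show "((x \<circ> uminus) has_vector_derivative - x' (- t)) (at t)" by simp
      show "norm (- x' (- t)) \<le> C * norm ((x \<circ> uminus) t) + e" using bnd[of "-t"] t by auto
    qed (use False y x0 in auto)
    then show ?thesis by simp
  qed
qed

lemma linear_ode_unique:
  fixes x :: "real \<Rightarrow> 'a::real_inner"
  assumes "\<And>t. (x has_vector_derivative x' t) (at t)" "\<And>t. norm (x' t) \<le> C * norm (x t)" "x 0 = 0"
  shows "x y = 0"
proof -
  have "norm (x y) \<le> (0 + 0) * exp ((max C 0 + 1) * \<bar>y\<bar>)"
  proof (rule gronwall[where x' = x'])
    fix t
    have "C * norm (x t) \<le> max C 0 * norm (x t)" by (simp add: mult_right_mono)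
    then show "norm (x' t) \<le> max C 0 * norm (x t) + 0" using assms(2)[of t] by simp
  qed (use assms in auto)
  then show ?thesis by simp
qed

lemma antiderivative_exists:
  fixes h :: "real \<Rightarrow> 'a::euclidean_space"
  assumes "continuous_on UNIV h"
  shows "\<exists>H. H 0 = 0 \<and> (\<forall>y. (H has_vector_derivative h y) (at y))"
proof -
  obtain F where F: "\<And>x. (F has_vector_derivative h x) (at x)"
    using einterval_antiderivative[of "-\<infinity>" "\<infinity>" h] assms
    by (auto simp: continuous_on_eq_continuous_at)
  have "((\<lambda>y. F y - F 0) has_vector_derivative h y) (at y)" for y
    using F[of y] by (auto intro!: derivative_eq_intros)
  then show ?thesis by (intro exI[of _ "\<lambda>y. F y - F 0"]) auto
qed

text \<open>In the norm weighted by \<open>exp (- 2 C \<bar>y\<bar>)\<close> each Picard step is a contraction by \<open>1 / 2\<close>.\<close>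

lemma exp_weighted_bound:
  fixes H :: "real \<Rightarrow> 'a::real_normed_vector"
  assumes der: "\<And>t. (H has_vector_derivative h t) (at t)" and H0: "H 0 = 0"
    and bnd: "\<And>t. \<bar>t\<bar> \<le> Y \<Longrightarrow> norm (h t) \<le> C * (K * exp (2 * C * \<bar>t\<bar>))"
    and K: "0 \<le> K" and y: "\<bar>y\<bar> \<le> Y"
  shows "norm (H y) \<le> K / 2 * exp (2 * C * \<bar>y\<bar>)"
proof -
  have main: "norm (H y) \<le> K / 2 * exp (2 * C * y)"
    if der: "\<And>t. (H has_vector_derivative h t) (at t)" and H0: "H 0 = 0"
      and bnd: "\<And>t. \<bar>t\<bar> \<le> Y \<Longrightarrow> norm (h t) \<le> C * (K * exp (2 * C * \<bar>t\<bar>))"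
      and y: "0 < y" "y \<le> Y" for H h :: "real \<Rightarrow> 'a" and y
  proof -
    have "norm (H y - H 0) \<le> K / 2 * exp (2 * C * y) - K / 2 * exp (2 * C * 0)"
    proof (rule differentiable_bound_general[OF y(1), where f' = h and \<phi>' = "\<lambda>t. C * (K * exp (2 * C * t))"])
      show "continuous_on {0..y} H"
        using der has_vector_derivative_continuous
        by (metis continuous_at_imp_continuous_on)
      show "((\<lambda>t. K / 2 * exp (2 * C * t)) has_vector_derivative C * (K * exp (2 * C * t))) (at t)" for t
        unfolding has_real_derivative_iff_has_vector_derivative[symmetric]
        by (auto intro!: derivative_eq_intros)
    next
      fix t assume "0 < t" "t < y"
      then show "norm (h t) \<le> C * (K * exp (2 * C * t))" using bnd[of t] y by auto
    qed (auto intro!: continuous_intros der)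
    then show ?thesis using H0 K by auto
  qed
  consider "y = 0" | "y > 0" | "y < 0" by linarith
  then show ?thesis
  proof cases
    case 1 then show ?thesis using H0 K by auto
  next
    case 2 then show ?thesis using main[OF der H0 bnd 2] y by auto
  next
    case 3
    have "norm ((H \<circ> uminus) (- y)) \<le> K / 2 * exp (2 * C * (- y))"
    proof (rule main[where h = "\<lambda>t. - h (- t)"])
      fix t :: real
      have "((H \<circ> uminus) has_vector_derivative (-1) *\<^sub>R h (- t)) (at t)"
        by (intro vector_diff_chain_at der) (auto intro!: derivative_eq_intros)
      then show "((H \<circ> uminus) has_vector_derivative - h (- t)) (at t)" by simp
      assume "\<bar>t\<bar> \<le> Y"
      then show "norm (- h (- t)) \<le> C * (K * exp (2 * C * \<bar>t\<bar>))" using bnd[of "-t"] by auto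
    qed (use 3 y H0 in auto)
    then show ?thesis using 3 by simp
  qed
qed

text \<open>Picard iteration, written as the series of its increments \<open>d n\<close>. In the
  weighted norm they decay like \<open>1 / 2 ^ n\<close> on every compact interval, so one series
  converges on the whole line, without continuation from short intervals, and it can be
  differentiated term by term.\<close>

lemma linear_ode_exists:
  fixes P :: "real \<Rightarrow> 'a::euclidean_space \<Rightarrow> 'a"
  assumes lin: "\<And>y. linear (P y)" and bnd: "\<And>y x. norm (P y x) \<le> C * norm x"
    and cont: "\<And>x. continuous_on UNIV x \<Longrightarrow> continuous_on UNIV (\<lambda>y. P y (x y))"
    and g: "continuous_on UNIV g"
  shows "\<exists>x. x 0 = c \<and> (\<forall>y. (x has_vector_derivative P y (x y) + g y) (at y))"
proof -
  have C: "0 \<le> C"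
  proof -
    obtain b :: 'a where "norm b = 1" using SOME_Basis norm_Basis by blast
    then have "norm (P 0 b) \<le> C" using bnd[of 0 b] by simp
    then show ?thesis using norm_ge_zero order_trans by blast
  qed
  define ant where "ant h = (SOME H. H 0 = 0 \<and> (\<forall>y. (H has_vector_derivative h y) (at y)))"
    for h :: "real \<Rightarrow> 'a"
  have ant: "ant h 0 = 0 \<and> (\<forall>y. (ant h has_vector_derivative h y) (at y))"
    if "continuous_on UNIV h" for h
    unfolding ant_def by (rule someI_ex[OF antiderivative_exists[OF that]])
  have antc: "continuous_on UNIV (ant h)" if "continuous_on UNIV h" for h
    using ant[OF that] has_vector_derivative_continuous by (metis continuous_at_imp_continuous_on)
  \<comment> \<open>The increment \<open>d 0\<close> carries the initial value and the source
    \<open>g\<close>; all later increments vanish at 0, so the sum keeps the initial value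
    \<open>c\<close>.\<close>
  define d where "d = rec_nat (\<lambda>y. c + ant g y) (\<lambda>_ x. ant (\<lambda>t. P t (x t)))"
  have d0: "d 0 = (\<lambda>y. c + ant g y)" and dS: "d (Suc n) = ant (\<lambda>t. P t (d n t))" for n
    by (simp_all add: d_def)
  have dc: "continuous_on UNIV (d n)" for n
    by (induction n) (auto simp: d0 dS intro!: continuous_intros antc g cont)
  have dSd: "(d (Suc n) has_vector_derivative P y (d n y)) (at y)" "d (Suc n) 0 = 0" for n y
    using ant[OF cont[OF dc[of n]]] by (auto simp: dS)
  have d0d: "(d 0 has_vector_derivative g y) (at y)" "d 0 0 = c" for y
    using ant[OF g] unfolding d0 by (auto intro!: derivative_eq_intros)
  have "\<exists>B\<ge>0. \<forall>n y. \<bar>y\<bar> \<le> Y \<longrightarrow> norm (d n y) \<le> B / 2 ^ n * exp (2 * C * \<bar>y\<bar>)" for Y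
  proof -
    have "bounded (d 0 ` {-Y..Y})"
      by (rule compact_imp_bounded, rule compact_continuous_image)
         (auto intro: continuous_on_subset[OF dc])
    then obtain B where B: "B > 0" "\<And>y. \<bar>y\<bar> \<le> Y \<Longrightarrow> norm (d 0 y) \<le> B"
      unfolding bounded_pos by (auto simp: abs_le_iff)
    have "norm (d n y) \<le> B / 2 ^ n * exp (2 * C * \<bar>y\<bar>)" if "\<bar>y\<bar> \<le> Y" for n y
      using that
    proof (induction n arbitrary: y)
      case 0
      have "1 \<le> exp (2 * C * \<bar>y\<bar>)" using C by auto
      then have "B * 1 \<le> B * exp (2 * C * \<bar>y\<bar>)" using B(1) by (intro mult_left_mono) auto
      then show ?case using B(2)[OF 0] by simp
    next
      case (Suc n)
      have "norm (d (Suc n) y) \<le> (B / 2 ^ n) / 2 * exp (2 * C * \<bar>y\<bar>)"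
      proof (rule exp_weighted_bound[OF dSd(1) dSd(2)])
        fix t assume "\<bar>t\<bar> \<le> Y"
        from Suc.IH[OF this] C
        have "C * norm (d n t) \<le> C * (B / 2 ^ n * exp (2 * C * \<bar>t\<bar>))" by (rule mult_left_mono)
        then show "norm (P t (d n t)) \<le> C * (B / 2 ^ n * exp (2 * C * \<bar>t\<bar>))"
          using bnd[of t "d n t"] by linarith
      qed (use Suc.prems B in auto)
      then show ?case by simp
    qed
    then show ?thesis using B(1) by (intro exI[of _ B]) auto
  qed
  then obtain B where B: "\<And>Y. B Y \<ge> 0"
    "\<And>n y Y. \<bar>y\<bar> \<le> Y \<Longrightarrow> norm (d n y) \<le> B Y / 2 ^ n * exp (2 * C * \<bar>y\<bar>)" by metis
  define x where "x y = (\<Sum>n. d n y)" for y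
  have bY: "norm (d n y) \<le> (B Y * exp (2 * C * Y)) * (1/2) ^ n" if "\<bar>y\<bar> \<le> Y" for n y Y
  proof -
    have "norm (d n y) \<le> B Y / 2 ^ n * exp (2 * C * \<bar>y\<bar>)" by (rule B(2)[OF that])
    also have "\<dots> \<le> B Y / 2 ^ n * exp (2 * C * Y)"
      using B(1)[of Y] C that by (intro mult_left_mono) (auto intro: mult_left_mono)
    finally show ?thesis by (simp add: power_divide)
  qed
  have geo: "summable (\<lambda>n. (B Y * exp (2 * C * Y)) * (1/2) ^ n)" for Y
    by (intro summable_mult summable_geometric) auto
  have sms: "summable (\<lambda>n. d n y)" for y
    by (rule summable_comparison_test[OF _ geo[of "\<bar>y\<bar>"]]) (use bY[of y "\<bar>y\<bar>"] in auto)
  have uni: "uniform_limit {-Y..Y} (\<lambda>n y. \<Sum>i<n. d i y) x sequentially" for Y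
    unfolding x_def by (rule Weierstrass_m_test[OF _ geo[of Y]]) (use bY in auto)
  have der: "(x has_vector_derivative P y (x y) + g y) (at y)" for y
  proof -
    define Y where "Y = \<bar>y\<bar> + 1"
    define f' where "f' n y h = h *\<^sub>R (case n of 0 \<Rightarrow> g y | Suc m \<Rightarrow> P y (d m y))"
      for n and y h :: real
    have "\<exists>z. \<forall>t\<in>{-Y..Y}. (\<lambda>n. d n t) sums z t \<and>
        (z has_derivative (\<lambda>h. h *\<^sub>R (P t (x t) + g t))) (at t within {-Y..Y})"
    proof (rule has_derivative_series[where f' = f' and x = 0])
      fix n t
      show "(d n has_derivative f' n t) (at t within {-Y..Y})"
        using d0d(1)[of t] dSd(1)[of _ t] unfolding f'_def has_vector_derivative_def
        by (cases n) (auto intro: has_derivative_at_withinI)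
    next
      fix e :: real assume e: "e > 0"
      have "\<forall>\<^sub>F n in sequentially. \<forall>t\<in>{-Y..Y}. dist (\<Sum>i<n. d i t) (x t) < e / (C + 1)"
        using uni[of Y] e C unfolding uniform_limit_iff by auto
      \<comment> \<open>The derivatives of the first \<open>n + 1\<close> increments add up to
        \<open>g\<close> plus \<open>P\<close> of the sum of the first \<open>n\<close> increments;
        hence the shifted index, and uniform convergence of the derivatives follows from that of the
        sums.\<close>
      then have "\<forall>\<^sub>F n in sequentially. \<forall>t\<in>{-Y..Y}. \<forall>h.
          norm ((\<Sum>i<Suc n. f' i t h) - h *\<^sub>R (P t (x t) + g t)) \<le> e * norm h"
      proof eventually_elim
        case (elim n)
        show ?case
        proof safe
          fix t h assume t: "t \<in> {-Y..Y}"
          have "(\<Sum>i<Suc n. f' i t h) = h *\<^sub>R g t + (\<Sum>i<n. h *\<^sub>R P t (d i t))"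
            by (simp add: sum.lessThan_Suc_shift f'_def del: sum.lessThan_Suc)
          also have "\<dots> = h *\<^sub>R (P t (\<Sum>i<n. d i t) + g t)"
            by (simp add: linear_sum[OF lin] scaleR_sum_right algebra_simps)
          finally have "(\<Sum>i<Suc n. f' i t h) - h *\<^sub>R (P t (x t) + g t)
              = h *\<^sub>R P t ((\<Sum>i<n. d i t) - x t)"
            by (simp add: linear_diff[OF lin] algebra_simps)
          moreover have "norm (P t ((\<Sum>i<n. d i t) - x t)) \<le> e"
          proof -
            have "norm (P t ((\<Sum>i<n. d i t) - x t)) \<le> C * norm ((\<Sum>i<n. d i t) - x t)"
              by (rule bnd)
            also have "\<dots> \<le> C * (e / (C + 1))"
              using elim t C by (intro mult_left_mono) (auto simp: dist_norm less_imp_le)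
            also have "\<dots> \<le> e" using C e by (simp add: field_simps)
            finally show ?thesis .
          qed
          ultimately show "norm ((\<Sum>i<Suc n. f' i t h) - h *\<^sub>R (P t (x t) + g t)) \<le> e * norm h"
            by (simp add: mult.commute[of e] mult_left_mono del: sum.lessThan_Suc)
        qed
      qed
      then show "\<forall>\<^sub>F n in sequentially. \<forall>t\<in>{-Y..Y}. \<forall>h.
          norm ((\<Sum>i<n. f' i t h) - h *\<^sub>R (P t (x t) + g t)) \<le> e * norm h"
        by (rule eventually_sequentially_Suc[THEN iffD1])
    qed (use sms[of 0] in \<open>auto simp: Y_def summable_sums\<close>)
    then obtain z where z: "\<And>t. t \<in> {-Y..Y} \<Longrightarrow> (\<lambda>n. d n t) sums z t"
      "\<And>t. t \<in> {-Y..Y} \<Longrightarrow> (z has_derivative (\<lambda>h. h *\<^sub>R (P t (x t) + g t))) (at t within {-Y..Y})"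
      by blast
    have zx: "z t = x t" if "t \<in> {-Y..Y}" for t
      using z(1)[OF that] by (simp add: x_def sums_iff)
    have yY: "y \<in> {-Y<..<Y}" by (auto simp: Y_def)
    then have "(z has_derivative (\<lambda>h. h *\<^sub>R (P y (x y) + g y))) (at y within {-Y<..<Y})"
      by (intro has_derivative_subset[OF z(2)]) auto
    then have "(z has_derivative (\<lambda>h. h *\<^sub>R (P y (x y) + g y))) (at y)"
      by (simp only: at_within_open[OF yY open_greaterThanLessThan])
    then have "(x has_derivative (\<lambda>h. h *\<^sub>R (P y (x y) + g y))) (at y)"
      by (rule has_derivative_transform_within_open[where s = "{-Y<..<Y}"]) (use yY zx in auto)
    then show ?thesis by (simp add: has_vector_derivative_def)
  qed
  have "(\<lambda>n. d n 0) = (\<lambda>n. if n = 0 then c else 0)"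
  proof
    show "d n 0 = (if n = 0 then c else 0)" for n using d0d(2) dSd(2) by (cases n) auto
  qed
  then have "x 0 = c" unfolding x_def using sums_unique[OF sums_single[of 0 "\<lambda>_. c"]] by metis
  then show ?thesis using der by blast
qed

subsection \<open>Differentiability in a parameter, uniformly on compact intervals\<close>

text \<open>A first-order expansion at \<open>s = 0\<close>. Uniformity in \<open>y\<close> is what
  allows it to be integrated in \<open>y\<close> and evaluated at a moving point such as the period.
  In multiplied form there is no division by \<open>s\<close>, so the filter may contain
  \<open>s = 0\<close>.\<close>

definition udiff :: "(real \<Rightarrow> real \<Rightarrow> real) \<Rightarrow> (real \<Rightarrow> real) \<Rightarrow> bool" where
  "udiff x z \<longleftrightarrow> (\<forall>Y. \<forall>e>0. \<forall>\<^sub>F s in nhds 0. \<forall>y. \<bar>y\<bar> \<le> Y \<longrightarrow>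
     \<bar>x s y - x 0 y - s * z y\<bar> \<le> e * \<bar>s\<bar>)"

lemma udiffD:
  "udiff x z \<Longrightarrow> e > 0 \<Longrightarrow> \<forall>\<^sub>F s in nhds 0. \<forall>y. \<bar>y\<bar> \<le> Y \<longrightarrow> \<bar>x s y - x 0 y - s * z y\<bar> \<le> e * \<bar>s\<bar>"
  unfolding udiff_def by blast

lemma has_real_derivative_0I:
  assumes "\<And>e. e > 0 \<Longrightarrow> \<forall>\<^sub>F s in nhds 0. \<bar>\<phi> s - \<phi> 0 - s * D\<bar> \<le> e * \<bar>s\<bar>"
  shows "(\<phi> has_real_derivative D) (at (0::real))"
  unfolding has_field_derivative_iff
proof (rule tendstoI)
  fix e :: real assume "e > 0"
  then have "\<forall>\<^sub>F s in at 0. \<bar>\<phi> s - \<phi> 0 - s * D\<bar> \<le> e / 2 * \<bar>s\<bar>"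
    using assms[of "e / 2"] by (simp add: eventually_nhds_conv_at)
  moreover have "\<forall>\<^sub>F s in at (0::real). s \<noteq> 0" by (rule eventually_neq_at_within)
  ultimately show "\<forall>\<^sub>F s in at 0. dist ((\<phi> s - \<phi> 0) / (s - 0)) D < e"
  proof eventually_elim
    case (elim s)
    have "(\<phi> s - \<phi> 0) / s - D = (\<phi> s - \<phi> 0 - s * D) / s" using elim by (simp add: field_simps)
    then have "\<bar>(\<phi> s - \<phi> 0) / s - D\<bar> \<le> e / 2" using elim by (simp add: field_simps)
    then show ?case using \<open>e > 0\<close> by (simp add: dist_real_def)
  qed
qed

lemma has_real_derivative_0D:
  assumes "(\<phi> has_real_derivative D) (at (0::real))" and "e > 0"
  shows "\<forall>\<^sub>F s in nhds 0. \<bar>\<phi> s - \<phi> 0 - s * D\<bar> \<le> e * \<bar>s\<bar>"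
proof -
  have "\<forall>\<^sub>F s in at 0. dist ((\<phi> (0 + s) - \<phi> 0) / (s - 0)) D < e"
    using assms tendstoD has_field_derivative_iff by fastforce
  moreover have "\<forall>\<^sub>F s in at (0::real). s \<noteq> 0" by (rule eventually_neq_at_within)
  ultimately have "\<forall>\<^sub>F s in at 0. \<bar>\<phi> s - \<phi> 0 - s * D\<bar> \<le> e * \<bar>s\<bar>"
  proof eventually_elim
    case (elim s)
    have "\<phi> s - \<phi> 0 - s * D = ((\<phi> s - \<phi> 0) / s - D) * s" using elim by (simp add: field_simps)
    then show ?case using elim by (simp add: abs_mult dist_real_def mult_right_mono)
  qed
  then show ?thesis by (simp add: eventually_nhds_conv_at)
qed

lemma udiff_pointwise:
  assumes "udiff x z" shows "((\<lambda>s. x s y) has_real_derivative z y) (at 0)"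
proof (rule has_real_derivative_0I)
  fix e :: real assume "e > 0"
  from udiffD[OF assms this, of "\<bar>y\<bar>"]
  show "\<forall>\<^sub>F s in nhds 0. \<bar>x s y - x 0 y - s * z y\<bar> \<le> e * \<bar>s\<bar>"
    by (rule eventually_mono) auto
qed

lemma udiff_const: "udiff (\<lambda>s y. c + s * k) (\<lambda>y. k)"
  unfolding udiff_def by simp

lemma continuous_bounded_compact:
  fixes z :: "real \<Rightarrow> real"
  assumes "continuous_on UNIV z"
  obtains C where "C > 0" "\<And>y. \<bar>y\<bar> \<le> Y \<Longrightarrow> \<bar>z y\<bar> \<le> C"
proof -
  have "bounded (z ` {-Y..Y})"
    by (intro compact_imp_bounded compact_continuous_image continuous_on_subset[OF assms]) auto
  then show ?thesis using that unfolding bounded_pos by (auto simp: abs_le_iff)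
qed

lemma udiff_lipschitz:
  assumes u: "udiff x z" and z: "continuous_on UNIV z"
  obtains C where "C > 0" "\<forall>\<^sub>F s in nhds 0. \<forall>y. \<bar>y\<bar> \<le> Y \<longrightarrow> \<bar>x s y - x 0 y\<bar> \<le> C * \<bar>s\<bar>"
proof -
  obtain B where B: "B > 0" "\<And>y. \<bar>y\<bar> \<le> Y \<Longrightarrow> \<bar>z y\<bar> \<le> B"
    using continuous_bounded_compact[OF z] by metis
  have "\<forall>\<^sub>F s in nhds 0. \<forall>y. \<bar>y\<bar> \<le> Y \<longrightarrow> \<bar>x s y - x 0 y\<bar> \<le> (1 + B) * \<bar>s\<bar>"
    using udiffD[OF u zero_less_one, of Y]
  proof eventually_elim
    case (elim s)
    show ?case
    proof safe
      fix y assume y: "\<bar>y\<bar> \<le> Y"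
      have "\<bar>s * z y\<bar> \<le> B * \<bar>s\<bar>" using B(2)[OF y] by (simp add: abs_mult mult.commute[of B] mult_left_mono)
      then show "\<bar>x s y - x 0 y\<bar> \<le> (1 + B) * \<bar>s\<bar>"
        using elim[rule_format, OF y] by (simp add: algebra_simps)
    qed
  qed
  then show ?thesis using B(1) that[of "1 + B"] by auto
qed

lemma eventually_small: "e > 0 \<Longrightarrow> \<forall>\<^sub>F s in nhds (0::real). \<bar>s\<bar> < e"
  unfolding eventually_nhds_metric by (auto simp: dist_real_def)

lemma udiff_mult:
  assumes u1: "udiff x1 z1" and u2: "udiff x2 z2"
    and c: "continuous_on UNIV z1" "continuous_on UNIV z2" "continuous_on UNIV (x1 0)" "continuous_on UNIV (x2 0)"
  shows "udiff (\<lambda>s y. x1 s y * x2 s y) (\<lambda>y. z1 y * x2 0 y + x1 0 y * z2 y)"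
  unfolding udiff_def
proof (intro allI impI)
  fix Y e :: real assume e: "e > 0"
  obtain B1 where B1: "B1 > 0" "\<And>y. \<bar>y\<bar> \<le> Y \<Longrightarrow> \<bar>z1 y\<bar> \<le> B1"
    using continuous_bounded_compact[OF c(1)] by metis
  obtain B3 where B3: "B3 > 0" "\<And>y. \<bar>y\<bar> \<le> Y \<Longrightarrow> \<bar>x1 0 y\<bar> \<le> B3"
    using continuous_bounded_compact[OF c(3)] by metis
  obtain B4 where B4: "B4 > 0" "\<And>y. \<bar>y\<bar> \<le> Y \<Longrightarrow> \<bar>x2 0 y\<bar> \<le> B4"
    using continuous_bounded_compact[OF c(4)] by metis
  obtain C where C: "C > 0" "\<forall>\<^sub>F s in nhds 0. \<forall>y. \<bar>y\<bar> \<le> Y \<longrightarrow> \<bar>x2 s y - x2 0 y\<bar> \<le> C * \<bar>s\<bar>"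
    by (rule udiff_lipschitz[OF u2 c(2)])
  \<comment> \<open>The error of the product is (error of \<open>x1\<close>) times
    \<open>x2 s\<close>, plus \<open>s * z1\<close> times the increment of \<open>x2\<close>, plus
    \<open>x1 0\<close> times (error of \<open>x2\<close>). Each summand receives
    \<open>e / 3\<close>; the middle one is quadratic in \<open>s\<close> by the Lipschitz
    bound.\<close>
  define e1 where "e1 = e / (3 * (B4 + C))"
  define e2 where "e2 = e / (3 * B3)"
  define e3 where "e3 = e / (3 * (B1 * C))"
  have pos: "e1 > 0" "e2 > 0" "e3 > 0" using e B1 B3 B4 C by (auto simp: e1_def e2_def e3_def)
  show "\<forall>\<^sub>F s in nhds 0. \<forall>y. \<bar>y\<bar> \<le> Y \<longrightarrow>
     \<bar>x1 s y * x2 s y - x1 0 y * x2 0 y - s * (z1 y * x2 0 y + x1 0 y * z2 y)\<bar> \<le> e * \<bar>s\<bar>"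
    using udiffD[OF u1 pos(1), of Y] udiffD[OF u2 pos(2), of Y] C(2)
      eventually_small[OF pos(3)] eventually_small[of 1, simplified]
  proof eventually_elim
    case (elim s)
    show ?case
    proof safe
      fix y assume y: "\<bar>y\<bar> \<le> Y"
      note E = elim(1)[rule_format, OF y] elim(2)[rule_format, OF y] elim(3)[rule_format, OF y]
      have "\<bar>x2 s y\<bar> \<le> B4 + C * \<bar>s\<bar>" using E(3) B4(2)[OF y] by linarith
      also have "\<dots> \<le> B4 + C" using elim(5) C(1) by simp
      finally have x2: "\<bar>x2 s y\<bar> \<le> B4 + C" .
      have 1: "\<bar>(x1 s y - x1 0 y - s * z1 y) * x2 s y\<bar> \<le> (e1 * \<bar>s\<bar>) * (B4 + C)"
        unfolding abs_mult by (intro mult_mono E x2) (use pos in auto)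
      have 2: "\<bar>(s * z1 y) * (x2 s y - x2 0 y)\<bar> \<le> (\<bar>s\<bar> * B1) * (C * e3)"
      proof -
        have "C * \<bar>s\<bar> \<le> C * e3" using elim(4) C(1) by auto
        then have "\<bar>x2 s y - x2 0 y\<bar> \<le> C * e3" using E(3) by linarith
        then show ?thesis unfolding abs_mult
          using B1 C pos y by (intro mult_mono) auto
      qed
      have 3: "\<bar>x1 0 y * (x2 s y - x2 0 y - s * z2 y)\<bar> \<le> B3 * (e2 * \<bar>s\<bar>)"
        unfolding abs_mult by (intro mult_mono E B3(2) y) (use B3 in auto)
      have "(e1 * \<bar>s\<bar>) * (B4 + C) = e / 3 * \<bar>s\<bar>" "(\<bar>s\<bar> * B1) * (C * e3) = e / 3 * \<bar>s\<bar>"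
        "B3 * (e2 * \<bar>s\<bar>) = e / 3 * \<bar>s\<bar>"
        using B1(1) B3(1) B4(1) C(1) by (auto simp: e1_def e2_def e3_def field_simps)
      then have "\<bar>(x1 s y - x1 0 y - s * z1 y) * x2 s y\<bar> + \<bar>(s * z1 y) * (x2 s y - x2 0 y)\<bar>
          + \<bar>x1 0 y * (x2 s y - x2 0 y - s * z2 y)\<bar> \<le> e * \<bar>s\<bar>"
        using 1 2 3 by linarith
      moreover have "x1 s y * x2 s y - x1 0 y * x2 0 y - s * (z1 y * x2 0 y + x1 0 y * z2 y) =
         (x1 s y - x1 0 y - s * z1 y) * x2 s y + (s * z1 y) * (x2 s y - x2 0 y)
          + x1 0 y * (x2 s y - x2 0 y - s * z2 y)" by algebra
      ultimately show "\<bar>x1 s y * x2 s y - x1 0 y * x2 0 y - s * (z1 y * x2 0 y + x1 0 y * z2 y)\<bar> \<le> e * \<bar>s\<bar>"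
        by linarith
    qed
  qed
qed

lemma lipschitz_on_interval:
  fixes h :: "real \<Rightarrow> real"
  assumes h: "\<And>a. a \<in> {a0..b0} \<Longrightarrow> (h has_real_derivative h' a) (at a)"
    and B: "\<And>a. a \<in> {a0..b0} \<Longrightarrow> \<bar>h' a\<bar> \<le> C" and ab: "a \<in> {a0..b0}" "b \<in> {a0..b0}"
  shows "\<bar>h b - h a\<bar> \<le> C * \<bar>b - a\<bar>"
proof -
  have "norm (h b - h a) \<le> C * norm (b - a)"
    by (rule field_differentiable_bound[of "{a0..b0}" h h'])
      (use h B ab in \<open>auto intro: has_field_derivative_at_within\<close>)
  then show ?thesis by simp
qed

text \<open>The mean value inequality for \<open>h t - h' a * t\<close> on the segment from
  \<open>a\<close> to \<open>b\<close>, whose derivative is at most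
  \<open>C * \<bar>b - a\<bar>\<close> there.\<close>

lemma taylor_quadratic:
  fixes h :: "real \<Rightarrow> real"
  assumes h: "\<And>a. a \<in> {a0..b0} \<Longrightarrow> (h has_real_derivative h' a) (at a)"
    and h': "\<And>a. a \<in> {a0..b0} \<Longrightarrow> (h' has_real_derivative h'' a) (at a)"
    and B: "\<And>a. a \<in> {a0..b0} \<Longrightarrow> \<bar>h'' a\<bar> \<le> C" and ab: "a \<in> {a0..b0}" "b \<in> {a0..b0}"
  shows "\<bar>h b - h a - h' a * (b - a)\<bar> \<le> C * (b - a)\<^sup>2"
proof -
  have sub: "closed_segment a b \<subseteq> {a0..b0}"
    using ab by (auto simp: closed_segment_eq_real_ivl split: if_splits)
  have C0: "0 \<le> C" using B[OF ab(1)] by linarith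
  have "norm ((\<lambda>t. h t - h' a * t) b - (\<lambda>t. h t - h' a * t) a) \<le> (C * \<bar>b - a\<bar>) * norm (b - a)"
  proof (rule field_differentiable_bound[of "closed_segment a b" _ "\<lambda>t. h' t - h' a"])
    fix t assume t: "t \<in> closed_segment a b"
    then have t': "t \<in> {a0..b0}" using sub by auto
    show "((\<lambda>t. h t - h' a * t) has_field_derivative h' t - h' a) (at t within closed_segment a b)"
      using has_field_derivative_at_within[OF h[OF t']] by (auto intro!: derivative_eq_intros)
    have "\<bar>h' t - h' a\<bar> \<le> C * \<bar>t - a\<bar>" by (rule lipschitz_on_interval[OF h' B ab(1) t'])
    also have "\<dots> \<le> C * \<bar>b - a\<bar>"
      using t C0 by (intro mult_left_mono) (auto simp: closed_segment_eq_real_ivl split: if_splits)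
    finally show "norm (h' t - h' a) \<le> C * \<bar>b - a\<bar>" by simp
  qed auto
  moreover have "(\<lambda>t. h t - h' a * t) b - (\<lambda>t. h t - h' a * t) a = h b - h a - h' a * (b - a)"
    by (simp add: algebra_simps)
  moreover have "(C * \<bar>b - a\<bar>) * norm (b - a) = C * (b - a)\<^sup>2" by (simp add: power2_eq_square mult.assoc)
  ultimately show ?thesis by (simp only: real_norm_def)
qed

lemma udiff_compose:
  assumes u: "udiff x z" and z: "continuous_on UNIV z"
    and h: "\<And>a. a \<in> {a0..b0} \<Longrightarrow> (h has_real_derivative h' a) (at a)"
    and h': "\<And>a. a \<in> {a0..b0} \<Longrightarrow> (h' has_real_derivative h'' a) (at a)"
    and B: "\<And>a. a \<in> {a0..b0} \<Longrightarrow> \<bar>h' a\<bar> \<le> C \<and> \<bar>h'' a\<bar> \<le> C"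
    and x: "\<forall>\<^sub>F s in nhds 0. \<forall>y. x s y \<in> {a0..b0}"
  shows "udiff (\<lambda>s y. h (x s y)) (\<lambda>y. h' (x 0 y) * z y)"
  unfolding udiff_def
proof (intro allI impI)
  fix Y e :: real assume e: "e > 0"
  obtain L where L: "L > 0" "\<forall>\<^sub>F s in nhds 0. \<forall>y. \<bar>y\<bar> \<le> Y \<longrightarrow> \<bar>x s y - x 0 y\<bar> \<le> L * \<bar>s\<bar>"
    by (rule udiff_lipschitz[OF u z])
  have x0: "x 0 y \<in> {a0..b0}" for y using eventually_nhds_x_imp_x[OF x] by blast
  have C0: "C \<ge> 0" using B[OF x0[of 0]] by linarith
  \<comment> \<open>One half of \<open>e\<close> pays for the Taylor remainder, which is quadratic
    in \<open>s\<close>, the other for the error of \<open>x\<close> multiplied by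
    \<open>h'\<close>. Writing \<open>C + 1\<close> covers the case \<open>C = 0\<close>.\<close>
  define e1 where "e1 = e / 2 / (C + 1)"
  define e2 where "e2 = e / (2 * ((C + 1) * L\<^sup>2))"
  have pos: "e1 > 0" "e2 > 0" using e L(1) C0 by (auto simp: e1_def e2_def)
  show "\<forall>\<^sub>F s in nhds 0. \<forall>y. \<bar>y\<bar> \<le> Y \<longrightarrow>
     \<bar>h (x s y) - h (x 0 y) - s * (h' (x 0 y) * z y)\<bar> \<le> e * \<bar>s\<bar>"
    using udiffD[OF u pos(1), of Y] L(2) x eventually_small[OF pos(2)]
  proof eventually_elim
    case (elim s)
    show ?case
    proof safe
      fix y assume y: "\<bar>y\<bar> \<le> Y"
      note E = elim(1)[rule_format, OF y] elim(2)[rule_format, OF y] elim(3)[rule_format, of y]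
      have "\<bar>h (x s y) - h (x 0 y) - h' (x 0 y) * (x s y - x 0 y)\<bar> \<le> C * (x s y - x 0 y)\<^sup>2"
        by (rule taylor_quadratic[OF h h' _ x0 E(3)]) (use B in auto)
      also have "\<dots> \<le> (C + 1) * (L * \<bar>s\<bar>)\<^sup>2"
        using E(2) C0 L(1) by (intro mult_mono) (auto simp: abs_le_square_iff[symmetric])
      also have "\<dots> = ((C + 1) * L\<^sup>2 * \<bar>s\<bar>) * \<bar>s\<bar>" by (simp add: power_mult_distrib power2_eq_square)
      also have "\<dots> \<le> ((C + 1) * L\<^sup>2 * e2) * \<bar>s\<bar>"
        using elim(4) C0 L(1) by (intro mult_right_mono mult_left_mono) auto
      also have "(C + 1) * L\<^sup>2 * e2 = e / 2" using C0 L(1) by (simp add: e2_def)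
      finally have 1: "\<bar>h (x s y) - h (x 0 y) - h' (x 0 y) * (x s y - x 0 y)\<bar> \<le> e / 2 * \<bar>s\<bar>" .
      have "\<bar>h' (x 0 y) * (x s y - x 0 y - s * z y)\<bar> \<le> (C + 1) * (e1 * \<bar>s\<bar>)"
        unfolding abs_mult using B[OF x0[of y]] E(1) C0 by (intro mult_mono) auto
      also have "\<dots> = e / 2 * \<bar>s\<bar>"
      proof -
        have "D * (e / 2 / D) = e / 2" if "D > 0" for D :: real using that by simp
        from this[of "C + 1"] have "(C + 1) * e1 = e / 2" using C0 unfolding e1_def by linarith
        then show ?thesis by (simp only: mult.assoc[symmetric])
      qed
      finally have 2: "\<bar>h' (x 0 y) * (x s y - x 0 y - s * z y)\<bar> \<le> e / 2 * \<bar>s\<bar>" .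
      have "h (x s y) - h (x 0 y) - s * (h' (x 0 y) * z y) =
          (h (x s y) - h (x 0 y) - h' (x 0 y) * (x s y - x 0 y)) + h' (x 0 y) * (x s y - x 0 y - s * z y)"
        by (simp add: algebra_simps)
      then show "\<bar>h (x s y) - h (x 0 y) - s * (h' (x 0 y) * z y)\<bar> \<le> e * \<bar>s\<bar>"
        using 1 2 by (smt (verit) field_sum_of_halves distrib_right)
    qed
  qed
qed

text \<open>The error of \<open>X\<close> vanishes at 0 and has the error of \<open>x\<close> as its
  derivative, so the mean value inequality transfers the bound at the cost of a factor
  \<open>\<bar>Y\<bar> + 1\<close>.\<close>

lemma udiff_integral:
  assumes u: "udiff x z"
    and X: "\<forall>\<^sub>F s in nhds 0. X s 0 = 0 \<and> (\<forall>y. (X s has_real_derivative x s y) (at y))"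
    and Z: "Z 0 = 0" "\<And>y. (Z has_real_derivative z y) (at y)"
  shows "udiff X Z"
  unfolding udiff_def
proof (intro allI impI)
  fix Y e :: real assume e: "e > 0"
  define e' where "e' = e / (\<bar>Y\<bar> + 1)"
  have e': "e' > 0" using e by (auto simp: e'_def)
  note X0 = eventually_nhds_x_imp_x[OF X]
  show "\<forall>\<^sub>F s in nhds 0. \<forall>y. \<bar>y\<bar> \<le> Y \<longrightarrow> \<bar>X s y - X 0 y - s * Z y\<bar> \<le> e * \<bar>s\<bar>"
    using udiffD[OF u e', of Y] X
  proof eventually_elim
    case (elim s)
    show ?case
    proof safe
      fix y assume y: "\<bar>y\<bar> \<le> Y"
      let ?D = "\<lambda>t. X s t - X 0 t - s * Z t"
      have "norm (?D y - ?D 0) \<le> (e' * \<bar>s\<bar>) * norm (y - 0)"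
      proof (rule field_differentiable_bound[of "{-\<bar>y\<bar>..\<bar>y\<bar>}" _ "\<lambda>t. x s t - x 0 t - s * z t"])
        fix t assume "t \<in> {-\<bar>y\<bar>..\<bar>y\<bar>}"
        then have t: "\<bar>t\<bar> \<le> Y" using y by auto
        show "(?D has_field_derivative x s t - x 0 t - s * z t) (at t within {-\<bar>y\<bar>..\<bar>y\<bar>})"
          using elim(2) X0
          by (intro has_field_derivative_at_within[OF DERIV_diff[OF DERIV_diff DERIV_cmult[OF Z(2)]]]) auto
        show "norm (x s t - x 0 t - s * z t) \<le> e' * \<bar>s\<bar>" using elim(1) t by simp
      qed auto
      then have "\<bar>X s y - X 0 y - s * Z y\<bar> \<le> (e' * \<bar>s\<bar>) * \<bar>y\<bar>" using elim(2) X0 Z(1) by simp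
      also have "\<dots> \<le> (e' * \<bar>s\<bar>) * (\<bar>Y\<bar> + 1)" using y e' by (intro mult_left_mono) auto
      also have "\<dots> = e * \<bar>s\<bar>" by (simp add: e'_def)
      finally show "\<bar>X s y - X 0 y - s * Z y\<bar> \<le> e * \<bar>s\<bar>" .
    qed
  qed
qed

text \<open>Comparing \<open>x s\<close> with \<open>x 0\<close> at the same moving point asks only
  for continuity of \<open>\<tau>\<close>. This isolates the part of the chain rule that is
  available before \<open>\<tau>\<close> is known to be differentiable.\<close>

lemma udiff_moving_increment:
  assumes u: "udiff x z" and z: "isCont z (\<tau> 0)" and \<tau>: "isCont \<tau> 0"
  shows "((\<lambda>s. x s (\<tau> s) - x 0 (\<tau> s)) has_real_derivative z (\<tau> 0)) (at 0)"
proof (rule has_real_derivative_0I)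
  fix e :: real assume e: "e > 0"
  have zt: "isCont (\<lambda>s. z (\<tau> s)) 0" using \<tau> z by (rule isCont_o2)
  have E1: "\<forall>\<^sub>F s in nhds 0. \<bar>z (\<tau> s) - z (\<tau> 0)\<bar> < e / 2"
    using tendstoD[OF zt[unfolded isCont_def tendsto_at_iff_tendsto_nhds] half_gt_zero[OF e]]
    unfolding dist_real_def using e by (simp add: eventually_nhds_conv_at)
  have E2: "\<forall>\<^sub>F s in nhds 0. \<bar>\<tau> s - \<tau> 0\<bar> < 1"
    using tendstoD[OF \<tau>[unfolded isCont_def tendsto_at_iff_tendsto_nhds] zero_less_one]
    unfolding dist_real_def by (simp add: eventually_nhds_conv_at)
  show "\<forall>\<^sub>F s in nhds 0. \<bar>x s (\<tau> s) - x 0 (\<tau> s) - (x 0 (\<tau> 0) - x 0 (\<tau> 0)) - s * z (\<tau> 0)\<bar> \<le> e * \<bar>s\<bar>"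
    using udiffD[OF u, of "e / 2" "\<bar>\<tau> 0\<bar> + 1", simplified, OF e] E1 E2
  proof eventually_elim
    case (elim s)
    have "\<bar>x s (\<tau> s) - x 0 (\<tau> s) - s * z (\<tau> s)\<bar> \<le> e / 2 * \<bar>s\<bar>" using elim(1,3) by auto
    moreover have "\<bar>s * (z (\<tau> s) - z (\<tau> 0))\<bar> \<le> e / 2 * \<bar>s\<bar>"
      using elim(2) unfolding abs_mult mult.commute[of "\<bar>s\<bar>"] by (intro mult_right_mono) auto
    moreover have "x s (\<tau> s) - x 0 (\<tau> s) - s * z (\<tau> 0) =
      (x s (\<tau> s) - x 0 (\<tau> s) - s * z (\<tau> s)) + s * (z (\<tau> s) - z (\<tau> 0))" by (simp add: algebra_simps)
    ultimately show ?case by (smt (verit) field_sum_of_halves distrib_right)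
  qed
qed

lemma udiff_chain:
  assumes u: "udiff x z" and z: "isCont z (\<tau> 0)"
    and x0: "(x 0 has_real_derivative c) (at (\<tau> 0))" and \<tau>: "(\<tau> has_real_derivative \<tau>') (at 0)"
  shows "((\<lambda>s. x s (\<tau> s)) has_real_derivative z (\<tau> 0) + c * \<tau>') (at 0)"
proof -
  have "((\<lambda>s. (x s (\<tau> s) - x 0 (\<tau> s)) + x 0 (\<tau> s)) has_real_derivative z (\<tau> 0) + c * \<tau>') (at 0)"
    by (rule DERIV_add[OF udiff_moving_increment[OF u z DERIV_isCont[OF \<tau>]] DERIV_chain2[OF x0 \<tau>]])
  then show ?thesis by simp
qed

text \<open>The Caratheodory factor \<open>Q\<close> writes \<open>x 0 (\<tau> s)\<close> as
  \<open>Q (\<tau> s) * (\<tau> s - \<tau> 0)\<close>. As \<open>x s (\<tau> s) = 0\<close>, this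
  equals minus the increment in the parameter, and dividing by \<open>s\<close> and by
  \<open>Q\<close>, which tends to \<open>c\<close>, gives the derivative.\<close>

lemma udiff_implicit:
  assumes u: "udiff x z" and z: "isCont z (\<tau> 0)"
    and x0: "(x 0 has_real_derivative c) (at (\<tau> 0))" and c: "c \<noteq> 0"
    and \<tau>: "isCont \<tau> 0" and zero: "\<forall>\<^sub>F s in nhds 0. x s (\<tau> s) = 0"
  shows "(\<tau> has_real_derivative - z (\<tau> 0) / c) (at 0)"
proof -
  obtain Q where Q: "\<And>t. x 0 t - x 0 (\<tau> 0) = Q t * (t - \<tau> 0)" "isCont Q (\<tau> 0)" "Q (\<tau> 0) = c"
    using x0 unfolding CARAT_DERIV by blast
  have Qt: "((\<lambda>s. Q (\<tau> s)) \<longlongrightarrow> c) (at 0)"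
    using isCont_o2[OF \<tau> Q(2)] Q(3) by (simp add: isCont_def)
  have r: "((\<lambda>s. (x s (\<tau> s) - x 0 (\<tau> s)) / s) \<longlongrightarrow> z (\<tau> 0)) (at 0)"
    using udiff_moving_increment[OF u z \<tau>] unfolding has_field_derivative_iff by simp
  have "((\<lambda>s. - ((x s (\<tau> s) - x 0 (\<tau> s)) / s) / Q (\<tau> s)) \<longlongrightarrow> - z (\<tau> 0) / c) (at 0)"
    by (intro tendsto_intros r Qt c)
  moreover have "\<forall>\<^sub>F s in at 0. - ((x s (\<tau> s) - x 0 (\<tau> s)) / s) / Q (\<tau> s) = (\<tau> s - \<tau> 0) / s"
  proof -
    have "\<forall>\<^sub>F s in at 0. Q (\<tau> s) \<noteq> 0" using tendsto_imp_eventually_ne[OF Qt c] .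
    moreover have "\<forall>\<^sub>F s in at 0. x s (\<tau> s) = 0" using zero by (simp add: eventually_nhds_conv_at)
    ultimately show ?thesis
    proof eventually_elim
      case (elim s)
      have "x 0 (\<tau> 0) = 0" using eventually_nhds_x_imp_x[OF zero] .
      then have "x 0 (\<tau> s) = Q (\<tau> s) * (\<tau> s - \<tau> 0)" using Q(1)[of "\<tau> s"] by simp
      then have "x 0 (\<tau> s) / Q (\<tau> s) = \<tau> s - \<tau> 0" using elim(1) by simp
      moreover have "- ((0 - x 0 (\<tau> s)) / s) / Q (\<tau> s) = (x 0 (\<tau> s) / Q (\<tau> s)) / s" by simp
      ultimately show ?case using elim(2) by (simp only:)
    qed
  qed
  ultimately have "((\<lambda>s. (\<tau> s - \<tau> 0) / s) \<longlongrightarrow> - z (\<tau> 0) / c) (at 0)"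
    by (rule Lim_transform_eventually)
  then show ?thesis unfolding has_field_derivative_iff by simp
qed

lemma has_vector_derivative_Pair_real:
  assumes "(f has_real_derivative f') (at x)" "(g has_real_derivative g') (at x)"
  shows "((\<lambda>x. (f x, g x)) has_vector_derivative (f', g')) (at x)"
  using assms unfolding has_real_derivative_iff_has_vector_derivative
  by (rule has_vector_derivative_Pair)

lemma norm_Pair_abs_le: "norm (a, b) \<le> \<bar>a\<bar> + \<bar>b::real\<bar>" for a :: real
  by (simp add: norm_Pair sqrt_sum_squares_le_sum_abs)

lemma abs_le_norm_Pair: "\<bar>a\<bar> \<le> norm (a, b)" "\<bar>b\<bar> \<le> norm (a, b)" for a b :: real
  using norm_fst_le[of a b] norm_snd_le[of b a] by auto

text \<open>Gronwall's inequality is applied twice: first to the increment of the solution, giving a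
  bound linear in \<open>s\<close>, then to its difference from the linearized solution, where that
  bound makes every source term quadratic in \<open>s\<close>. The right-hand side is a quadratic
  polynomial in \<open>s\<close> because \<open>\<kappa>\<close> enters the profile equation
  squared.\<close>

lemma udiff_second_order:
  fixes A B :: "real \<Rightarrow> real \<Rightarrow> real"
  assumes sol: "\<forall>\<^sub>F s in nhds 0. \<forall>y. (A s has_real_derivative B s y) (at y) \<and>
      (B s has_real_derivative G0 (A s y) + s * g1 (A s y) + s\<^sup>2 * g2 (A s y)) (at y) \<and>
      A s y \<in> {a0..b0}"
    and G0: "\<And>a. a \<in> {a0..b0} \<Longrightarrow> (G0 has_real_derivative G0' a) (at a)"
      "\<And>a. a \<in> {a0..b0} \<Longrightarrow> (G0' has_real_derivative G0'' a) (at a)"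
    and g1: "\<And>a. a \<in> {a0..b0} \<Longrightarrow> (g1 has_real_derivative g1' a) (at a)"
    and bnd: "\<And>a. a \<in> {a0..b0} \<Longrightarrow> \<bar>G0' a\<bar> \<le> C \<and> \<bar>G0'' a\<bar> \<le> C \<and> \<bar>g1 a\<bar> \<le> C \<and> \<bar>g1' a\<bar> \<le> C \<and> \<bar>g2 a\<bar> \<le> C"
    and z: "\<And>y. (z has_real_derivative z1 y) (at y)"
      "\<And>y. (z1 has_real_derivative G0' (A 0 y) * z y + g1 (A 0 y)) (at y)"
    and ic: "((\<lambda>s. A s 0) has_real_derivative z 0) (at 0)" "\<forall>\<^sub>F s in nhds 0. B s 0 = 0" "z1 0 = 0"
  shows "udiff A z" "udiff B z1"
proof -
  note sol0 = eventually_nhds_x_imp_x[OF sol]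
  have A0: "A 0 y \<in> {a0..b0}" for y using sol0 by blast
  have B00: "B 0 0 = 0" using eventually_nhds_x_imp_x[OF ic(2)] .
  have C0: "C \<ge> 0" using bnd[OF A0[of 0]] by linarith
  have key: "\<forall>\<^sub>F s in nhds 0. \<forall>y. \<bar>y\<bar> \<le> Y \<longrightarrow>
      \<bar>A s y - A 0 y - s * z y\<bar> \<le> e * \<bar>s\<bar> \<and> \<bar>B s y - B 0 y - s * z1 y\<bar> \<le> e * \<bar>s\<bar>"
    if e: "e > 0" for Y e
  proof -
    define L where "L = ((\<bar>z 0\<bar> + 1) + 2 * C) * exp ((C + 1 + 1) * \<bar>Y\<bar>)"
    have L0: "L \<ge> 0" using C0 by (simp add: L_def)
    have lip: "\<forall>\<^sub>F s in nhds 0. \<forall>y. \<bar>y\<bar> \<le> Y \<longrightarrow> \<bar>A s y - A 0 y\<bar> \<le> L * \<bar>s\<bar>"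
      using sol has_real_derivative_0D[OF ic(1) zero_less_one] ic(2) eventually_small[OF zero_less_one]
    proof eventually_elim
      case (elim s)
      let ?d = "\<lambda>y. (A s y - A 0 y, B s y - B 0 y)"
      let ?d' = "\<lambda>y. (B s y - B 0 y, G0 (A s y) + s * g1 (A s y) + s\<^sup>2 * g2 (A s y) - G0 (A 0 y))"
      show ?case
      proof safe
        fix y assume y: "\<bar>y\<bar> \<le> Y"
        have "norm (?d y) \<le> ((\<bar>z 0\<bar> + 1) * \<bar>s\<bar> + 2 * C * \<bar>s\<bar>) * exp ((C + 1 + 1) * Y)"
        proof (rule gronwall[where x = ?d and x' = ?d' and y = y])
          fix t assume "\<bar>t\<bar> \<le> Y"
          show "(?d has_vector_derivative ?d' t) (at t)"
            using elim(1) sol0 by (intro has_vector_derivative_Pair_real DERIV_diff) auto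
          have As: "A s t \<in> {a0..b0}" using elim(1) by auto
          have "\<bar>G0 (A s t) - G0 (A 0 t)\<bar> \<le> C * \<bar>A s t - A 0 t\<bar>"
            by (rule lipschitz_on_interval[OF G0(1) _ A0 As]) (use bnd in auto)
          also have "\<dots> \<le> C * norm (?d t)"
            using C0 by (intro mult_left_mono abs_le_norm_Pair)
          finally have 1: "\<bar>G0 (A s t) - G0 (A 0 t)\<bar> \<le> C * norm (?d t)" .
          have 2: "\<bar>s * g1 (A s t)\<bar> \<le> C * \<bar>s\<bar>"
            using bnd[OF As] by (simp add: abs_mult mult.commute[of C] mult_left_mono)
          have "\<bar>s\<^sup>2 * g2 (A s t)\<bar> \<le> \<bar>s\<bar> * C"
            using bnd[OF As] elim(4) mult_left_le_one_le[of "\<bar>s\<bar>" "\<bar>s\<bar>"]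
            unfolding abs_mult power2_eq_square by (intro mult_mono) auto
          then have 3: "\<bar>s\<^sup>2 * g2 (A s t)\<bar> \<le> C * \<bar>s\<bar>" by (simp add: mult.commute)
          have "norm (?d' t) \<le> \<bar>B s t - B 0 t\<bar> + \<bar>G0 (A s t) + s * g1 (A s t) + s\<^sup>2 * g2 (A s t) - G0 (A 0 t)\<bar>"
            by (rule norm_Pair_abs_le)
          also have "\<dots> \<le> norm (?d t) + (C * norm (?d t) + 2 * C * \<bar>s\<bar>)"
            using abs_le_norm_Pair(2)[where b="B s t - B 0 t" and a="A s t - A 0 t"] 1 2 3 by linarith
          finally show "norm (?d' t) \<le> (C + 1) * norm (?d t) + 2 * C * \<bar>s\<bar>" by (simp add: algebra_simps)
        next
          have "\<bar>A s 0 - A 0 0\<bar> \<le> (\<bar>z 0\<bar> + 1) * \<bar>s\<bar>"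
          proof -
            have "\<bar>s * z 0\<bar> = \<bar>z 0\<bar> * \<bar>s\<bar>" by (simp add: abs_mult)
            then show ?thesis using elim(2) by (simp add: distrib_right)
          qed
          then show "norm (?d 0) \<le> (\<bar>z 0\<bar> + 1) * \<bar>s\<bar>" using elim(3) B00 by (simp add: norm_Pair)
        qed (use C0 y in auto)
        also have "\<dots> = L * \<bar>s\<bar>" using y by (simp add: L_def algebra_simps)
        finally show "\<bar>A s y - A 0 y\<bar> \<le> L * \<bar>s\<bar>" using abs_le_norm_Pair(1) order_trans by blast
      qed
    qed
    define W where "W = exp ((C + 1 + 1) * \<bar>Y\<bar>)"
    \<comment> \<open>The three summands bound the Taylor remainder of \<open>G0\<close>, the change
      of \<open>g1\<close> along the increment, and \<open>g2\<close>, each up to the factor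
      \<open>s\<^sup>2\<close>.\<close>
    define E where "E = C * L\<^sup>2 + C * L + C"
    have E0: "E \<ge> 0" using C0 L0 by (simp add: E_def)
    have W0: "W > 0" by (simp add: W_def)
    define e1 where "e1 = e / (2 * W)"
    define e2 where "e2 = e / (2 * W * (E + 1))"
    have pos: "e1 > 0" "e2 > 0" using e W0 E0 by (auto simp: e1_def e2_def)
    show ?thesis
      using sol has_real_derivative_0D[OF ic(1) pos(1)] ic(2) eventually_small[OF pos(2)] lip
    proof eventually_elim
      case (elim s)
      let ?d = "\<lambda>y. (A s y - A 0 y - s * z y, B s y - B 0 y - s * z1 y)"
      let ?d' = "\<lambda>y. (B s y - B 0 y - s * z1 y, G0 (A s y) + s * g1 (A s y) + s\<^sup>2 * g2 (A s y) - G0 (A 0 y)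
          - s * (G0' (A 0 y) * z y + g1 (A 0 y)))"
      show ?case
      proof (intro allI impI)
        fix y assume y: "\<bar>y\<bar> \<le> Y"
        have "norm (?d y) \<le> (e1 * \<bar>s\<bar> + E * s\<^sup>2) * exp ((C + 1 + 1) * Y)"
        proof (rule gronwall[where x = ?d and x' = ?d' and y = y])
          fix t assume t: "\<bar>t\<bar> \<le> Y"
          show "(?d has_vector_derivative ?d' t) (at t)"
            using elim(1) sol0 by (intro has_vector_derivative_Pair_real DERIV_diff DERIV_cmult z) auto
          have As: "A s t \<in> {a0..b0}" using elim(1) by auto
          have l: "\<bar>A s t - A 0 t\<bar> \<le> L * \<bar>s\<bar>" using elim(5) t by blast
          have "\<bar>G0 (A s t) - G0 (A 0 t) - G0' (A 0 t) * (A s t - A 0 t)\<bar> \<le> C * (A s t - A 0 t)\<^sup>2"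
            by (rule taylor_quadratic[OF G0 _ A0 As]) (use bnd in auto)
          also have "\<dots> \<le> C * (L * \<bar>s\<bar>)\<^sup>2"
            using l C0 L0 by (intro mult_left_mono) (auto simp: abs_le_square_iff[symmetric])
          also have "\<dots> = C * L\<^sup>2 * s\<^sup>2" by (simp add: power_mult_distrib)
          finally have 1: "\<bar>G0 (A s t) - G0 (A 0 t) - G0' (A 0 t) * (A s t - A 0 t)\<bar> \<le> C * L\<^sup>2 * s\<^sup>2" .
          have "\<bar>g1 (A s t) - g1 (A 0 t)\<bar> \<le> C * \<bar>A s t - A 0 t\<bar>"
            by (rule lipschitz_on_interval[OF g1 _ A0 As]) (use bnd in auto)
          also have "\<dots> \<le> C * (L * \<bar>s\<bar>)" using l C0 by (rule mult_left_mono)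
          finally have "\<bar>s * (g1 (A s t) - g1 (A 0 t))\<bar> \<le> \<bar>s\<bar> * (C * (L * \<bar>s\<bar>))"
            unfolding abs_mult by (rule mult_left_mono) auto
          then have 2: "\<bar>s * (g1 (A s t) - g1 (A 0 t))\<bar> \<le> C * L * s\<^sup>2"
            by (simp add: power2_eq_square mult_ac)
          have 3: "\<bar>s\<^sup>2 * g2 (A s t)\<bar> \<le> C * s\<^sup>2"
            using bnd[OF As] by (simp add: abs_mult mult.commute[of C] mult_left_mono)
          have "\<bar>G0' (A 0 t) * (A s t - A 0 t - s * z t)\<bar> \<le> C * norm (?d t)"
            unfolding abs_mult using bnd[OF A0[of t]] C0 by (intro mult_mono abs_le_norm_Pair) auto
          note 4 = this
          have "snd (?d' t) = (G0 (A s t) - G0 (A 0 t) - G0' (A 0 t) * (A s t - A 0 t))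
              + s * (g1 (A s t) - g1 (A 0 t)) + s\<^sup>2 * g2 (A s t) + G0' (A 0 t) * (A s t - A 0 t - s * z t)"
            by (simp add: algebra_simps)
          then have "\<bar>snd (?d' t)\<bar> \<le> C * norm (?d t) + (C * L\<^sup>2 * s\<^sup>2 + C * L * s\<^sup>2 + C * s\<^sup>2)"
            using 1 2 3 4 by linarith
          moreover have "norm (?d' t) \<le> \<bar>B s t - B 0 t - s * z1 t\<bar> + \<bar>snd (?d' t)\<bar>"
            using norm_Pair_abs_le[of "fst (?d' t)" "snd (?d' t)"] by simp
          moreover have "\<bar>B s t - B 0 t - s * z1 t\<bar> \<le> norm (?d t)" by (rule abs_le_norm_Pair(2))
          ultimately have "norm (?d' t) \<le> norm (?d t) + (C * norm (?d t) + (C * L\<^sup>2 * s\<^sup>2 + C * L * s\<^sup>2 + C * s\<^sup>2))"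
            by linarith
          then show "norm (?d' t) \<le> (C + 1) * norm (?d t) + E * s\<^sup>2" by (simp add: E_def algebra_simps)
        next
          show "norm (?d 0) \<le> e1 * \<bar>s\<bar>" using elim(2,3) B00 ic(3) by (simp add: norm_Pair)
        qed (use C0 y E0 in auto)
        also have "\<dots> = (e1 + E * \<bar>s\<bar>) * W * \<bar>s\<bar>"
          using y by (simp add: W_def algebra_simps power2_eq_square)
        also have "\<dots> \<le> (e1 + (E + 1) * e2) * W * \<bar>s\<bar>"
          using elim(4) E0 W0 by (intro mult_right_mono add_left_mono mult_mono) auto
        also have "(e1 + (E + 1) * e2) * W = e"
        proof -
          have "(e / (2 * W) + D * (e / (2 * W * D))) * W = e" if "D > 0" for D
            using that W0 by (simp add: field_simps)
          from this[of "E + 1"] show ?thesis using E0 unfolding e1_def e2_def by linarith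
        qed
        finally show "\<bar>A s y - A 0 y - s * z y\<bar> \<le> e * \<bar>s\<bar> \<and> \<bar>B s y - B 0 y - s * z1 y\<bar> \<le> e * \<bar>s\<bar>"
          using abs_le_norm_Pair order_trans by blast
      qed
    qed
  qed
  show "udiff A z" "udiff B z1"
    unfolding udiff_def by (auto intro: eventually_mono[OF key])
qed

subsection \<open>A single wave\<close>

lemma DERIV_const_divide_power:
  "x \<noteq> 0 \<Longrightarrow> ((\<lambda>x. c / x ^ n) has_real_derivative - (real n * c / x ^ Suc n)) (at x)"
proof (induction n)
  case (Suc n)
  have "((\<lambda>x. (c / x ^ n) * inverse x) has_real_derivative
      - (real n * c / x ^ Suc n) * inverse x + - (inverse x ^ Suc 1) * (c / x ^ n)) (at x)"
    using DERIV_mult[OF Suc.IH DERIV_inverse] Suc.prems by (simp add: numeral_2_eq_2)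
  then show ?case using Suc.prems
    by (rule_tac back_subst[of "\<lambda>D. (_ has_real_derivative D) (at x)"])
      (auto simp: field_simps)
qed auto

locale nonlinearity =
  fixes f f1 f2 F :: "real \<Rightarrow> real"
  assumes f: "\<And>x. x > 0 \<Longrightarrow> (f has_real_derivative f1 x) (at x)"
    and f1: "\<And>x. x > 0 \<Longrightarrow> (f1 has_real_derivative f2 x) (at x)"
    and f2: "continuous_on {0<..} f2"
    and F: "\<And>x. x > 0 \<Longrightarrow> (F has_real_derivative f x) (at x)"

locale wave = nonlinearity +
  fixes E \<kappa> \<omega> \<zeta> a b T :: real and A B S :: "real \<Rightarrow> real"
  assumes \<kappa>: "\<kappa> > 0"
    and tp: "turning_points F (E, \<kappa>, \<omega>, \<zeta>) a b"
    and T: "T = 2 * integral {a..b} (\<lambda>x. 1 / sqrt (Rfun F (E, \<kappa>, \<omega>, \<zeta>) x))"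
    and profile: "wave_profile f F (E, \<kappa>, \<omega>, \<zeta>) a b T A S"
    and B_def: "B = deriv A"
begin

text \<open>Once \<open>S_y\<close> is replaced by \<open>\<kappa> / A\<^sup>2\<close>, the profile
  equation becomes \<open>A_yy = G A\<close> with energy identity \<open>A_y\<^sup>2 = R A\<close>,
  and \<open>R' = 2 G\<close>.\<close>

definition "R x = 2 * E - \<omega> * x\<^sup>2 - \<kappa>\<^sup>2 / x\<^sup>2 - \<zeta> * F (x\<^sup>2)"
definition "G x = - \<omega> * x + \<kappa>\<^sup>2 / x ^ 3 - \<zeta> * f (x\<^sup>2) * x"
definition "G' x = - \<omega> - 3 * \<kappa>\<^sup>2 / x ^ 4 - \<zeta> * (f (x\<^sup>2) + 2 * x\<^sup>2 * f1 (x\<^sup>2))"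
definition "G'' x = 12 * \<kappa>\<^sup>2 / x ^ 5 - \<zeta> * (6 * x * f1 (x\<^sup>2) + 4 * x ^ 3 * f2 (x\<^sup>2))"

lemma Rfun_eq: "Rfun F (E, \<kappa>, \<omega>, \<zeta>) = R"
  by (simp add: Rfun_def R_def fun_eq_iff)

lemma a_pos: "0 < a" and a_less_b: "a < b"
  and R_pos: "a < x \<Longrightarrow> x < b \<Longrightarrow> R x > 0" and R_a: "R a = 0" and R_b: "R b = 0"
  using tp unfolding turning_points_def Rfun_eq by auto

lemma A_bounds: "a \<le> A y" "A y \<le> b" and A_0: "A 0 = a" and A_half: "A (T / 2) = b"
  and A_periodic: "A (y + T) = A y" and S_0: "S 0 = 0"
  and dS: "(S has_real_derivative \<kappa> / (A y)\<^sup>2) (at y)"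
  and dA: "(A has_real_derivative B y) (at y)"
  and energy: "(B y)\<^sup>2 = R (A y)"
  using profile unfolding wave_profile_def B_def by (auto simp: Rfun_eq)

lemma A_pos: "0 < A y" using A_bounds(1)[of y] a_pos by linarith

lemma deriv_S: "deriv S y = \<kappa> / (A y)\<^sup>2" by (rule DERIV_imp_deriv[OF dS])

lemma dB: "(B has_real_derivative G (A y)) (at y)"
proof -
  have "(B has_real_derivative - \<omega> * A y + A y * (deriv S y)\<^sup>2 - \<zeta> * f ((A y)\<^sup>2) * A y) (at y)"
    using profile unfolding wave_profile_def B_def by auto
  moreover have "- \<omega> * A y + A y * (deriv S y)\<^sup>2 - \<zeta> * f ((A y)\<^sup>2) * A y = G (A y)"
    using A_pos[of y] by (simp add: deriv_S G_def power_divide power2_eq_square power3_eq_cube)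
  ultimately show ?thesis by simp
qed

lemma dR: "x > 0 \<Longrightarrow> (R has_real_derivative 2 * G x) (at x)"
proof -
  assume x: "x > 0"
  have "((\<lambda>x. F (x\<^sup>2)) has_real_derivative f (x\<^sup>2) * (2 * x)) (at x)"
    by (rule DERIV_chain2[OF F]) (use x in \<open>auto intro!: derivative_eq_intros\<close>)
  note [derivative_intros] = this
  have "(R has_real_derivative 0 - \<omega> * (2 * x) - - (real 2 * \<kappa>\<^sup>2 / x ^ Suc 2) - \<zeta> * (f (x\<^sup>2) * (2 * x))) (at x)"
    unfolding R_def[abs_def] using x
    by (intro DERIV_diff DERIV_cmult DERIV_const_divide_power) (auto intro!: derivative_eq_intros)
  then show ?thesis by (rule back_subst[of "\<lambda>D. (R has_real_derivative D) (at x)"])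
    (simp add: G_def algebra_simps numeral_3_eq_3 numeral_2_eq_2)
qed

lemma dG: "x > 0 \<Longrightarrow> (G has_real_derivative G' x) (at x)"
proof -
  assume x: "x > 0"
  have "((\<lambda>x. f (x\<^sup>2)) has_real_derivative f1 (x\<^sup>2) * (2 * x)) (at x)"
    by (rule DERIV_chain2[OF f]) (use x in \<open>auto intro!: derivative_eq_intros\<close>)
  note [derivative_intros] = this
  have "(G has_real_derivative - \<omega> * 1 + - (real 3 * \<kappa>\<^sup>2 / x ^ Suc 3)
      - ((\<zeta> * (f1 (x\<^sup>2) * (2 * x))) * x + 1 * (\<zeta> * f (x\<^sup>2)))) (at x)"
    unfolding G_def[abs_def] using x
    by (intro DERIV_diff DERIV_add DERIV_cmult DERIV_const_divide_power DERIV_mult DERIV_ident)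
       (auto intro!: derivative_eq_intros)
  then show ?thesis by (rule back_subst[of "\<lambda>D. (G has_real_derivative D) (at x)"])
    (simp add: G'_def algebra_simps eval_nat_numeral)
qed

lemma dG': "x > 0 \<Longrightarrow> (G' has_real_derivative G'' x) (at x)"
proof -
  assume x: "x > 0"
  have "((\<lambda>x. f (x\<^sup>2)) has_real_derivative f1 (x\<^sup>2) * (2 * x)) (at x)"
    by (rule DERIV_chain2[OF f]) (use x in \<open>auto intro!: derivative_eq_intros\<close>)
  note [derivative_intros] = this
  have "((\<lambda>x. f1 (x\<^sup>2)) has_real_derivative f2 (x\<^sup>2) * (2 * x)) (at x)"
    by (rule DERIV_chain2[OF f1]) (use x in \<open>auto intro!: derivative_eq_intros\<close>)
  note [derivative_intros] = this
  have "(G' has_real_derivative 0 - - (real 4 * (3 * \<kappa>\<^sup>2) / x ^ Suc 4)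
      - \<zeta> * (f1 (x\<^sup>2) * (2 * x) + ((4 * x) * f1 (x\<^sup>2) + (f2 (x\<^sup>2) * (2 * x)) * (2 * x\<^sup>2)))) (at x)"
    unfolding G'_def[abs_def] using x
    by (intro DERIV_diff DERIV_add DERIV_cmult DERIV_const_divide_power DERIV_mult DERIV_const)
       (auto intro!: derivative_eq_intros)
  then show ?thesis by (rule back_subst[of "\<lambda>D. (G' has_real_derivative D) (at x)"])
    (simp add: G''_def algebra_simps eval_nat_numeral)
qed

lemma continuous_on_G'': "continuous_on {0<..} G''"
proof -
  have sq: "continuous_on {0<..} (\<lambda>x::real. x\<^sup>2)" "(\<lambda>x::real. x\<^sup>2) ` {0<..} \<subseteq> {0<..}"
    by (auto intro!: continuous_intros)
  have "continuous_on {0<..} (\<lambda>x. f1 (x\<^sup>2))" "continuous_on {0<..} (\<lambda>x. f2 (x\<^sup>2))"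
    using continuous_on_compose2[OF f2 sq]
    by (auto intro!: continuous_on_compose2[OF _ sq] continuous_at_imp_continuous_on[of "{0<..}" f1]
        DERIV_isCont[OF f1])
  then show ?thesis unfolding G''_def[abs_def] by (intro continuous_intros) auto
qed

text \<open>The root is simple, so the slope of \<open>R\<close> at \<open>a\<close> is not 0; a
  negative slope would make \<open>R\<close> negative just inside the interval.\<close>

lemma G_a: "G a > 0"
proof (rule ccontr)
  have d: "deriv R a = 2 * G a" by (rule DERIV_imp_deriv[OF dR[OF a_pos]])
  have "deriv R a \<noteq> 0" using tp unfolding turning_points_def Rfun_eq by auto
  moreover assume "\<not> G a > 0"
  ultimately have "2 * G a < 0" using d by auto
  from DERIV_neg_dec_right[OF dR[OF a_pos] this] obtain d where
    d: "d > 0" "\<And>h. 0 < h \<Longrightarrow> h < d \<Longrightarrow> R (a + h) < R a" by blast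
  define h where "h = min (d / 2) ((b - a) / 2)"
  have h: "0 < h" "h < d" "h < b - a" using d a_less_b by (auto simp: h_def min_def)
  then have "R (a + h) < 0" "R (a + h) > 0" using d(2)[of h] R_a R_pos[of "a + h"] by auto
  then show False by simp
qed

lemma G_b: "G b < 0"
proof (rule ccontr)
  have b0: "b > 0" using a_pos a_less_b by linarith
  have d: "deriv R b = 2 * G b" by (rule DERIV_imp_deriv[OF dR[OF b0]])
  have "deriv R b \<noteq> 0" using tp unfolding turning_points_def Rfun_eq by auto
  moreover assume "\<not> G b < 0"
  ultimately have "2 * G b > 0" using d by auto
  from DERIV_pos_inc_left[OF dR[OF b0] this] obtain d where
    d: "d > 0" "\<And>h. 0 < h \<Longrightarrow> h < d \<Longrightarrow> R (b - h) < R b" by blast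
  define h where "h = min (d / 2) ((b - a) / 2)"
  have h: "0 < h" "h < d" "h < b - a" using d a_less_b by (auto simp: h_def min_def)
  then have "R (b - h) < 0" "R (b - h) > 0" using d(2)[of h] R_b R_pos[of "b - h"] by auto
  then show False by simp
qed

section \<open>Monotonicity on the half period, and the moments as integrals along the wave\<close>

lemma continuous_A: "continuous_on X A" and continuous_B: "continuous_on X B"
  using dA dB DERIV_isCont continuous_at_imp_continuous_on by metis+

lemma B_0: "B 0 = 0" and B_half: "B (T / 2) = 0"
  using energy[of 0] energy[of "T / 2"] by (simp_all add: A_0 A_half R_a R_b)

lemma T_pos: "T > 0"
proof -
  \<comment> \<open>The value of \<open>integral\<close> is 0 for a function that is not integrable,
    so only \<open>T \<ge> 0\<close> is available at this point. The case \<open>T = 0\<close> is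
    excluded by \<open>A 0 = a\<close> and \<open>A (T / 2) = b\<close>.\<close>
  have "integral {a..b} (\<lambda>x. 1 / sqrt (R x)) \<ge> 0"
  proof (cases "(\<lambda>x. 1 / sqrt (R x)) integrable_on {a..b}")
    case True
    then show ?thesis
    proof (rule integral_nonneg)
      show "0 \<le> 1 / sqrt (R x)" if "x \<in> {a..b}" for x
        using that R_a R_b R_pos[of x] by (cases "x = a \<or> x = b") auto
    qed
  qed (simp add: not_integrable_integral)
  then have "T \<ge> 0" using T by (simp add: Rfun_eq)
  moreover have "T \<noteq> 0" using A_0 A_half a_less_b by auto
  ultimately show ?thesis by simp
qed

text \<open>The profile has a maximum at \<open>T / 2\<close>, but possibly not its first one. Here
  \<open>\<tau>\<close> is the first positive zero of \<open>B\<close>: \<open>B\<close> increases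
  through 0 at the minimum, and beyond a small \<open>d\<close> the zeros up to \<open>T / 2\<close>
  form a nonempty compact set. It is identified with \<open>T / 2\<close> later.\<close>

lemma first_turning_time:
  obtains \<tau> where "0 < \<tau>" "B \<tau> = 0" "A \<tau> = b" "\<And>y. 0 < y \<Longrightarrow> y < \<tau> \<Longrightarrow> B y > 0"
proof -
  have "(B has_real_derivative G a) (at 0)" using dB[of 0] by (simp add: A_0)
  from DERIV_pos_inc_right[OF this G_a] obtain d where
    d: "d > 0" "\<And>h. 0 < h \<Longrightarrow> h < d \<Longrightarrow> B h > 0" by (auto simp: B_0)
  have dT: "d \<le> T / 2" using d(2)[of "T / 2"] T_pos B_half by force
  define Z where "Z = {d..T / 2} \<inter> {y. B y = 0}"
  have "closed {y. B y = 0}" by (rule closed_Collect_eq) (auto intro: continuous_B)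
  then have "compact Z" unfolding Z_def by (intro compact_Int_closed) auto
  moreover have "T / 2 \<in> Z" using dT B_half by (simp add: Z_def)
  ultimately obtain \<tau> where \<tau>: "\<tau> \<in> Z" "\<And>y. y \<in> Z \<Longrightarrow> \<tau> \<le> y"
    using compact_attains_inf[of Z] by blast
  have \<tau>0: "0 < \<tau>" "B \<tau> = 0" "d \<le> \<tau>" "\<tau> \<le> T / 2" using \<tau>(1) d(1) by (auto simp: Z_def)
  have Bpos: "B y > 0" if "0 < y" "y < \<tau>" for y
  proof (cases "y < d")
    case True then show ?thesis using d(2) that by auto
  next
    case False
    show ?thesis
    proof (rule ccontr)
      assume "\<not> B y > 0"
      moreover have "B (d / 2) > 0" using d by auto
      ultimately obtain x where x: "d / 2 \<le> x" "x \<le> y" "B x = 0"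
        using IVT2'[of B y 0 "d / 2"] False d(1) continuous_B by force
      then have "x \<ge> d" using d by (metis linorder_not_le less_numeral_extra(3) half_gt_zero order_less_le_trans)
      then have "x \<in> Z" using x that \<tau>0 by (auto simp: Z_def)
      then show False using \<tau>(2)[of x] x that by auto
    qed
  qed
  have "A 0 < A \<tau>"
    by (rule DERIV_pos_imp_increasing_open[OF \<tau>0(1)])
       (use dA Bpos continuous_A in \<open>auto intro: DERIV_isCont\<close>)
  then have "a < A \<tau>" by (simp add: A_0)
  moreover have "R (A \<tau>) = 0" using energy[of \<tau>] \<tau>0 by simp
  ultimately have "A \<tau> = b" using R_pos[of "A \<tau>"] A_bounds[of \<tau>] by force
  then show ?thesis using that \<tau>0 Bpos by blast
qed

text \<open>Integration over \<open>[a, b]\<close> is the substitution \<open>x = A y\<close> on the half period; the inverse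
  function of \<open>A\<close> is differentiable only in the interior, where \<open>R\<close> does not vanish.\<close>

lemma has_integral_half_period:
  assumes \<tau>: "0 < \<tau>" "A \<tau> = b" "\<And>y. 0 < y \<Longrightarrow> y < \<tau> \<Longrightarrow> B y > 0"
    and h: "\<And>y. (h has_real_derivative h' y) (at y)"
    and \<phi>: "\<And>y. 0 < y \<Longrightarrow> y < \<tau> \<Longrightarrow> \<phi> (A y) * B y = h' y"
  shows "(\<phi> has_integral (h \<tau> - h 0)) {a..b}"
proof -
  have inc: "A x < A y" if "0 \<le> x" "x < y" "y \<le> \<tau>" for x y
  proof (rule DERIV_pos_imp_increasing_open[OF that(2)])
    show "\<exists>D. (A has_real_derivative D) (at t) \<and> 0 < D" if "x < t" "t < y" for t
      using dA[of t] \<tau>(3)[of t] that \<open>0 \<le> x\<close> \<open>y \<le> \<tau>\<close> by (intro exI[of _ "B t"]) auto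
  qed (rule continuous_A)
  have inj: "inj_on A {0..\<tau>}" by (rule linorder_inj_onI') (use inc in force)
  have img: "A ` {0..\<tau>} = {a..b}"
  proof
    show "A ` {0..\<tau>} \<subseteq> {a..b}" using A_bounds by auto
    show "{a..b} \<subseteq> A ` {0..\<tau>}"
    proof
      fix x assume "x \<in> {a..b}"
      then show "x \<in> A ` {0..\<tau>}"
        using IVT'[of A 0 x \<tau>] \<tau>(1,2) A_0 continuous_A by (force simp: image_iff)
    qed
  qed
  define Y where "Y = inv_into {0..\<tau>} A"
  have YA: "Y (A y) = y" if "y \<in> {0..\<tau>}" for y
    unfolding Y_def by (rule inv_into_f_f[OF inj that])
  have AY: "A (Y x) = x" "Y x \<in> {0..\<tau>}" if "x \<in> {a..b}" for x
    unfolding Y_def using that f_inv_into_f[of x A "{0..\<tau>}"] inv_into_into[of x A "{0..\<tau>}"]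
    by (simp_all only: img)
  have contY: "continuous_on {a..b} Y"
    using continuous_on_inv[of "{0..\<tau>}" A Y] continuous_A YA img by auto
  have Yin: "Y x \<in> {0<..<\<tau>}" if "x \<in> {a<..<b}" for x
  proof -
    have "Y x \<in> {0..\<tau>}" "A (Y x) = x" using AY that by auto
    moreover have "Y x \<noteq> 0" "Y x \<noteq> \<tau>" using calculation that A_0 \<tau>(2) by auto
    ultimately show ?thesis by (auto simp: less_le)
  qed
  have "(\<phi> has_integral ((h \<circ> Y) b - (h \<circ> Y) a)) {a..b}"
  proof (rule fundamental_theorem_of_calculus_interior)
    show "continuous_on {a..b} (h \<circ> Y)"
      by (rule continuous_on_compose[OF contY])
         (use h in \<open>auto intro!: continuous_at_imp_continuous_on DERIV_isCont\<close>)
    fix x assume x: "x \<in> {a<..<b}"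
    note y = Yin[OF x]
    have Bp: "B (Y x) > 0" using \<tau>(3) y by auto
    have "(Y has_real_derivative inverse (B (Y x))) (at x)"
    proof (rule DERIV_inverse_function[where f = A and a = a and b = b])
      show "isCont Y x" using contY x by (auto simp: continuous_on_eq_continuous_at continuous_on_interior)
    qed (use x dA Bp AY in auto)
    from DERIV_chain2[OF h this]
    have "((h \<circ> Y) has_real_derivative h' (Y x) * inverse (B (Y x))) (at x)" by (simp add: comp_def)
    moreover have "h' (Y x) * inverse (B (Y x)) = \<phi> x"
      using \<phi>[of "Y x"] y Bp AY(1)[of x] x by (simp add: field_simps)
    ultimately show "((h \<circ> Y) has_vector_derivative \<phi> x) (at x)"
      by (simp add: has_real_derivative_iff_has_vector_derivative)
  qed (use a_less_b in auto)
  moreover have "Y a = 0" "Y b = \<tau>" using YA[of 0] YA[of \<tau>] A_0 \<tau> by auto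
  ultimately show ?thesis by simp
qed

lemma sqrt_R: "B y > 0 \<Longrightarrow> sqrt (R (A y)) = B y"
  by (simp add: energy[symmetric])

text \<open>Substituting \<open>x = A y\<close> up to the first turning time \<open>\<tau>\<close>
  evaluates the integral that defines \<open>T\<close> as \<open>2 * \<tau>\<close>, so no turning
  point lies strictly between 0 and \<open>T / 2\<close>.\<close>

lemma B_pos: assumes "0 < y" "y < T / 2" shows "B y > 0"
proof -
  obtain \<tau> where \<tau>: "0 < \<tau>" "B \<tau> = 0" "A \<tau> = b" "\<And>y. 0 < y \<Longrightarrow> y < \<tau> \<Longrightarrow> B y > 0"
    by (rule first_turning_time) blast
  have "((\<lambda>x. 1 / sqrt (R x)) has_integral (\<tau> - 0)) {a..b}"
    by (rule has_integral_half_period[OF \<tau>(1,3,4), of "\<lambda>y. y" "\<lambda>_. 1"])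
       (use \<tau>(4) sqrt_R in \<open>auto simp: less_imp_neq[symmetric]\<close>)
  then have "T = 2 * \<tau>" using T by (simp add: Rfun_eq integral_unique)
  then show ?thesis using \<tau>(4) assms by auto
qed

lemma G_lipschitz:
  obtains C where "C \<ge> 0" "\<And>x y. x \<in> {a..b} \<Longrightarrow> y \<in> {a..b} \<Longrightarrow> \<bar>G y - G x\<bar> \<le> C * \<bar>y - x\<bar>"
proof -
  have pos: "x > 0" if "x \<in> {a..b}" for x using that a_pos by auto
  have "continuous_on {a..b} G'"
    by (intro continuous_at_imp_continuous_on ballI DERIV_isCont[OF dG'[OF pos]])
  then have "bounded (G' ` {a..b})" by (intro compact_imp_bounded compact_continuous_image) auto
  then obtain C where C: "C > 0" "\<And>x. x \<in> {a..b} \<Longrightarrow> \<bar>G' x\<bar> \<le> C" unfolding bounded_pos by auto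
  show ?thesis
    by (rule that[of C]) (use C lipschitz_on_interval[OF dG[OF pos] C(2)] in auto)
qed

text \<open>The reflected wave solves the same second-order equation with the same data at 0. Since
  \<open>G\<close> is Lipschitz on the range of \<open>A\<close>, the difference of the two
  satisfies a linear bound and uniqueness applies.\<close>

lemma A_even: "A (- y) = A y" and B_odd: "B (- y) = - B y"
proof -
  obtain C where C: "C \<ge> 0" "\<And>x y. x \<in> {a..b} \<Longrightarrow> y \<in> {a..b} \<Longrightarrow> \<bar>G y - G x\<bar> \<le> C * \<bar>y - x\<bar>"
    by (rule G_lipschitz) blast
  define d where "d = (\<lambda>y. (A (- y) - A y, - B (- y) - B y))"
  have "d y = 0"
  proof (rule linear_ode_unique)
    fix t
    have 1: "((\<lambda>y. A (- y)) has_real_derivative B (- t) * - 1) (at t)"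
      by (rule DERIV_chain2[OF dA]) (auto intro!: derivative_eq_intros)
    have 2: "((\<lambda>y. B (- y)) has_real_derivative G (A (- t)) * - 1) (at t)"
      by (rule DERIV_chain2[OF dB]) (auto intro!: derivative_eq_intros)
    show "(d has_vector_derivative (B (- t) * - 1 - B t, - (G (A (- t)) * - 1) - G (A t))) (at t)"
      unfolding d_def by (intro has_vector_derivative_Pair_real DERIV_diff DERIV_minus 1 2 dA dB)
    have "norm (B (- t) * - 1 - B t, - (G (A (- t)) * - 1) - G (A t)) \<le>
        \<bar>B (- t) * - 1 - B t\<bar> + \<bar>- (G (A (- t)) * - 1) - G (A t)\<bar>" by (rule norm_Pair_abs_le)
    also have "\<dots> \<le> norm (d t) + C * norm (d t)"
    proof (rule add_mono)
      show "\<bar>B (- t) * - 1 - B t\<bar> \<le> norm (d t)"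
        using abs_le_norm_Pair(2)[of "- B (- t) - B t"] by (simp add: d_def)
      have "\<bar>G (A (- t)) - G (A t)\<bar> \<le> C * \<bar>A (- t) - A t\<bar>" using C(2) A_bounds by auto
      also have "\<dots> \<le> C * norm (d t)"
        unfolding d_def by (intro mult_left_mono abs_le_norm_Pair C)
      finally show "\<bar>- (G (A (- t)) * - 1) - G (A t)\<bar> \<le> C * norm (d t)" by simp
    qed
    finally show "norm (B (- t) * - 1 - B t, - (G (A (- t)) * - 1) - G (A t)) \<le> (1 + C) * norm (d t)"
      by (simp add: algebra_simps)
  qed (simp add: d_def zero_prod_def B_0)
  then show "A (- y) = A y" "B (- y) = - B y" by (auto simp: d_def zero_prod_def)
qed

lemma deriv_shift:
  assumes "\<And>y. (g has_real_derivative g' y) (at y)"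
  shows "((\<lambda>y. g (y + c)) has_real_derivative g' (y + c)) (at y)"
proof -
  have "((\<lambda>y. g (y + c)) has_real_derivative g' (y + c) * 1) (at y)"
    by (rule DERIV_chain2[OF assms]) (auto intro!: derivative_eq_intros)
  then show ?thesis by simp
qed

lemma B_periodic: "B (y + T) = B y"
proof -
  have "((\<lambda>y. A (y + T)) has_real_derivative B (y + T)) (at y)" by (rule deriv_shift[OF dA])
  then have "(A has_real_derivative B (y + T)) (at y)" by (simp add: A_periodic)
  then show ?thesis using DERIV_unique[OF dA] by metis
qed

lemma B_T: "B T = 0" using B_periodic[of 0] B_0 by simp
lemma A_T: "A T = a" using A_periodic[of 0] A_0 by simp

lemma antiderivative_period:
  assumes h: "\<And>y. (h has_real_derivative h' y) (at y)" "h 0 = 0" and per: "\<And>y. h' (y + T) = h' y"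
  shows "h (y + T) = h y + h T"
proof -
  have "((\<lambda>y. h (y + T) - h y) has_real_derivative h' (y + T) - h' y) (at y)" for y
    by (intro DERIV_diff deriv_shift[OF h(1)] h)
  then have "\<forall>y. ((\<lambda>y. h (y + T) - h y) has_real_derivative 0) (at y)" by (simp add: per)
  from DERIV_isconst_all[OF this, of y 0] show ?thesis using h(2) by simp
qed

lemma antiderivative_half:
  assumes h: "\<And>y. (h has_real_derivative h' y) (at y)" "h 0 = 0" and per: "\<And>y. h' (y + T) = h' y"
    and even: "\<And>y. h' (- y) = h' y"
  shows "h T = 2 * h (T / 2)"
proof -
  have "((\<lambda>y. h (- y) + h y) has_real_derivative h' (- y) * - 1 + h' y) (at y)" for y
    by (intro DERIV_add DERIV_chain2[OF h(1)] h) (auto intro!: derivative_eq_intros)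
  then have "\<forall>y. ((\<lambda>y. h (- y) + h y) has_real_derivative 0) (at y)" by (simp add: even)
  from DERIV_isconst_all[OF this, of "T / 2" 0] have "h (- (T / 2)) = - h (T / 2)" using h(2) by simp
  \<comment> \<open>Moving from \<open>- T / 2\<close> to \<open>T / 2\<close> adds
    \<open>h T\<close>, and \<open>h\<close> is odd because its derivative is even.\<close>
  then show ?thesis using antiderivative_period[OF h per, of "- (T / 2)"] by simp
qed

text \<open>This form of the moments removes the singular integrand and the moving endpoints: what
  remains is a smooth function of \<open>y\<close> evaluated at \<open>T\<close>, which the chain
  rule can differentiate in the parameters.\<close>

lemma moment_eq:
  assumes h: "\<And>y. (h has_real_derivative h' y) (at y)" "h 0 = 0" and per: "\<And>y. h' (y + T) = h' y"
    and even: "\<And>y. h' (- y) = h' y"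
    and \<phi>: "\<And>y. B y > 0 \<Longrightarrow> \<phi> (A y) * B y = h' y"
  shows "2 * integral {a..b} \<phi> = h T"
proof -
  have "(\<phi> has_integral (h (T / 2) - h 0)) {a..b}"
    by (rule has_integral_half_period[OF _ A_half B_pos h(1)]) (use T_pos B_pos \<phi> in auto)
  then show ?thesis using antiderivative_half[OF h per even] h(2) by (simp add: integral_unique)
qed

lemma \<eta>_eq: "2 * integral {a..b} (\<lambda>x. \<kappa> / (x\<^sup>2 * sqrt (R x))) = S T"
  by (rule moment_eq[OF dS S_0])
     (auto simp: A_periodic A_even sqrt_R)

lemma M_eq:
  assumes "\<And>y. (m has_real_derivative (A y)\<^sup>2) (at y)" "m 0 = 0"
  shows "2 * integral {a..b} (\<lambda>x. x\<^sup>2 / sqrt (R x)) = m T"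
  by (rule moment_eq[OF assms]) (auto simp: A_periodic A_even sqrt_R)

lemma K_eq:
  assumes "\<And>y. (k has_real_derivative (B y)\<^sup>2) (at y)" "k 0 = 0"
  shows "2 * integral {a..b} (\<lambda>x. sqrt (R x)) = k T"
  by (rule moment_eq[OF assms]) (auto simp: B_periodic B_odd sqrt_R power2_eq_square)

lemma S_periodic: "S (y + T) = S y + S T"
  by (rule antiderivative_period[OF dS S_0]) (simp add: A_periodic)

end

subsection \<open>Variation of the parameters\<close>

locale wave_family = nonlinearity +
  fixes U :: "params set" and am ap T \<eta> M K :: "params \<Rightarrow> real" and A S :: "params \<Rightarrow> real \<Rightarrow> real"
  assumes U: "open U" "U \<subseteq> Omega F"
    and endpoints: "\<And>q. q \<in> U \<Longrightarrow> turning_points F q (am q) (ap q)"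
    and endpoints_differentiable: "\<And>q. q \<in> U \<Longrightarrow> am differentiable (at q)"
      "\<And>q. q \<in> U \<Longrightarrow> ap differentiable (at q)"
    and T: "T = T_moment F am ap" and \<eta>: "\<eta> = \<eta>_moment F am ap"
    and M: "M = M_moment F am ap" and K: "K = K_moment F am ap"
    and profile: "\<And>q. q \<in> U \<Longrightarrow> wave_profile f F q (am q) (ap q) (T q) (A q) (S q)"

text \<open>The parameters move along a straight line in the direction \<open>(e, k, w, 0)\<close>.
  The three unit directions give the partial derivatives, and a general direction keeps all formulas
  in a single proof.\<close>

locale wave_line = wave_family +
  fixes E \<kappa> \<omega> \<zeta> e k w :: real
  assumes base_in_U: "(E, \<kappa>, \<omega>, \<zeta>) \<in> U"
begin

definition "line s = (E + s * e, \<kappa> + s * k, \<omega> + s * w, \<zeta>)"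
definition "lo s = am (line s)"
definition "hi s = ap (line s)"
definition "Ts s = T (line s)"
definition "\<eta>s s = \<eta> (line s)"
definition "Ms s = M (line s)"
definition "Ks s = K (line s)"
definition "As s = A (line s)"
definition "Bs s = deriv (A (line s))"
definition "Ss s = S (line s)"

lemma line_0: "line 0 = (E, \<kappa>, \<omega>, \<zeta>)" by (simp add: line_def)

lemma line_has_derivative: "(line has_derivative (\<lambda>h. (h * e, h * k, h * w, 0))) (at s)"
  unfolding line_def[abs_def]
  by (auto intro!: derivative_eq_intros)

lemma line_in_U: "\<forall>\<^sub>F s in nhds 0. line s \<in> U"
proof -
  have "isCont line 0" using line_has_derivative has_derivative_continuous by blast
  then have "(line \<longlongrightarrow> line 0) (nhds 0)"
    by (simp add: isCont_def tendsto_at_iff_tendsto_nhds)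
  then show ?thesis by (rule topological_tendstoD) (use U(1) base_in_U line_0 in auto)
qed

lemma Ts_eq: "Ts s = 2 * integral {lo s..hi s}
    (\<lambda>x. 1 / sqrt (Rfun F (E + s * e, \<kappa> + s * k, \<omega> + s * w, \<zeta>) x))"
  and \<eta>s_eq: "\<eta>s s = 2 * integral {lo s..hi s}
    (\<lambda>x. (\<kappa> + s * k) / (x\<^sup>2 * sqrt (Rfun F (E + s * e, \<kappa> + s * k, \<omega> + s * w, \<zeta>) x)))"
  and Ms_eq: "Ms s = 2 * integral {lo s..hi s}
    (\<lambda>x. x\<^sup>2 / sqrt (Rfun F (E + s * e, \<kappa> + s * k, \<omega> + s * w, \<zeta>) x))"
  and Ks_eq: "Ks s = 2 * integral {lo s..hi s}
    (\<lambda>x. sqrt (Rfun F (E + s * e, \<kappa> + s * k, \<omega> + s * w, \<zeta>) x))"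
  unfolding Ts_def \<eta>s_def Ms_def Ks_def lo_def hi_def line_def
  unfolding T \<eta> M K T_moment_def \<eta>_moment_def M_moment_def K_moment_def by simp_all

lemma wave:
  assumes "line s \<in> U"
  shows "wave f f1 f2 F (E + s * e) (\<kappa> + s * k) (\<omega> + s * w) \<zeta> (lo s) (hi s) (Ts s) (As s) (Bs s) (Ss s)"
proof unfold_locales
  show "\<kappa> + s * k > 0" using assms U(2) by (auto simp: Omega_def line_def)
  show "turning_points F (E + s * e, \<kappa> + s * k, \<omega> + s * w, \<zeta>) (lo s) (hi s)"
    using endpoints[OF assms] by (simp add: line_def lo_def hi_def)
  show "Ts s = 2 * integral {lo s..hi s}
     (\<lambda>x. 1 / sqrt (Rfun F (E + s * e, \<kappa> + s * k, \<omega> + s * w, \<zeta>) x))"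
    by (rule Ts_eq)
  show "wave_profile f F (E + s * e, \<kappa> + s * k, \<omega> + s * w, \<zeta>) (lo s) (hi s) (Ts s) (As s) (Ss s)"
    using profile[OF assms] by (simp add: Ts_def lo_def hi_def As_def Ss_def line_def)
  show "Bs s = deriv (As s)" by (simp add: Bs_def As_def)
qed

sublocale base: wave f f1 f2 F E \<kappa> \<omega> \<zeta> "lo 0" "hi 0" "Ts 0" "As 0" "Bs 0" "Ss 0"
  using wave[of 0] base_in_U line_0 by simp

text \<open>Coefficients of the expansions of \<open>G\<close> and \<open>R\<close> along the line.
  Both stop at \<open>s\<^sup>2\<close>: the energy and the frequency enter linearly,
  \<open>\<kappa>\<close> through its square.\<close>

definition "g1 x = - w * x + 2 * \<kappa> * k / x ^ 3"
definition "g1' x = - w - 6 * \<kappa> * k / x ^ 4"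
definition "g2 x = k\<^sup>2 / x ^ 3"
definition "r1 x = 2 * e - w * x\<^sup>2 - 2 * \<kappa> * k / x\<^sup>2"

lemma lo_derivative: "\<exists>D. (lo has_real_derivative D) (at 0)"
  and hi_derivative: "\<exists>D. (hi has_real_derivative D) (at 0)"
proof -
  have "lo differentiable (at 0)" "hi differentiable (at 0)"
    unfolding lo_def[abs_def] hi_def[abs_def]
    using endpoints_differentiable[OF base_in_U] differentiableI[OF line_has_derivative[of 0]]
    by (simp_all add: differentiable_compose line_0)
  then show "\<exists>D. (lo has_real_derivative D) (at 0)" "\<exists>D. (hi has_real_derivative D) (at 0)"
    by (auto simp: real_differentiable_def)
qed

lemma endpoints_near:
  assumes "\<epsilon> > 0"
  shows "\<forall>\<^sub>F s in nhds 0. \<bar>lo s - lo 0\<bar> < \<epsilon>" "\<forall>\<^sub>F s in nhds 0. \<bar>hi s - hi 0\<bar> < \<epsilon>"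
proof -
  have "isCont lo 0" "isCont hi 0" using lo_derivative hi_derivative DERIV_isCont by blast+
  then have "(lo \<longlongrightarrow> lo 0) (nhds 0)" "(hi \<longlongrightarrow> hi 0) (nhds 0)"
    by (simp_all add: isCont_def tendsto_at_iff_tendsto_nhds)
  from this[THEN tendstoD, OF assms]
  show "\<forall>\<^sub>F s in nhds 0. \<bar>lo s - lo 0\<bar> < \<epsilon>" "\<forall>\<^sub>F s in nhds 0. \<bar>hi s - hi 0\<bar> < \<epsilon>"
    by (simp_all add: dist_real_def)
qed

text \<open>One compact interval in the positive axis contains all nearby waves at all times, so the
  derivatives of the nonlinearity have bounds independent of \<open>s\<close> and
  \<open>y\<close>.\<close>

lemma As_range: "\<forall>\<^sub>F s in nhds 0. \<forall>y. As s y \<in> {lo 0 / 2..hi 0 + 1}"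
  using line_in_U endpoints_near(1)[OF half_gt_zero[OF base.a_pos]] endpoints_near(2)[OF zero_less_one]
proof eventually_elim
  case (elim s)
  interpret ws: wave f f1 f2 F "E + s * e" "\<kappa> + s * k" "\<omega> + s * w" \<zeta> "lo s" "hi s" "Ts s" "As s" "Bs s" "Ss s"
    by (rule wave) (use elim in simp)
  show ?case
  proof
    fix y show "As s y \<in> {lo 0 / 2..hi 0 + 1}"
      unfolding atLeastAtMost_iff using ws.A_bounds[of y] elim(2,3) by linarith
  qed
qed

lemma G_along_line:
  "wave.G f (\<kappa> + s * k) (\<omega> + s * w) \<zeta> x = base.G x + s * g1 x + s\<^sup>2 * g2 x" if "line s \<in> U"
  unfolding wave.G_def[OF wave[OF that]] base.G_def g1_def g2_def
  by (simp add: power2_sum power_mult_distrib add_divide_distrib algebra_simps)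

lemma R_along_line:
  "wave.R F (E + s * e) (\<kappa> + s * k) (\<omega> + s * w) \<zeta> x = base.R x + s * r1 x - s\<^sup>2 * (k\<^sup>2 / x\<^sup>2)" if "line s \<in> U"
  unfolding wave.R_def[OF wave[OF that]] base.R_def r1_def
  by (simp add: power2_sum power_mult_distrib add_divide_distrib algebra_simps)

lemma range_pos: "x \<in> {lo 0 / 2..hi 0 + 1} \<Longrightarrow> x > 0"
  using base.a_pos by auto

lemma bounded_on_range:
  assumes "\<And>x. x > 0 \<Longrightarrow> isCont h x"
  obtains C where "\<And>x. x \<in> {lo 0 / 2..hi 0 + 1} \<Longrightarrow> \<bar>h x :: real\<bar> \<le> C"
proof -
  have "continuous_on {lo 0 / 2..hi 0 + 1} h"
    using assms range_pos by (auto intro!: continuous_at_imp_continuous_on)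
  then have "bounded (h ` {lo 0 / 2..hi 0 + 1})" by (intro compact_imp_bounded compact_continuous_image) auto
  then obtain C where C: "\<forall>x\<in>{lo 0 / 2..hi 0 + 1}. \<bar>h x\<bar> \<le> C" by (auto simp: bounded_iff)
  show ?thesis by (rule that[of C]) (use C in blast)
qed

text \<open>The candidate \<open>z\<close> is constructed as the solution of the linearized equation
  rather than extracted from the family. Its initial data come from \<open>As s 0 = lo s\<close> and
  \<open>Bs s 0 = 0\<close>: the slope of the left endpoint, and 0.\<close>

lemma linearized_solution:
  obtains z z1 where "udiff As z" "udiff Bs z1" "\<And>y. (z has_real_derivative z1 y) (at y)"
    "\<And>y. (z1 has_real_derivative base.G' (As 0 y) * z y + g1 (As 0 y)) (at y)" "z1 0 = 0"
proof -
  have dg1: "(g1 has_real_derivative g1' x) (at x)" if "x > 0" for x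
  proof -
    have "(g1 has_real_derivative - w * 1 + - (real 3 * (2 * \<kappa> * k) / x ^ Suc 3)) (at x)"
      unfolding g1_def[abs_def] using that
      by (intro DERIV_add DERIV_cmult DERIV_const_divide_power DERIV_ident) auto
    then show ?thesis by (simp add: g1'_def mult.assoc)
  qed
  obtain C1 where C1: "\<And>x. x \<in> {lo 0 / 2..hi 0 + 1} \<Longrightarrow> \<bar>base.G' x\<bar> \<le> C1"
    by (rule bounded_on_range[of base.G']) (use base.dG' in \<open>auto intro: DERIV_isCont\<close>)
  obtain C2 where C2: "\<And>x. x \<in> {lo 0 / 2..hi 0 + 1} \<Longrightarrow> \<bar>base.G'' x\<bar> \<le> C2"
    by (rule bounded_on_range[of base.G''])
       (use base.continuous_on_G'' in \<open>auto simp: continuous_on_eq_continuous_at\<close>)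
  obtain C3 where C3: "\<And>x. x \<in> {lo 0 / 2..hi 0 + 1} \<Longrightarrow> \<bar>g1 x\<bar> \<le> C3"
    by (rule bounded_on_range[of g1]) (use dg1 in \<open>auto intro: DERIV_isCont\<close>)
  obtain C4 where C4: "\<And>x. x \<in> {lo 0 / 2..hi 0 + 1} \<Longrightarrow> \<bar>g1' x\<bar> \<le> C4"
    by (rule bounded_on_range[of g1']) (auto simp: g1'_def[abs_def] intro!: continuous_intros)
  obtain C5 where C5: "\<And>x. x \<in> {lo 0 / 2..hi 0 + 1} \<Longrightarrow> \<bar>g2 x\<bar> \<le> C5"
    by (rule bounded_on_range[of g2]) (auto simp: g2_def[abs_def] intro!: continuous_intros)
  define C where "C = Max {C1, C2, C3, C4, C5}"
  have C: "C1 \<le> C" "C2 \<le> C" "C3 \<le> C" "C4 \<le> C" "C5 \<le> C" by (auto simp: C_def)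
  have A0: "As 0 y \<in> {lo 0 / 2..hi 0 + 1}" for y using eventually_nhds_x_imp_x[OF As_range] by blast
  obtain a' where a': "(lo has_real_derivative a') (at 0)" using lo_derivative by blast
  define P where "P = (\<lambda>y (u, v). (v, base.G' (As 0 y) * u) :: real \<times> real)"
  have cG': "continuous_on UNIV (\<lambda>y. base.G' (As 0 y))"
    by (intro continuous_at_imp_continuous_on ballI isCont_o2[OF DERIV_isCont[OF base.dA]]
        DERIV_isCont[OF base.dG'] base.A_pos)
  have cg1: "continuous_on UNIV (\<lambda>y. g1 (As 0 y))"
    by (intro continuous_at_imp_continuous_on ballI isCont_o2[OF DERIV_isCont[OF base.dA]]
        DERIV_isCont[OF dg1] base.A_pos)
  have "\<exists>x. x 0 = (a', 0) \<and> (\<forall>y. (x has_vector_derivative P y (x y) + (0, g1 (As 0 y))) (at y))"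
  proof (rule linear_ode_exists)
    show "linear (P y)" for y
      by (rule linearI) (auto simp: P_def algebra_simps)
    show "norm (P y x) \<le> (1 + C) * norm x" for y x
    proof -
      obtain u v where x: "x = (u, v)" by force
      have "norm (P y x) \<le> \<bar>v\<bar> + \<bar>base.G' (As 0 y) * u\<bar>" unfolding P_def x by (simp add: norm_Pair_abs_le)
      also have "\<dots> \<le> norm (u, v) + C * norm (u, v)"
        unfolding abs_mult using C1[OF A0[of y]] C(1)
        by (intro add_mono mult_mono abs_le_norm_Pair) auto
      finally show ?thesis by (simp add: x algebra_simps)
    qed
    show "continuous_on UNIV (\<lambda>y. P y (x y))" if "continuous_on UNIV x" for x
      unfolding P_def case_prod_unfold using that by (intro continuous_intros cG')
    show "continuous_on UNIV (\<lambda>y. (0, g1 (As 0 y)))" by (intro continuous_intros cg1)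
  qed
  then obtain x where x: "x 0 = (a', 0)"
    "\<And>y. (x has_vector_derivative P y (x y) + (0, g1 (As 0 y))) (at y)" by blast
  define z where "z y = fst (x y)" for y
  define z1 where "z1 y = snd (x y)" for y
  have z: "(z has_real_derivative z1 y) (at y)" for y
    using bounded_linear.has_vector_derivative[OF bounded_linear_fst x(2)[of y]]
    by (simp add: z_def[abs_def] z1_def P_def has_real_derivative_iff_has_vector_derivative case_prod_unfold)
  have z1: "(z1 has_real_derivative base.G' (As 0 y) * z y + g1 (As 0 y)) (at y)" for y
    using bounded_linear.has_vector_derivative[OF bounded_linear_snd x(2)[of y]]
    by (simp add: z_def z1_def[abs_def] P_def has_real_derivative_iff_has_vector_derivative case_prod_unfold)
  have ic: "((\<lambda>s. As s 0) has_real_derivative z 0) (at 0)"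
  proof -
    have "\<forall>\<^sub>F s in nhds 0. lo s = As s 0"
      using line_in_U
    proof eventually_elim
      case (elim s)
      show ?case using wave.A_0[OF wave[OF elim]] by simp
    qed
    then show ?thesis using a' x(1) by (subst DERIV_cong_ev[OF refl _ refl, of _ lo]) (auto simp: z_def eq_commute)
  qed
  have B0: "\<forall>\<^sub>F s in nhds 0. Bs s 0 = 0"
    using line_in_U
  proof eventually_elim
    case (elim s)
    show ?case by (rule wave.B_0[OF wave[OF elim]])
  qed
  have sol: "\<forall>\<^sub>F s in nhds 0. \<forall>y. (As s has_real_derivative Bs s y) (at y) \<and>
      (Bs s has_real_derivative base.G (As s y) + s * g1 (As s y) + s\<^sup>2 * g2 (As s y)) (at y) \<and>
      As s y \<in> {lo 0 / 2..hi 0 + 1}"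
    using line_in_U As_range
  proof eventually_elim
    case (elim s)
    show ?case
      using wave.dA[OF wave[OF elim(1)]] wave.dB[OF wave[OF elim(1)]] elim(2)
      unfolding G_along_line[OF elim(1)] by blast
  qed
  have bnd: "\<bar>base.G' x\<bar> \<le> C \<and> \<bar>base.G'' x\<bar> \<le> C \<and> \<bar>g1 x\<bar> \<le> C \<and> \<bar>g1' x\<bar> \<le> C \<and> \<bar>g2 x\<bar> \<le> C"
    if "x \<in> {lo 0 / 2..hi 0 + 1}" for x
    using C1[OF that] C2[OF that] C3[OF that] C4[OF that] C5[OF that] C by linarith
  have z10: "z1 0 = 0" using x(1) by (simp add: z1_def)
  note U = udiff_second_order[where A = As and B = Bs and ?G0.0 = base.G and ?G0' = base.G' and ?G0'' = base.G'',
      OF sol base.dG[OF range_pos] base.dG'[OF range_pos] dg1[OF range_pos] bnd z z1 ic B0 z10]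
  show ?thesis by (rule that[OF U z z1 z10])
qed

end

locale wave_variation = wave_line +
  fixes z z1
  assumes udiff_A: "udiff As z" and udiff_B: "udiff Bs z1"
    and dz: "\<And>y. (z has_real_derivative z1 y) (at y)"
    and dz1: "\<And>y. (z1 has_real_derivative base.G' (As 0 y) * z y + g1 (As 0 y)) (at y)"
    and z1_0: "z1 0 = 0"
begin

lemma continuous_z: "continuous_on X z" and continuous_z1: "continuous_on X z1"
  using dz dz1 DERIV_isCont continuous_at_imp_continuous_on by metis+

lemma isCont_z: "isCont z y" and isCont_z1: "isCont z1 y"
  using dz dz1 DERIV_isCont by blast+

text \<open>The half period is the first time at which \<open>A\<close> reaches its maximum, where \<open>A'\<close> changes sign
  transversally; neither can jump under a uniformly small perturbation.\<close>

lemma half_period_continuous: "isCont (\<lambda>s. Ts s / 2) 0"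
proof -
  have "\<forall>\<^sub>F s in nhds 0. \<bar>Ts s / 2 - Ts 0 / 2\<bar> < \<epsilon>" if \<epsilon>: "\<epsilon> > 0" for \<epsilon>
  proof -
    define \<tau> where "\<tau> = Ts 0 / 2"
    have \<tau>0: "\<tau> > 0" using base.T_pos by (simp add: \<tau>_def)
    obtain d where d: "d > 0" "\<And>h. 0 < h \<Longrightarrow> h < d \<Longrightarrow> Bs 0 (\<tau> + h) < Bs 0 \<tau>"
      using DERIV_neg_dec_right[OF base.dB[of \<tau>]] base.G_b base.A_half by (auto simp: \<tau>_def)
    define h where "h = min (d / 2) (\<epsilon> / 2)"
    have h: "0 < h" "h < d" "h < \<epsilon>" using d(1) \<epsilon> by (auto simp: h_def min_def)
    have neg: "Bs 0 (\<tau> + h) < 0" using d(2)[OF h(1,2)] base.B_half by (simp add: \<tau>_def)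
    define c where "c = - Bs 0 (\<tau> + h)"
    have c: "c > 0" using neg by (simp add: c_def)
    obtain L1 where L1: "L1 > 0"
      "\<forall>\<^sub>F s in nhds 0. \<forall>y. \<bar>y\<bar> \<le> \<tau> + h \<longrightarrow> \<bar>Bs s y - Bs 0 y\<bar> \<le> L1 * \<bar>s\<bar>"
      by (rule udiff_lipschitz[OF udiff_B continuous_z1])
    obtain L2 where L2: "L2 > 0"
      "\<forall>\<^sub>F s in nhds 0. \<forall>y. \<bar>y\<bar> \<le> \<tau> \<longrightarrow> \<bar>As s y - As 0 y\<bar> \<le> L2 * \<bar>s\<bar>"
      by (rule udiff_lipschitz[OF udiff_A continuous_z])
    \<comment> \<open>On \<open>[0, \<tau> - h]\<close> the base wave stays at least
      \<open>\<beta>\<close> below its maximum, so a nearby wave cannot reach its own maximum there.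
      The \<open>max\<close> covers the case \<open>h > \<tau>\<close>.\<close>
    define \<beta> where "\<beta> = hi 0 - As 0 (max 0 (\<tau> - h))"
    have inc: "As 0 y \<le> hi 0 - \<beta>" if "0 \<le> y" "y \<le> \<tau> - h" for y
    proof -
      have incr: "As 0 x < As 0 y" if "0 \<le> x" "x < y" "y \<le> \<tau>" for x y
      proof (rule DERIV_pos_imp_increasing_open[OF that(2)])
        show "\<exists>D. (As 0 has_real_derivative D) (at t) \<and> 0 < D" if "x < t" "t < y" for t
          using base.dA[of t] base.B_pos[of t] that \<open>0 \<le> x\<close> \<open>y \<le> \<tau>\<close>
          by (intro exI[of _ "Bs 0 t"]) (auto simp: \<tau>_def)
      qed (rule base.continuous_A)
      have "As 0 y \<le> As 0 (max 0 (\<tau> - h))"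
        using incr[of y "max 0 (\<tau> - h)"] that h by (cases "y = max 0 (\<tau> - h)") auto
      then show "As 0 y \<le> hi 0 - \<beta>" by (simp add: \<beta>_def)
    qed
    have \<beta>: "\<beta> > 0"
    proof -
      have "As 0 (max 0 (\<tau> - h)) < As 0 \<tau>"
      proof (rule DERIV_pos_imp_increasing_open[where f = "As 0"])
        show "\<exists>D. (As 0 has_real_derivative D) (at t) \<and> 0 < D" if "max 0 (\<tau> - h) < t" "t < \<tau>" for t
          using base.dA[of t] base.B_pos[of t] that by (intro exI[of _ "Bs 0 t"]) (auto simp: \<tau>_def)
      qed (use h \<tau>0 base.continuous_A in auto)
      then show ?thesis using base.A_half by (simp add: \<beta>_def \<tau>_def)
    qed
    have pos: "c / L1 > 0" "\<beta> / (2 * L2) > 0" "\<beta> / 2 > 0" using c L1(1) \<beta> L2(1) by auto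
    show ?thesis
      using L1(2) L2(2) line_in_U eventually_small[OF pos(1)] eventually_small[OF pos(2)]
        endpoints_near(2)[OF pos(3)]
    proof eventually_elim
      case (elim s)
      have U: "line s \<in> U" using elim by simp
      interpret ws: wave f f1 f2 F "E + s * e" "\<kappa> + s * k" "\<omega> + s * w" \<zeta> "lo s" "hi s" "Ts s" "As s" "Bs s" "Ss s"
        by (rule wave[OF U])
      have "L1 * \<bar>s\<bar> < c" using elim(4) L1(1) by (simp add: field_simps)
      then have "Bs s (\<tau> + h) < 0" using elim(1)[rule_format, of "\<tau> + h"] \<tau>0 h by (simp add: c_def)
      \<comment> \<open>A wave has positive slope throughout the first half of its own period, so a
        negative slope at \<open>\<tau> + h\<close> bounds that half period from above.\<close>
      then have 1: "Ts s / 2 \<le> \<tau> + h" using ws.B_pos[of "\<tau> + h"] \<tau>0 h by force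
      have 2: "\<tau> - h < Ts s / 2"
      proof (rule ccontr)
        assume "\<not> \<tau> - h < Ts s / 2"
        then have y: "0 \<le> Ts s / 2" "Ts s / 2 \<le> \<tau> - h" using ws.T_pos by auto
        have "L2 * \<bar>s\<bar> < \<beta> / 2" using elim(5) L2(1) by (simp add: field_simps)
        moreover have "\<bar>As s (Ts s / 2) - As 0 (Ts s / 2)\<bar> \<le> L2 * \<bar>s\<bar>"
          using elim(2)[rule_format, of "Ts s / 2"] y h by auto
        moreover have "\<bar>hi s - hi 0\<bar> < \<beta> / 2" using elim(6) by (simp add: field_simps)
        ultimately show False using inc[OF y] ws.A_half by linarith
      qed
      show ?case using 1 2 h by (simp add: \<tau>_def abs_less_iff field_simps)
    qed
  qed
  then have "((\<lambda>s. Ts s / 2) \<longlongrightarrow> Ts 0 / 2) (nhds 0)"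
    by (intro tendstoI) (simp add: dist_real_def)
  then show ?thesis unfolding isCont_def by (rule tendsto_mono[OF at_within_le_nhds])
qed

text \<open>Implicit differentiation of \<open>Bs s (Ts s / 2) = 0\<close>. The
  \<open>y\<close>-derivative of \<open>B\<close> at the maximum is \<open>G (hi 0)\<close>, which
  is negative because the root of \<open>R\<close> is simple.\<close>

definition "T' = - 2 * z1 (Ts 0 / 2) / base.G (hi 0)"

lemma dT: "(Ts has_real_derivative T') (at 0)"
proof -
  have "\<forall>\<^sub>F s in nhds 0. Bs s (Ts s / 2) = 0"
    using line_in_U
  proof eventually_elim
    case (elim s)
    show ?case by (rule wave.B_half[OF wave[OF elim]])
  qed
  from udiff_implicit[where \<tau> = "\<lambda>s. Ts s / 2", OF udiff_B isCont_z1 base.dB _ half_period_continuous this]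
  have "((\<lambda>s. Ts s / 2) has_real_derivative - z1 (Ts 0 / 2) / base.G (hi 0)) (at 0)"
    using base.G_b base.A_half by simp
  from DERIV_cmult[OF this, of 2] show ?thesis by (simp add: T'_def)
qed

lemma udiff_chain_period:
  assumes "udiff x x'" "isCont x' (y + Ts 0)" "(x 0 has_real_derivative c) (at (y + Ts 0))"
  shows "((\<lambda>s. x s (y + Ts s)) has_real_derivative x' (y + Ts 0) + c * T') (at 0)"
  by (rule udiff_chain[where \<tau> = "\<lambda>s. y + Ts s", OF assms]) (auto intro!: derivative_eq_intros dT)

text \<open>Differentiate \<open>As s (y + Ts s) = As s y\<close> in \<open>s\<close>. The
  derivative of a periodic family is not periodic, because the period moves too.\<close>

lemma z_shift: "z (y + Ts 0) = z y - T' * Bs 0 y"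
proof -
  have "((\<lambda>s. As s (y + Ts s)) has_real_derivative z (y + Ts 0) + Bs 0 (y + Ts 0) * T') (at 0)"
    by (rule udiff_chain_period[OF udiff_A isCont_z base.dA])
  moreover have "\<forall>\<^sub>F s in nhds 0. As s (y + Ts s) = As s y"
    using line_in_U
  proof eventually_elim
    case (elim s)
    show ?case by (rule wave.A_periodic[OF wave[OF elim]])
  qed
  ultimately have "((\<lambda>s. As s y) has_real_derivative z (y + Ts 0) + Bs 0 (y + Ts 0) * T') (at 0)"
    by (subst (asm) DERIV_cong_ev[OF refl _ refl]) auto
  then have "z (y + Ts 0) + Bs 0 (y + Ts 0) * T' = z y"
    using udiff_pointwise[OF udiff_A] DERIV_unique by blast
  then show ?thesis by (simp add: base.B_periodic algebra_simps)
qed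

text \<open>Derivative in \<open>s\<close> of the energy identity; \<open>r1\<close> is the explicit
  change of \<open>R\<close> with its parameters. At \<open>y = 0\<close> it determines
  \<open>z 0\<close>, and integrated over a period it yields the derivative of the action.\<close>

lemma energy_variation: "2 * Bs 0 y * z1 y = 2 * base.G (As 0 y) * z y + r1 (As 0 y)"
proof -
  have dB2: "((\<lambda>s. (Bs s y)\<^sup>2) has_real_derivative 2 * Bs 0 y * z1 y) (at 0)"
    using DERIV_power[OF udiff_pointwise[OF udiff_B, of y], of 2] by (simp add: mult_ac)
  have "\<forall>\<^sub>F s in nhds 0. (Bs s y)\<^sup>2 = base.R (As s y) + s * r1 (As s y) - s\<^sup>2 * (k\<^sup>2 / (As s y)\<^sup>2)"
    using line_in_U
  proof eventually_elim
    case (elim s)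
    show ?case using wave.energy[OF wave[OF elim], of y] R_along_line[OF elim] by simp
  qed
  moreover have "((\<lambda>s. base.R (As s y) + s * r1 (As s y) - s\<^sup>2 * (k\<^sup>2 / (As s y)\<^sup>2)) has_real_derivative
      2 * base.G (As 0 y) * z y + r1 (As 0 y)) (at 0)"
  proof -
    have p: "As 0 y \<noteq> 0" using base.A_pos[of y] by simp
    note dA = udiff_pointwise[OF udiff_A, of y]
    have 1: "((\<lambda>s. base.R (As s y)) has_real_derivative 2 * base.G (As 0 y) * z y) (at 0)"
      by (rule DERIV_chain2[OF base.dR[OF base.A_pos] dA])
    have D2: "((\<lambda>s. c / (As s y)\<^sup>2) has_real_derivative - (real 2 * c / As 0 y ^ Suc 2) * z y) (at 0)" for c
      by (rule DERIV_chain2[OF DERIV_const_divide_power[OF p] dA])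
    have D1: "((\<lambda>s. r1 (As s y)) has_real_derivative
        0 - w * (real 2 * (z y * As 0 y ^ (2 - Suc 0))) - - (real 2 * (2 * \<kappa> * k) / As 0 y ^ Suc 2) * z y) (at 0)"
      unfolding r1_def by (intro DERIV_diff DERIV_const DERIV_cmult DERIV_power dA D2)
    show ?thesis by (rule derivative_eq_intros 1 D1 D2 refl)+ simp
  qed
  ultimately have "((\<lambda>s. (Bs s y)\<^sup>2) has_real_derivative 2 * base.G (As 0 y) * z y + r1 (As 0 y)) (at 0)"
    by (subst DERIV_cong_ev[OF refl _ refl])
  then show ?thesis by (rule DERIV_unique[OF dB2])
qed

lemma z_0: "2 * base.G (lo 0) * z 0 + r1 (lo 0) = 0"
  using energy_variation[of 0] by (simp add: z1_0 base.A_0)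

lemma antiderivatives:
  assumes "\<forall>\<^sub>F s in nhds 0. continuous_on UNIV (x s)"
  obtains X :: "real \<Rightarrow> real \<Rightarrow> real"
    where "\<forall>\<^sub>F s in nhds 0. X s 0 = 0 \<and> (\<forall>y. (X s has_real_derivative x s y) (at y))"
proof -
  have "\<exists>H. H 0 = 0 \<and> (\<forall>y. (H has_real_derivative x s y) (at y))" if "continuous_on UNIV (x s)" for s
    using antiderivative_exists[OF that] unfolding has_real_derivative_iff_has_vector_derivative .
  then have "\<forall>s. \<exists>H. continuous_on UNIV (x s) \<longrightarrow> H 0 = 0 \<and> (\<forall>y. (H has_real_derivative x s y) (at y))"
    by blast
  then obtain X where "\<forall>s. continuous_on UNIV (x s) \<longrightarrow> X s 0 = 0 \<and> (\<forall>y. (X s has_real_derivative x s y) (at y))"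
    unfolding choice_iff by (rule exE)
  then show ?thesis by (intro that[of X] eventually_mono[OF assms]) simp
qed

lemma real_antiderivative:
  assumes "continuous_on UNIV h"
  obtains H :: "real \<Rightarrow> real" where "H 0 = 0" "\<And>y. (H has_real_derivative h y) (at y)"
  using antiderivative_exists[OF assms] unfolding has_real_derivative_iff_has_vector_derivative by blast

text \<open>The moment is \<open>X s (Ts s)\<close> for an antiderivative \<open>X s\<close> of the
  squared amplitude. Its derivative is the integral of \<open>2 * A * z\<close> plus the
  contribution of the moving end, where \<open>A\<close> equals \<open>lo 0\<close>; solving for the
  integral gives the pairing with the rotation mode.\<close>

lemma mass_variation:
  obtains M' where "(Ms has_real_derivative M') (at 0)"
    "((\<lambda>y. As 0 y * z y) has_integral (M' - T' * (lo 0)\<^sup>2) / 2) {0..Ts 0}"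
proof -
  have "\<forall>\<^sub>F s in nhds 0. continuous_on UNIV (\<lambda>y. (As s y)\<^sup>2)"
    using line_in_U
  proof eventually_elim
    case (elim s)
    show ?case by (intro continuous_intros wave.continuous_A[OF wave[OF elim]])
  qed
  then obtain X where X: "\<forall>\<^sub>F s in nhds 0. X s 0 = 0 \<and> (\<forall>y. (X s has_real_derivative (As s y)\<^sup>2) (at y))"
    by (rule antiderivatives)
  obtain Z where Z: "Z 0 = 0" "\<And>y. (Z has_real_derivative 2 * As 0 y * z y) (at y)"
    by (rule real_antiderivative[of "\<lambda>y. 2 * As 0 y * z y"])
       (auto intro!: continuous_intros base.continuous_A continuous_z)
  have "udiff (\<lambda>s y. (As s y)\<^sup>2) (\<lambda>y. 2 * As 0 y * z y)"
    using udiff_mult[OF udiff_A udiff_A continuous_z continuous_z base.continuous_A base.continuous_A]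
    by (simp add: power2_eq_square mult_ac)
  from udiff_integral[OF this X Z] have uX: "udiff X Z" .
  have "((\<lambda>s. X s (0 + Ts s)) has_real_derivative Z (0 + Ts 0) + (As 0 (0 + Ts 0))\<^sup>2 * T') (at 0)"
    by (rule udiff_chain_period[OF uX]) (use Z DERIV_isCont eventually_nhds_x_imp_x[OF X] in blast)+
  moreover have "\<forall>\<^sub>F s in nhds 0. X s (0 + Ts s) = Ms s"
    using line_in_U X
  proof eventually_elim
    case (elim s)
    have "2 * integral {lo s..hi s} (\<lambda>x. x\<^sup>2 / sqrt (wave.R F (E + s * e) (\<kappa> + s * k) (\<omega> + s * w) \<zeta> x)) = X s (Ts s)"
      by (rule wave.M_eq[OF wave[OF elim(1)]]) (use elim(2) in auto)
    then show ?case by (simp add: Ms_eq wave.Rfun_eq[OF wave[OF elim(1)]])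
  qed
  ultimately have dM: "(Ms has_real_derivative Z (Ts 0) + (lo 0)\<^sup>2 * T') (at 0)"
    by (subst (asm) DERIV_cong_ev[OF refl _ refl]) (auto simp: base.A_T)
  have "((\<lambda>y. 2 * As 0 y * z y) has_integral (Z (Ts 0) - Z 0)) {0..Ts 0}"
    by (rule fundamental_theorem_of_calculus)
       (use base.T_pos Z(2) in \<open>auto simp: has_real_derivative_iff_has_vector_derivative[symmetric] intro: has_field_derivative_at_within\<close>)
  from has_integral_mult_right[OF this, of "1 / 2"]
  have "((\<lambda>y. As 0 y * z y) has_integral Z (Ts 0) / 2) {0..Ts 0}" by (simp add: Z(1))
  then show ?thesis using that[OF dM] by simp
qed

lemma action_variation: "(Ks has_real_derivative e * Ts 0 - w * Ms 0 / 2 - k * \<eta>s 0) (at 0)"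
proof -
  have "\<forall>\<^sub>F s in nhds 0. continuous_on UNIV (\<lambda>y. (Bs s y)\<^sup>2)"
    using line_in_U
  proof eventually_elim
    case (elim s)
    show ?case by (intro continuous_intros wave.continuous_B[OF wave[OF elim]])
  qed
  then obtain X where X: "\<forall>\<^sub>F s in nhds 0. X s 0 = 0 \<and> (\<forall>y. (X s has_real_derivative (Bs s y)\<^sup>2) (at y))"
    by (rule antiderivatives)
  obtain Z where Z: "Z 0 = 0" "\<And>y. (Z has_real_derivative 2 * Bs 0 y * z1 y) (at y)"
    by (rule real_antiderivative[of "\<lambda>y. 2 * Bs 0 y * z1 y"])
       (auto intro!: continuous_intros base.continuous_B continuous_z1)
  have "udiff (\<lambda>s y. (Bs s y)\<^sup>2) (\<lambda>y. 2 * Bs 0 y * z1 y)"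
    using udiff_mult[OF udiff_B udiff_B continuous_z1 continuous_z1 base.continuous_B base.continuous_B]
    by (simp add: power2_eq_square mult_ac)
  from udiff_integral[OF this X Z] have uX: "udiff X Z" .
  have "((\<lambda>s. X s (0 + Ts s)) has_real_derivative Z (0 + Ts 0) + (Bs 0 (0 + Ts 0))\<^sup>2 * T') (at 0)"
    by (rule udiff_chain_period[OF uX]) (use Z DERIV_isCont eventually_nhds_x_imp_x[OF X] in blast)+
  moreover have "\<forall>\<^sub>F s in nhds 0. X s (0 + Ts s) = Ks s"
    using line_in_U X
  proof eventually_elim
    case (elim s)
    have "2 * integral {lo s..hi s} (\<lambda>x. sqrt (wave.R F (E + s * e) (\<kappa> + s * k) (\<omega> + s * w) \<zeta> x)) = X s (Ts s)"
      by (rule wave.K_eq[OF wave[OF elim(1)]]) (use elim(2) in auto)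
    then show ?case by (simp add: Ks_eq wave.Rfun_eq[OF wave[OF elim(1)]])
  qed
  ultimately have dK: "(Ks has_real_derivative Z (Ts 0)) (at 0)"
    by (subst (asm) DERIV_cong_ev[OF refl _ refl]) (auto simp: base.B_T)
  obtain m where m: "m 0 = 0" "\<And>y. (m has_real_derivative (As 0 y)\<^sup>2) (at y)"
    by (rule real_antiderivative[of "\<lambda>y. (As 0 y)\<^sup>2"]) (auto intro!: continuous_intros base.continuous_A)
  have mT: "m (Ts 0) = Ms 0"
    using base.M_eq[OF m(2,1)] Ms_eq[of 0] by (simp add: base.Rfun_eq)
  have ST: "Ss 0 (Ts 0) = \<eta>s 0"
    using base.\<eta>_eq \<eta>s_eq[of 0] by (simp add: base.Rfun_eq)
  \<comment> \<open>By the varied energy identity \<open>H\<close> is constant. Its boundary term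
    \<open>Bs 0 y * z y\<close> vanishes at 0 and at the period because the amplitude is minimal
    there, which leaves the explicit change of \<open>R\<close> integrated along the wave.\<close>
  define H where "H y = 2 * Z y - 2 * (Bs 0 y * z y) - (2 * e * y - w * m y - 2 * k * Ss 0 y)" for y
  have "(H has_real_derivative 0) (at y)" for y
  proof -
    have "(H has_real_derivative 2 * (2 * Bs 0 y * z1 y) - 2 * (base.G (As 0 y) * z y + z1 y * Bs 0 y)
        - (2 * e * 1 - w * (As 0 y)\<^sup>2 - 2 * k * (\<kappa> / (As 0 y)\<^sup>2))) (at y)"
      unfolding H_def[abs_def]
      by (intro DERIV_diff DERIV_cmult DERIV_mult Z base.dB dz m base.dS DERIV_ident)
    moreover have "2 * (2 * Bs 0 y * z1 y) - 2 * (base.G (As 0 y) * z y + z1 y * Bs 0 y)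
        - (2 * e * 1 - w * (As 0 y)\<^sup>2 - 2 * k * (\<kappa> / (As 0 y)\<^sup>2)) = 0"
      using energy_variation[of y] by (simp add: r1_def algebra_simps)
    ultimately show ?thesis by simp
  qed
  then have "H (Ts 0) = H 0" using DERIV_isconst_all by blast
  then have "Z (Ts 0) = e * Ts 0 - w * Ms 0 / 2 - k * \<eta>s 0"
    by (simp add: H_def Z(1) m(1) base.S_0 base.B_0 base.B_T mT ST field_simps)
  then show ?thesis using dK by simp
qed

text \<open>The phase is the \<open>y\<close>-integral of \<open>\<kappa> / A\<^sup>2\<close>, so
  its expansion follows from those of composition, product and integral. Differentiating
  \<open>S (T) = \<eta>\<close> and \<open>S (y + T) = S y + \<eta>\<close> along the family gives
  \<open>\<eta>'\<close> and the shift rule.\<close>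

lemma phase_variation:
  obtains \<eta>' \<xi> where "(\<eta>s has_real_derivative \<eta>') (at 0)" "\<xi> 0 = 0"
    "\<And>y. ((\<lambda>s. Ss s y) has_real_derivative \<xi> y) (at 0)"
    "\<And>y. (\<xi> has_real_derivative k / (As 0 y)\<^sup>2 - 2 * \<kappa> * z y / (As 0 y) ^ 3) (at y)"
    "\<And>y. \<xi> (y + Ts 0) = \<xi> y + \<eta>' - T' * (\<kappa> / (As 0 y)\<^sup>2)"
proof -
  define x' where "x' y = k / (As 0 y)\<^sup>2 - 2 * \<kappa> * z y / (As 0 y) ^ 3" for y
  have An: "As 0 y \<noteq> 0" for y using base.A_pos[of y] by simp
  obtain \<xi> where \<xi>: "\<xi> 0 = 0" "\<And>y. (\<xi> has_real_derivative x' y) (at y)"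
    by (rule real_antiderivative[of x'])
       (auto simp: x'_def[abs_def] An intro!: continuous_intros base.continuous_A continuous_z)
  have d1: "((\<lambda>x. 1 / x\<^sup>2) has_real_derivative - (2 / x ^ 3)) (at x)" if "x > 0" for x :: real
    using DERIV_const_divide_power[of x 1 2] that by (simp add: numeral_3_eq_3 numeral_2_eq_2)
  have d2: "((\<lambda>x. - (2 / x ^ 3)) has_real_derivative 6 / x ^ 4) (at x)" if "x > 0" for x :: real
    using DERIV_minus[OF DERIV_const_divide_power[of x 2 3]] that by simp
  obtain C1 where C1: "\<And>x. x \<in> {lo 0 / 2..hi 0 + 1} \<Longrightarrow> \<bar>- (2 / x ^ 3)\<bar> \<le> C1"
    by (rule bounded_on_range[of "\<lambda>x. - (2 / x ^ 3)"]) (auto intro!: continuous_intros)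
  obtain C2 where C2: "\<And>x. x \<in> {lo 0 / 2..hi 0 + 1} \<Longrightarrow> \<bar>6 / x ^ 4\<bar> \<le> C2"
    by (rule bounded_on_range[of "\<lambda>x. 6 / x ^ 4"]) (auto intro!: continuous_intros)
  have "udiff (\<lambda>s y. 1 / (As s y)\<^sup>2) (\<lambda>y. - (2 / (As 0 y) ^ 3) * z y)"
    by (rule udiff_compose[OF udiff_A continuous_z d1 d2 _ As_range, of "max C1 C2"])
       (use range_pos C1 C2 in \<open>auto simp: le_max_iff_disj\<close>)
  then have "udiff (\<lambda>s y. (\<kappa> + s * k) * (1 / (As s y)\<^sup>2))
      (\<lambda>y. k * (1 / (As 0 y)\<^sup>2) + (\<kappa> + 0 * k) * (- (2 / (As 0 y) ^ 3) * z y))"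
    by (rule udiff_mult[OF udiff_const])
       (auto simp: An intro!: continuous_intros base.continuous_A continuous_z)
  then have u: "udiff (\<lambda>s y. (\<kappa> + s * k) / (As s y)\<^sup>2) x'" by (simp add: x'_def[abs_def] mult_ac)
  have X: "\<forall>\<^sub>F s in nhds 0. Ss s 0 = 0 \<and> (\<forall>y. (Ss s has_real_derivative (\<kappa> + s * k) / (As s y)\<^sup>2) (at y))"
    using line_in_U
  proof eventually_elim
    case (elim s)
    show ?case using wave.S_0[OF wave[OF elim]] wave.dS[OF wave[OF elim]] by blast
  qed
  have uS: "udiff Ss \<xi>" by (rule udiff_integral[OF u X \<xi>])
  define \<eta>' where "\<eta>' = \<xi> (Ts 0) + \<kappa> / (As 0 (Ts 0))\<^sup>2 * T'"
  have c: "isCont \<xi> y" for y using \<xi>(2) DERIV_isCont by blast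
  have ev\<eta>: "\<forall>\<^sub>F s in nhds 0. Ss s (0 + Ts s) = \<eta>s s"
    using line_in_U
  proof eventually_elim
    case (elim s)
    show ?case using wave.\<eta>_eq[OF wave[OF elim]] by (simp add: \<eta>s_eq wave.Rfun_eq[OF wave[OF elim]])
  qed
  have d\<eta>: "(\<eta>s has_real_derivative \<eta>') (at 0)"
    using udiff_chain_period[OF uS c base.dS, of 0] ev\<eta>
    by (subst (asm) DERIV_cong_ev[OF refl _ refl]) (auto simp: \<eta>'_def)
  have sh: "\<xi> (y + Ts 0) = \<xi> y + \<eta>' - T' * (\<kappa> / (As 0 y)\<^sup>2)" for y
  proof -
    have 1: "((\<lambda>s. Ss s (y + Ts s)) has_real_derivative \<xi> (y + Ts 0) + \<kappa> / (As 0 (y + Ts 0))\<^sup>2 * T') (at 0)"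
      by (rule udiff_chain_period[OF uS c base.dS])
    have "\<forall>\<^sub>F s in nhds 0. Ss s (y + Ts s) = Ss s y + \<eta>s s"
      using line_in_U ev\<eta>
    proof eventually_elim
      case (elim s)
      show ?case using wave.S_periodic[OF wave[OF elim(1)], of y] elim(2) by simp
    qed
    moreover have "((\<lambda>s. Ss s y + \<eta>s s) has_real_derivative \<xi> y + \<eta>') (at 0)"
      by (intro DERIV_add udiff_pointwise[OF uS] d\<eta>)
    ultimately have "((\<lambda>s. Ss s (y + Ts s)) has_real_derivative \<xi> y + \<eta>') (at 0)"
      by (subst DERIV_cong_ev[OF refl _ refl])
    then have "\<xi> (y + Ts 0) + \<kappa> / (As 0 (y + Ts 0))\<^sup>2 * T' = \<xi> y + \<eta>'"
      by (rule DERIV_unique[OF 1])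
    then show ?thesis by (simp add: base.A_periodic algebra_simps)
  qed
  show ?thesis
    by (rule that[OF d\<eta> \<xi>(1) udiff_pointwise[OF uS] _ sh]) (use \<xi>(2) in \<open>simp add: x'_def\<close>)
qed

end

subsection \<open>Operators with periodic coefficients\<close>

lemma periodic_continuous_bounded:
  fixes h :: "real \<Rightarrow> real"
  assumes T: "T > 0" and c: "continuous_on UNIV h" and p: "\<And>y. h (y + T) = h y"
  obtains C where "\<And>y. \<bar>h y\<bar> \<le> C"
proof -
  interpret periodic_fun_simple h T by unfold_locales (rule p)
  have "bounded (h ` {0..T})"
    by (intro compact_imp_bounded compact_continuous_image continuous_on_subset[OF c]) auto
  then obtain C where "\<forall>y\<in>{0..T}. \<bar>h y\<bar> \<le> C" by (auto simp: bounded_iff)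
  then have C: "\<And>y. y \<in> {0..T} \<Longrightarrow> \<bar>h y\<bar> \<le> C" by blast
  have "\<bar>h y\<bar> \<le> C" for y
  proof -
    define n where "n = \<lfloor>y / T\<rfloor>"
    have "of_int n \<le> y / T" "y / T < of_int n + 1" unfolding n_def by linarith+
    then have "y - of_int n * T \<in> {0..T}" using T by (auto simp: field_simps)
    from C[OF this] show ?thesis by (simp add: minus_of_int)
  qed
  then show ?thesis using that by blast
qed

text \<open>A bridge between equality almost everywhere for \<open>lborel\<close>, used in the graph
  of the operator, and gauge integrals, which ignore negligible sets.\<close>

lemma integrable_spike_AE:
  fixes g h :: "real \<Rightarrow> 'a::real_normed_vector"
  assumes "AE y in lborel. g y = h y" and "(h has_integral I) X"
  shows "(g has_integral I) X"
proof -
  have "AE y in lebesgue. g y = h y" using assms(1) by (rule AE_completion)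
  then obtain N where N: "negligible N" "{y. \<not> g y = h y} \<subseteq> N"
    unfolding eventually_ae_filter_negligible by blast
  show ?thesis by (rule has_integral_spike[OF N(1) _ assms(2)]) (use N(2) in auto)
qed

text \<open>\<open>H\<close> is only an indefinite integral of \<open>h\<close> and may fail to be
  differentiable at some points, so the product rule cannot be used pointwise. Instead the
  difference \<open>P\<close> of the two sides has increments of size
  \<open>(y - x) * (N y - N x)\<close>, where \<open>N\<close> is the integral of
  \<open>norm h\<close>. As \<open>N\<close> is continuous, \<open>P\<close> has derivative 0
  everywhere.\<close>

lemma weak_integration_by_parts:
  fixes g g' h H :: "real \<Rightarrow> complex"
  assumes ab: "a \<le> b"
    and dg: "\<And>y. y \<in> {a..b} \<Longrightarrow> (g has_vector_derivative g' y) (at y)"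
    and cg': "continuous_on {a..b} g'"
    and h: "h absolutely_integrable_on {a..b}"
    and H: "\<And>x y. a \<le> x \<Longrightarrow> x \<le> y \<Longrightarrow> y \<le> b \<Longrightarrow> (h has_integral (H y - H x)) {x..y}"
    and cH: "continuous_on {a..b} H"
  shows "((\<lambda>y. g y * h y + g' y * H y) has_integral (g b * H b - g a * H a)) {a..b}"
proof -
  have cg: "continuous_on {a..b} g"
    by (intro continuous_at_imp_continuous_on ballI has_vector_derivative_continuous[OF dg])
  let ?k = "\<lambda>y. g y * h y + g' y * H y"
  have gh: "(\<lambda>y. g y * h y) absolutely_integrable_on {a..b}"
  proof (rule absolutely_integrable_bounded_measurable_product[of "(*)"])
    show "bilinear ((*) :: complex \<Rightarrow> complex \<Rightarrow> complex)"
      unfolding bilinear_def by (auto intro!: linearI simp: algebra_simps)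
    show "g \<in> borel_measurable (lebesgue_on {a..b})"
      by (rule continuous_imp_measurable_on_sets_lebesgue[OF cg]) auto
    show "bounded (g ` {a..b})" by (intro compact_imp_bounded compact_continuous_image cg) auto
  qed (use h in auto)
  have kI: "?k integrable_on {a..b}"
  proof (rule integrable_add)
    show "(\<lambda>y. g y * h y) integrable_on {a..b}" using gh by (simp add: absolutely_integrable_on_def)
    show "(\<lambda>y. g' y * H y) integrable_on {a..b}"
      by (intro integrable_continuous_real continuous_intros cg' cH)
  qed
  have nhI: "(\<lambda>y. norm (h y)) integrable_on {a..b}" using h by (simp add: absolutely_integrable_on_def)
  have "bounded (g' ` {a..b})" by (intro compact_imp_bounded compact_continuous_image cg') auto
  then obtain C where C: "C > 0" "\<And>y. y \<in> {a..b} \<Longrightarrow> norm (g' y) \<le> C" unfolding bounded_pos by auto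
  define N where "N = (\<lambda>x. integral {a..x} (\<lambda>y. norm (h y)))"
  have cN: "continuous_on {a..b} N" unfolding N_def by (rule indefinite_integral_continuous_1[OF nhI])
  have Ndiff: "integral {x..y} (\<lambda>y. norm (h y)) = N y - N x" "0 \<le> N y - N x"
    if "a \<le> x" "x \<le> y" "y \<le> b" for x y
  proof -
    have i: "(\<lambda>y. norm (h y)) integrable_on {x..y}" "(\<lambda>y. norm (h y)) integrable_on {a..y}"
      by (rule integrable_on_subinterval[OF nhI]; use that in auto)+
    have "N x + integral {x..y} (\<lambda>y. norm (h y)) = N y"
      unfolding N_def by (rule Henstock_Kurzweil_Integration.integral_combine) (use that i in auto)
    moreover have "0 \<le> integral {x..y} (\<lambda>y. norm (h y))" by (rule integral_nonneg[OF i(1)]) auto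
    ultimately show "integral {x..y} (\<lambda>y. norm (h y)) = N y - N x" "0 \<le> N y - N x" by linarith+
  qed
  have Hb: "norm (H y - H x) \<le> N y - N x" if "a \<le> x" "x \<le> y" "y \<le> b" for x y
  proof -
    have "norm (integral {x..y} h) \<le> integral {x..y} (\<lambda>y. norm (h y))"
      by (rule integral_norm_bound_integral)
         (use H[OF that] integrable_on_subinterval[OF nhI, of x y] that in \<open>auto\<close>)
    then show ?thesis using H[OF that] Ndiff[OF that] by (simp add: integral_unique)
  qed
  define P where "P = (\<lambda>x. integral {a..x} ?k - (g x * H x - g a * H a))"
  have key: "norm (P y - P x) \<le> 2 * C * (y - x) * (N y - N x)" if xy: "a \<le> x" "x \<le> y" "y \<le> b" for x y
  proof -
    have kxy: "?k integrable_on {x..y}" by (rule integrable_on_subinterval[OF kI]) (use xy in auto)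
    have "integral {a..x} ?k + integral {x..y} ?k = integral {a..y} ?k"
      by (rule Henstock_Kurzweil_Integration.integral_combine)
         (use xy in \<open>auto intro!: integrable_on_subinterval[OF kI]\<close>)
    then have "P y - P x = integral {x..y} ?k - (g y * H y - g x * H x)"
      by (simp add: P_def algebra_simps)
    moreover
    have I1: "((\<lambda>t. g x * h t) has_integral g x * (H y - H x)) {x..y}"
      by (rule has_integral_mult_right[OF H[OF xy]])
    have "(g' has_integral (g y - g x)) {x..y}"
      by (rule fundamental_theorem_of_calculus)
         (use xy dg in \<open>auto intro: has_vector_derivative_at_within\<close>)
    from has_integral_mult_left[OF this, of "H y"]
    have I2: "((\<lambda>t. g' t * H y) has_integral (g y - g x) * H y) {x..y}" .
    have "((\<lambda>t. ?k t - g x * h t - g' t * H y) has_integral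
        (integral {x..y} ?k - g x * (H y - H x) - (g y - g x) * H y)) {x..y}"
      by (intro has_integral_diff integrable_integral kxy I1 I2)
    \<comment> \<open>Freezing \<open>g\<close> at \<open>x\<close> and \<open>H\<close> at
      \<open>y\<close> removes exactly the boundary terms; each remaining summand is a small
      increment times an integrable function.\<close>
    moreover have "(\<lambda>t. ?k t - g x * h t - g' t * H y) = (\<lambda>t. (g t - g x) * h t + g' t * (H t - H y))"
      by (simp add: fun_eq_iff algebra_simps)
    moreover have "integral {x..y} ?k - g x * (H y - H x) - (g y - g x) * H y = integral {x..y} ?k - (g y * H y - g x * H x)"
      by (simp add: algebra_simps)
    ultimately have I: "((\<lambda>t. (g t - g x) * h t + g' t * (H t - H y)) has_integral (P y - P x)) {x..y}"
      by simp
    have nxy: "(\<lambda>t. norm (h t)) integrable_on {x..y}"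
      by (rule integrable_on_subinterval[OF nhI]) (use xy in auto)
    have "norm (P y - P x) \<le> integral {x..y} (\<lambda>t. (C * (y - x)) * norm (h t) + C * (N y - N x))"
      unfolding integral_unique[OF I, symmetric]
    proof (rule integral_norm_bound_integral)
      show "(\<lambda>t. (g t - g x) * h t + g' t * (H t - H y)) integrable_on {x..y}" using I by blast
      show "(\<lambda>t. (C * (y - x)) * norm (h t) + C * (N y - N x)) integrable_on {x..y}"
        by (intro integrable_add integrable_on_mult_right nxy) auto
      fix t assume t: "t \<in> {x..y}"
      then have tab: "a \<le> t" "t \<le> b" using xy by auto
      have "norm (g t - g x) \<le> C * norm (t - x)"
      proof (rule differentiable_bound[of "{a..b}" g "\<lambda>y h. h *\<^sub>R g' y"])
        show "(g has_derivative (\<lambda>h. h *\<^sub>R g' y)) (at y within {a..b})" if "y \<in> {a..b}" for y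
          using dg[OF that] unfolding has_vector_derivative_def by (rule has_derivative_at_withinI)
        show "onorm (\<lambda>h. h *\<^sub>R g' y) \<le> C" if "y \<in> {a..b}" for y
          using C(2)[OF that] by (intro onorm_le) (simp add: mult.commute[of C] mult_left_mono)
      qed (use tab xy t in auto)
      also have "\<dots> \<le> C * (y - x)" using t C by (intro mult_left_mono) auto
      finally have 1: "norm ((g t - g x) * h t) \<le> C * (y - x) * norm (h t)"
        unfolding norm_mult by (rule mult_right_mono) simp
      have "norm (H t - H y) \<le> N y - N t"
        using Hb[of t y] t xy by (simp add: norm_minus_commute)
      also have "\<dots> \<le> N y - N x" using Ndiff(2)[of x t] t xy by simp
      finally have 2: "norm (g' t * (H t - H y)) \<le> C * (N y - N x)"
        unfolding norm_mult using C tab by (intro mult_mono) auto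
      show "norm ((g t - g x) * h t + g' t * (H t - H y)) \<le> C * (y - x) * norm (h t) + C * (N y - N x)"
        using 1 2 norm_triangle_ineq order_trans add_mono by meson
    qed
    also have "integral {x..y} (\<lambda>t. (C * (y - x)) * norm (h t) + C * (N y - N x)) =
        (C * (y - x)) * (N y - N x) + (y - x) * (C * (N y - N x))"
      using xy nxy by (subst Henstock_Kurzweil_Integration.integral_add)
        (auto intro!: integrable_on_mult_right simp: Ndiff)
    finally show ?thesis by (simp add: algebra_simps)
  qed
  have "(P has_vector_derivative 0) (at x within {a..b})" if x: "x \<in> {a..b}" for x
    unfolding has_vector_derivative_def has_derivative_within_alt2
  proof (intro conjI allI impI)
    fix e :: real assume e: "e > 0"
    have "e / (2 * C) > 0" using e C(1) by simp
    then have "\<forall>\<^sub>F y in at x within {a..b}. dist (N y) (N x) < e / (2 * C)"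
      using cN x unfolding continuous_on_def by (metis tendstoD)
    moreover have "\<forall>\<^sub>F y in at x within {a..b}. y \<in> {a..b}"
      by (simp add: eventually_at_filter)
    ultimately show "\<forall>\<^sub>F y in at x within {a..b}. norm (P y - P x - (y - x) *\<^sub>R 0) \<le> e * norm (y - x)"
    proof eventually_elim
      case (elim y)
      have "norm (P y - P x) \<le> 2 * C * \<bar>y - x\<bar> * \<bar>N y - N x\<bar>"
      proof (cases "x \<le> y")
        case True
        show ?thesis using key[of x y] Ndiff(2)[of x y] True x elim(2) by auto
      next
        case False
        then show ?thesis using key[of y x] Ndiff(2)[of y x] x elim(2) by (auto simp: norm_minus_commute)
      qed
      also have "\<dots> \<le> 2 * C * \<bar>y - x\<bar> * (e / (2 * C))"
        using elim(1) C(1) by (intro mult_left_mono) (auto simp: dist_real_def)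
      also have "\<dots> = e * \<bar>y - x\<bar>" using C(1) by simp
      finally show ?case by simp
    qed
  qed auto
  then obtain c where c: "\<And>x. x \<in> {a..b} \<Longrightarrow> P x = c"
    using has_vector_derivative_zero_constant[of "{a..b}" P] by blast
  have "P b = P a" using c ab by auto
  then have "integral {a..b} ?k = g b * H b - g a * H a" by (simp add: P_def)
  then show ?thesis using kI by (metis integrable_integral)
qed

section \<open>Pairs of complex numbers and square-integrable periodic functions\<close>

lemma bounded_linear_axis: "bounded_linear (axis i :: complex \<Rightarrow> complex^2)"
  by (rule linear_conv_bounded_linear[THEN iffD1], rule linearI) (auto simp: vec_eq_iff axis_def)

lemma vector_2_eq_axis: "(vector [a, b] :: complex^2) = axis 1 a + axis 2 b"
  by (simp add: vec_eq_iff forall_2 axis_def)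

lemma vec_eq_2: "(u = v) \<longleftrightarrow> u $ 1 = v $ 1 \<and> u $ 2 = (v $ 2 :: 'a)" for u v :: "'a^2"
  by (simp add: vec_eq_iff forall_2)

lemma continuous_on_vector_2 [continuous_intros]:
  assumes "continuous_on X a" "continuous_on X b"
  shows "continuous_on X (\<lambda>y. vector [a y, b y] :: complex^2)"
  unfolding vector_2_eq_axis
  by (intro continuous_on_add bounded_linear.continuous_on[OF bounded_linear_axis] assms)

lemma has_vector_derivative_vec_2:
  "(u has_vector_derivative d) (at y) \<longleftrightarrow>
    ((\<lambda>y. u y $ 1) has_vector_derivative d $ 1) (at y) \<and> ((\<lambda>y. u y $ 2) has_vector_derivative d $ 2) (at y)"
  for u :: "real \<Rightarrow> complex^2"
proof safe
  assume "((\<lambda>y. u y $ 1) has_vector_derivative d $ 1) (at y)" "((\<lambda>y. u y $ 2) has_vector_derivative d $ 2) (at y)"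
  then have "((\<lambda>y. axis 1 (u y $ 1) + axis 2 (u y $ 2) :: complex^2) has_vector_derivative
      axis 1 (d $ 1) + axis 2 (d $ 2)) (at y)"
    by (intro has_vector_derivative_add bounded_linear.has_vector_derivative[OF bounded_linear_axis])
  moreover have "axis 1 (v $ 1) + axis 2 (v $ 2) = v" for v :: "complex^2"
    by (simp add: vec_eq_2 axis_def)
  ultimately show "(u has_vector_derivative d) (at y)" by simp
qed (auto intro: bounded_linear.has_vector_derivative[OF bounded_linear_vec_nth])

lemma norm_vec_2_le: "norm v \<le> norm (v $ 1) + norm (v $ 2)" for v :: "complex^2"
  using L2_set_le_sum[of UNIV "\<lambda>i. norm (v $ i)"] by (simp add: norm_vec_def sum_2)

lemma L2_per_continuous:
  assumes "continuous_on UNIV v" "\<And>y. v (y + T) = v y" shows "L2_per T v"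
  unfolding L2_per_def
proof (intro conjI allI)
  show "v \<in> borel_measurable borel" by (rule borel_measurable_continuous_onI[OF assms(1)])
  show "set_integrable lborel {0..T} (\<lambda>y. (norm (v y))\<^sup>2)"
    by (rule borel_integrable_atLeastAtMost')
       (intro continuous_intros continuous_on_subset[OF assms(1)], auto)
qed (rule assms)

lemma L2_per_absolutely_integrable:
  assumes "L2_per T v" shows "(\<lambda>y. v y $ i) absolutely_integrable_on {0..T}"
proof -
  have m: "v \<in> borel_measurable borel" and s: "set_integrable lborel {0..T} (\<lambda>y. (norm (v y))\<^sup>2)"
    using assms by (auto simp: L2_per_def)
  have vi: "(\<lambda>y. v y $ i) \<in> borel_measurable borel"
    by (rule borel_measurable_continuous_on[OF _ m]) (intro continuous_intros)
  \<comment> \<open>On a bounded interval \<open>norm v \<le> 1 + (norm v)\<^sup>2\<close> makes a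
    square-integrable function integrable.\<close>
  have "set_integrable lborel {0..T} (\<lambda>y. 1 + (norm (v y))\<^sup>2)"
    by (intro set_integral_add s borel_integrable_atLeastAtMost'[OF continuous_on_const])
  then have "set_integrable lborel {0..T} (\<lambda>y. v y $ i)"
    unfolding set_integrable_def
  proof (rule Bochner_Integration.integrable_bound)
    show "(\<lambda>y. indicator {0..T} y *\<^sub>R v y $ i) \<in> borel_measurable lborel" using vi by simp
    have "norm (v y $ i) \<le> 1 + (norm (v y))\<^sup>2" for y
    proof -
      have "norm (v y $ i) \<le> norm (v y)" by (rule Finite_Cartesian_Product.norm_nth_le)
      also have "\<dots> \<le> 1 + (norm (v y))\<^sup>2"
        using sum_squares_bound[of 1 "norm (v y)"] norm_ge_zero[of "v y"] by (simp only: power_one)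
      finally show ?thesis .
    qed
    then show "AE y in lborel. norm (indicator {0..T} y *\<^sub>R v y $ i)
        \<le> norm (indicator {0..T} y *\<^sub>R (1 + (norm (v y))\<^sup>2))"
      by (intro AE_I2) (auto simp: indicator_def)
  qed
  then show ?thesis unfolding set_integrable_def
    by (subst integrable_completion) (use vi in auto)
qed

text \<open>\<open>rot\<close> is multiplication by the matrix J of the Hamiltonian structure, and
  \<open>symp w z\<close> is the bilinear form \<open>w^t J z\<close>, without conjugation.\<close>

definition rot :: "complex^2 \<Rightarrow> complex^2" where "rot v = vector [- v $ 2, v $ 1]"
definition symp :: "complex^2 \<Rightarrow> complex^2 \<Rightarrow> complex" where "symp w z = w $ 2 * z $ 1 - w $ 1 * z $ 2"

text \<open>The linearized operator with its coefficients abstracted: \<open>\<alpha>\<close> and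
  \<open>\<beta>\<close> stand for \<open>S_y\<close> and \<open>S_yy\<close>, the operator L_- is
  multiplication by \<open>V\<close> minus the second derivative, and L_+ differs from it by
  \<open>Q\<close>.\<close>

locale periodic_operator =
  fixes T :: real and \<alpha> \<beta> V Q :: "real \<Rightarrow> real"
  assumes T_pos: "T > 0"
    and d\<alpha>: "\<And>y. (\<alpha> has_real_derivative \<beta> y) (at y)"
    and cont: "continuous_on UNIV \<beta>" "continuous_on UNIV V" "continuous_on UNIV Q"
    and per: "\<And>y. \<alpha> (y + T) = \<alpha> y" "\<And>y. \<beta> (y + T) = \<beta> y" "\<And>y. V (y + T) = V y" "\<And>y. Q (y + T) = Q y"
begin

text \<open>The equation \<open>L u = v\<close> solved for the second derivative reads
  \<open>u'' = acc + rot v\<close>; \<open>Lval\<close> below is the operator itself.\<close>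

definition acc :: "real \<Rightarrow> complex^2 \<Rightarrow> complex^2 \<Rightarrow> complex^2" where
  "acc y u u1 = vector
     [of_real (V y - Q y) * u $ 1 + of_real (\<beta> y) * u $ 2 + 2 * of_real (\<alpha> y) * u1 $ 2,
      of_real (V y) * u $ 2 - of_real (\<beta> y) * u $ 1 - 2 * of_real (\<alpha> y) * u1 $ 1]"

definition Lval :: "real \<Rightarrow> complex^2 \<Rightarrow> complex^2 \<Rightarrow> complex^2 \<Rightarrow> complex^2" where
  "Lval y u u1 u2 = vector
     [of_real (\<beta> y) * u $ 1 + 2 * of_real (\<alpha> y) * u1 $ 1 - (of_real (V y) * u $ 2 - u2 $ 2),
      of_real (V y - Q y) * u $ 1 - u2 $ 1 + of_real (\<beta> y) * u $ 2 + 2 * of_real (\<alpha> y) * u1 $ 2]"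

definition op :: "((real \<Rightarrow> complex^2) \<times> (real \<Rightarrow> complex^2)) set" where
  "op = {(u, v). L2_per T v \<and>
     (\<exists>u' u''. H2_per T u u' u'' \<and> (AE y in lborel. v y = Lval y (u y) (u' y) (u'' y)))}"

text \<open>\<open>sol v u u1\<close>: the equation \<open>L u = v\<close> holds classically on the line, with \<open>u' = u1\<close> and
  without periodicity.\<close>

definition sol :: "(real \<Rightarrow> complex^2) \<Rightarrow> (real \<Rightarrow> complex^2) \<Rightarrow> (real \<Rightarrow> complex^2) \<Rightarrow> bool" where
  "sol v u u1 \<longleftrightarrow> (\<forall>y. (u has_vector_derivative u1 y) (at y) \<and>
     (u1 has_vector_derivative acc y (u y) (u1 y) + rot (v y)) (at y))"

lemma Lval_iff: "v = Lval y u u1 u2 \<longleftrightarrow> u2 = acc y u u1 + rot v"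
  by (auto simp: Lval_def acc_def rot_def vec_eq_2)

section \<open>Classical solutions on the line\<close>

lemma continuous_\<alpha>: "continuous_on X \<alpha>"
  using d\<alpha> DERIV_isCont continuous_at_imp_continuous_on by metis

lemma cont': "continuous_on X \<beta>" "continuous_on X V" "continuous_on X Q"
  using cont continuous_on_subset by blast+

lemma sol_continuous:
  assumes "sol v u u1" shows "continuous_on X u" "continuous_on X u1"
  using assms unfolding sol_def
  by (meson continuous_at_imp_continuous_on has_vector_derivative_continuous)+

lemma continuous_acc:
  assumes "continuous_on X u" "continuous_on X u1" shows "continuous_on X (\<lambda>y. acc y (u y) (u1 y))"
  unfolding acc_def by (intro continuous_intros assms continuous_\<alpha> cont')

lemma continuous_rot: "continuous_on X v \<Longrightarrow> continuous_on X (\<lambda>y. rot (v y))"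
  unfolding rot_def by (intro continuous_intros)

lemma sol_add: "sol v u u1 \<Longrightarrow> sol v' w w1 \<Longrightarrow> sol (\<lambda>y. v y + v' y) (\<lambda>y. u y + w y) (\<lambda>y. u1 y + w1 y)"
proof -
  have eq: "acc y (u + w) (u1 + w1) + rot (v + v') = (acc y u u1 + rot v) + (acc y w w1 + rot v')"
    for y u w u1 w1 v v'
    by (simp add: acc_def rot_def vec_eq_2 algebra_simps)
  show "sol v u u1 \<Longrightarrow> sol v' w w1 \<Longrightarrow> sol (\<lambda>y. v y + v' y) (\<lambda>y. u y + w y) (\<lambda>y. u1 y + w1 y)"
    unfolding sol_def eq by (auto intro!: has_vector_derivative_add)
qed

lemma sol_smult: "sol v u u1 \<Longrightarrow> sol (\<lambda>y. c *s v y) (\<lambda>y. c *s u y) (\<lambda>y. c *s u1 y)"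
proof -
  have bl: "bounded_linear (\<lambda>x :: complex^2. c *s x)"
    by (rule linear_conv_bounded_linear[THEN iffD1], rule linearI) (auto simp: vec_eq_2 algebra_simps)
  have eq: "acc y (c *s u) (c *s u1) + rot (c *s v) = c *s (acc y u u1 + rot v)" for y u u1 v
    by (simp add: acc_def rot_def vec_eq_2 algebra_simps)
  assume "sol v u u1"
  then show ?thesis unfolding sol_def eq
    by (intro allI conjI bounded_linear.has_vector_derivative[OF bl]) auto
qed

lemma sol_shift:
  assumes "sol v u u1" shows "sol (\<lambda>y. v (y + T)) (\<lambda>y. u (y + T)) (\<lambda>y. u1 (y + T))"
proof -
  have sh: "((\<lambda>y. g (y + T)) has_vector_derivative d) (at y)"
    if "(g has_vector_derivative d) (at (y + T))" for g :: "real \<Rightarrow> complex^2" and d y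
  proof -
    have "((g \<circ> (\<lambda>y. y + T)) has_vector_derivative 1 *\<^sub>R d) (at y)"
      by (rule vector_diff_chain_at) (auto intro!: derivative_eq_intros simp: that)
    then show ?thesis by (simp add: comp_def)
  qed
  have "acc (y + T) = acc y" for y by (simp add: acc_def per fun_eq_iff)
  then show ?thesis using assms unfolding sol_def by (metis sh)
qed

text \<open>Periodicity turns continuity of the coefficients into bounds on the whole line, so
  existence and uniqueness for linear equations apply globally.\<close>

lemma acc_bound: obtains C where "\<And>y u u1. norm (u1, acc y u u1) \<le> C * norm (u, u1)"
proof -
  obtain C1 where C1: "\<And>y. \<bar>\<alpha> y\<bar> \<le> C1" using periodic_continuous_bounded[OF T_pos continuous_\<alpha> per(1)] by blast
  obtain C2 where C2: "\<And>y. \<bar>\<beta> y\<bar> \<le> C2" using periodic_continuous_bounded[OF T_pos cont(1) per(2)] by blast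
  obtain C3 where C3: "\<And>y. \<bar>V y\<bar> \<le> C3" using periodic_continuous_bounded[OF T_pos cont(2) per(3)] by blast
  obtain C4 where C4: "\<And>y. \<bar>Q y\<bar> \<le> C4" using periodic_continuous_bounded[OF T_pos cont(3) per(4)] by blast
  have "norm (u1, acc y u u1) \<le> (1 + (2 * C3 + C4 + 2 * C2 + 4 * C1)) * norm (u, u1)" for y u u1
  proof -
    let ?n = "norm (u, u1)"
    have n: "norm (u $ i) \<le> ?n" "norm (u1 $ i) \<le> ?n" for i
      using Finite_Cartesian_Product.norm_nth_le norm_fst_le norm_snd_le order_trans by metis+
    have m: "norm (of_real c * x) \<le> D * ?n" if "\<bar>c\<bar> \<le> D" "norm x \<le> ?n" for c D and x :: complex
      unfolding norm_mult using that by (intro mult_mono) auto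
    have m': "norm (2 * of_real c * x) \<le> 2 * D * ?n" if "\<bar>c\<bar> \<le> D" "norm x \<le> ?n" for c D and x :: complex
      using m[OF that] by (simp add: norm_mult mult.assoc)
    have VQ: "\<bar>V y - Q y\<bar> \<le> C3 + C4" using C3[of y] C4[of y] by linarith
    have 1: "norm (acc y u u1 $ 1) \<le> (C3 + C4) * ?n + C2 * ?n + 2 * C1 * ?n"
      unfolding acc_def vector_2
      by (intro order_trans[OF norm_triangle_ineq] add_mono m m' C1 C2 VQ n)
    have 2: "norm (acc y u u1 $ 2) \<le> C3 * ?n + C2 * ?n + 2 * C1 * ?n"
      unfolding acc_def vector_2
      by (intro order_trans[OF norm_triangle_ineq4] add_mono m m' C1 C2 C3 n)
    have "norm (u1, acc y u u1) \<le> norm u1 + norm (acc y u u1)" by (rule norm_Pair_le)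
    also have "\<dots> \<le> ?n + (norm (acc y u u1 $ 1) + norm (acc y u u1 $ 2))"
      by (intro add_mono norm_vec_2_le norm_snd_le)
    also have "\<dots> \<le> ?n + (((C3 + C4) * ?n + C2 * ?n + 2 * C1 * ?n) + (C3 * ?n + C2 * ?n + 2 * C1 * ?n))"
      using 1 2 by linarith
    finally show ?thesis by (simp add: algebra_simps)
  qed
  then show ?thesis using that by blast
qed

lemma sol_unique_0:
  assumes s: "sol (\<lambda>y. 0) u u1" and ic: "u 0 = 0" "u1 0 = 0"
  shows "u y = 0" "u1 y = 0"
proof -
  obtain C where C: "\<And>y u u1. norm (u1, acc y u u1) \<le> C * norm (u, u1)" using acc_bound by blast
  have r0: "rot 0 = 0" by (simp add: rot_def vec_eq_2)
  have "(\<lambda>y. (u y, u1 y)) y = 0"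
  proof (rule linear_ode_unique[of _ "\<lambda>y. (u1 y, acc y (u y) (u1 y))" C])
    show "((\<lambda>y. (u y, u1 y)) has_vector_derivative (u1 t, acc t (u t) (u1 t))) (at t)" for t
      using s r0 by (intro has_vector_derivative_Pair) (auto simp: sol_def)
  qed (use C ic in \<open>auto simp: zero_prod_def\<close>)
  then show "u y = 0" "u1 y = 0" by (auto simp: zero_prod_def)
qed

lemma sol_diff:
  assumes "sol v u u1" "sol v' w w1"
  shows "sol (\<lambda>y. v y - v' y) (\<lambda>y. u y - w y) (\<lambda>y. u1 y - w1 y)"
  using sol_add[OF assms(1) sol_smult[OF assms(2), of "-1"]] by simp

lemma sol_exists:
  assumes "continuous_on UNIV v" obtains u u1 where "sol v u u1"
proof -
  obtain C where C: "\<And>y u u1. norm (u1, acc y u u1) \<le> C * norm (u, u1)" using acc_bound by blast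
  define P where "P = (\<lambda>y (u, u1). (u1, acc y u u1))"
  have "\<exists>x. x 0 = (0, 0) \<and> (\<forall>y. (x has_vector_derivative P y (x y) + (0, rot (v y))) (at y))"
  proof (rule linear_ode_exists)
    show "linear (P y)" for y
      by (rule linearI) (auto simp: P_def acc_def vec_eq_2 algebra_simps)
    show "norm (P y x) \<le> C * norm x" for y x
      using C by (cases x) (simp add: P_def)
    show "continuous_on UNIV (\<lambda>y. P y (x y))" if "continuous_on UNIV x" for x
      unfolding P_def case_prod_unfold using that by (intro continuous_intros continuous_acc)
    show "continuous_on UNIV (\<lambda>y. (0, rot (v y)))" by (intro continuous_intros continuous_rot assms)
  qed
  then obtain x where x: "\<And>y. (x has_vector_derivative P y (x y) + (0, rot (v y))) (at y)" by blast
  have "sol v (\<lambda>y. fst (x y)) (\<lambda>y. snd (x y))" unfolding sol_def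
  proof safe
    fix y
    show "((\<lambda>y. fst (x y)) has_vector_derivative snd (x y)) (at y)"
      using bounded_linear.has_vector_derivative[OF bounded_linear_fst x[of y]]
      by (simp add: P_def case_prod_unfold)
    show "((\<lambda>y. snd (x y)) has_vector_derivative acc y (fst (x y)) (snd (x y)) + rot (v y)) (at y)"
      using bounded_linear.has_vector_derivative[OF bounded_linear_snd x[of y]]
      by (simp add: P_def case_prod_unfold)
  qed
  then show ?thesis using that by blast
qed

lemma sol_periodic_derivative:
  assumes s: "sol v u u1" and u: "\<And>y. u (y + T) = u y"
  shows "u1 (y + T) = u1 y"
proof -
  have "((\<lambda>y. u (y + T)) has_vector_derivative u1 (y + T)) (at y)"
    using sol_shift[OF s] by (simp add: sol_def)
  then have "(u has_vector_derivative u1 (y + T)) (at y)" by (simp add: u)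
  then show ?thesis using s vector_derivative_unique_at unfolding sol_def by blast
qed

text \<open>Regularity: for continuous \<open>v\<close> the weak second derivative agrees almost
  everywhere with a continuous function. So \<open>u1\<close> is an integral of that function and is
  continuously differentiable.\<close>

lemma op_sol:
  assumes uv: "(u, v) \<in> op" and v: "continuous_on UNIV v"
  obtains u1 where "sol v u u1" "\<And>y. u (y + T) = u y" "\<And>y. u1 (y + T) = u1 y"
proof -
  obtain u1 u2 where H: "H2_per T u u1 u2" and ae: "AE y in lborel. v y = Lval y (u y) (u1 y) (u2 y)"
    using uv unfolding op_def by blast
  have per: "\<And>y. u (y + T) = u y" "\<And>y. u1 (y + T) = u1 y"
    and du: "\<And>y. (u has_vector_derivative u1 y) (at y)"
    and u2: "\<And>a b. a \<le> b \<Longrightarrow> (u2 has_integral (u1 b - u1 a)) {a..b}"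
    using H unfolding H2_per_def by auto
  have cu1: "continuous_on {a..b} u1" for a b
  proof (cases "a \<le> b")
    case True
    have "continuous_on {a..b} (\<lambda>x. integral {a..x} u2)"
      using u2[OF True] by (intro indefinite_integral_continuous_1) blast
    then have "continuous_on {a..b} (\<lambda>x. u1 a + integral {a..x} u2)" by (intro continuous_intros)
    moreover have "u1 a + integral {a..x} u2 = u1 x" if "x \<in> {a..b}" for x
      using integral_unique[OF u2[of a x]] that by simp
    ultimately show ?thesis by (metis (no_types, lifting) continuous_on_cong)
  qed simp
  have cu1': "continuous_on UNIV u1"
    unfolding continuous_on_eq_continuous_at[OF open_UNIV]
  proof
    fix y show "isCont u1 y"
      using cu1[of "y - 1" "y + 1"] by (auto simp: continuous_on_interior)
  qed
  define h where "h = (\<lambda>y. acc y (u y) (u1 y) + rot (v y))"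
  have cu: "continuous_on UNIV u"
    using du by (auto intro!: continuous_at_imp_continuous_on has_vector_derivative_continuous)
  have ch: "continuous_on UNIV h"
    unfolding h_def by (intro continuous_intros continuous_acc continuous_rot cu cu1' v)
  have ae': "AE y in lborel. h y = u2 y"
    using ae by eventually_elim (simp add: Lval_iff h_def)
  have hi: "(h has_integral (u1 b - u1 a)) {a..b}" if "a \<le> b" for a b
    by (rule integrable_spike_AE[OF ae' u2[OF that]])
  have "(u1 has_vector_derivative h y) (at y)" for y
  proof -
    have "((\<lambda>x. integral {y - 1..x} h) has_vector_derivative h y) (at y within {y - 1..y + 1})"
      by (rule integral_has_vector_derivative) (auto intro: continuous_on_subset[OF ch])
    then have "((\<lambda>x. u1 (y - 1) + integral {y - 1..x} h) has_vector_derivative h y) (at y within {y - 1..y + 1})"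
      by (auto intro!: derivative_eq_intros)
    moreover have "u1 (y - 1) + integral {y - 1..x} h = u1 x" if "x \<in> {y - 1..y + 1}" for x
      using integral_unique[OF hi[of "y - 1" x]] that by simp
    ultimately have "(u1 has_vector_derivative h y) (at y within {y - 1..y + 1})"
      by (rule_tac has_vector_derivative_transform[where f="\<lambda>x. u1 (y - 1) + integral {y - 1..x} h"]) auto
    then show ?thesis by (simp add: at_within_Icc_at)
  qed
  then have "sol v u u1" unfolding sol_def h_def using du by simp
  then show ?thesis using that per by blast
qed

lemma sol_op:
  assumes s: "sol v u u1" and v: "continuous_on UNIV v" "\<And>y. v (y + T) = v y" and u: "\<And>y. u (y + T) = u y"
  shows "(u, v) \<in> op"
proof -
  define h where "h = (\<lambda>y. acc y (u y) (u1 y) + rot (v y))"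
  have u1: "\<And>y. u1 (y + T) = u1 y" by (rule sol_periodic_derivative[OF s u])
  have ch: "continuous_on UNIV h"
    unfolding h_def by (intro continuous_intros continuous_acc continuous_rot sol_continuous[OF s] v)
  have "h (y + T) = h y" for y by (simp add: h_def u u1 v acc_def per)
  then have L: "L2_per T h" by (rule L2_per_continuous[OF ch])
  have "(h has_integral (u1 b - u1 a)) {a..b}" if "a \<le> b" for a b
    by (rule fundamental_theorem_of_calculus[OF that])
       (use s in \<open>auto simp: sol_def h_def intro: has_vector_derivative_at_within\<close>)
  then have "H2_per T u u1 h" using L u u1 s unfolding H2_per_def sol_def by auto
  moreover have "v y = Lval y (u y) (u1 y) (h y)" for y by (simp add: Lval_iff h_def)
  ultimately show ?thesis unfolding op_def using L2_per_continuous[OF v] by blast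
qed

lemma sol_functional: "sol v u u1 \<Longrightarrow> sol v' u u1' \<Longrightarrow> v y = v' y"
proof -
  assume s: "sol v u u1" and s': "sol v' u u1'"
  have "u1 = u1'" using s s' vector_derivative_unique_at unfolding sol_def by blast
  then have "acc y (u y) (u1 y) + rot (v y) = acc y (u y) (u1 y) + rot (v' y)"
    using s s' vector_derivative_unique_at unfolding sol_def by blast
  then show ?thesis by (auto simp: rot_def vec_eq_2)
qed

text \<open>The boundary form of the symmetric operator \<open>J\<^sup>-\<^sup>1 L\<close>.\<close>

definition conc :: "real \<Rightarrow> complex^2 \<Rightarrow> complex^2 \<Rightarrow> complex^2 \<Rightarrow> complex^2 \<Rightarrow> complex" where
  "conc y w w1 u u1 = u $ 1 * w1 $ 1 - w $ 1 * u1 $ 1 + u $ 2 * w1 $ 2 - w $ 2 * u1 $ 2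
     + 2 * of_real (\<alpha> y) * (w $ 1 * u $ 2 - w $ 2 * u $ 1)"

text \<open>Here \<open>u\<close> is only in the domain of the operator, so its derivative is merely absolutely
  continuous.\<close>

lemma green_op:
  assumes uz: "(u, z) \<in> op" and w: "sol v w w1"
  obtains u1 where "\<And>y. (u has_vector_derivative u1 y) (at y)" "\<And>y. u (y + T) = u y" "\<And>y. u1 (y + T) = u1 y"
    "((\<lambda>y. symp (u y) (v y) - symp (w y) (z y)) has_integral
      conc T (w T) (w1 T) (u T) (u1 T) - conc 0 (w 0) (w1 0) (u 0) (u1 0)) {0..T}"
proof -
  obtain u1 u2 where H: "H2_per T u u1 u2" and ae: "AE y in lborel. z y = Lval y (u y) (u1 y) (u2 y)"
    using uz unfolding op_def by blast
  have per: "\<And>y. u (y + T) = u y" "\<And>y. u1 (y + T) = u1 y" and L2: "L2_per T u2"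
    and du: "\<And>y. (u has_vector_derivative u1 y) (at y)"
    and u2: "\<And>a b. a \<le> b \<Longrightarrow> (u2 has_integral (u1 b - u1 a)) {a..b}"
    using H unfolding H2_per_def by auto
  have cu1: "continuous_on {0..T} u1"
  proof -
    have "continuous_on {0..T} (\<lambda>x. integral {0..x} u2)"
      using u2[of 0 T] T_pos by (intro indefinite_integral_continuous_1) auto
    then have "continuous_on {0..T} (\<lambda>x. u1 0 + integral {0..x} u2)" by (intro continuous_intros)
    moreover have "u1 0 + integral {0..x} u2 = u1 x" if "x \<in> {0..T}" for x
      using integral_unique[OF u2[of 0 x]] that by simp
    ultimately show ?thesis by (metis (no_types, lifting) continuous_on_cong)
  qed
  have dw: "\<And>y. (w has_vector_derivative w1 y) (at y)"
    "\<And>y. (w1 has_vector_derivative acc y (w y) (w1 y) + rot (v y)) (at y)" using w by (auto simp: sol_def)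
  have cw1: "continuous_on X w1" for X by (rule sol_continuous[OF w])
  have comp: "((\<lambda>y. w y $ i * u2 y $ i + w1 y $ i * u1 y $ i) has_integral
      (w T $ i * u1 T $ i - w 0 $ i * u1 0 $ i)) {0..T}" for i
  proof (rule weak_integration_by_parts)
    show "((\<lambda>y. w y $ i) has_vector_derivative w1 y $ i) (at y)" for y
      by (rule bounded_linear.has_vector_derivative[OF bounded_linear_vec_nth dw(1)])
    show "((\<lambda>y. u2 y $ i) has_integral (u1 y $ i - u1 x $ i)) {x..y}" if "x \<le> y" for x y
      using has_integral_linear[OF u2[OF that] bounded_linear_vec_nth] by (simp add: comp_def)
    show "(\<lambda>y. u2 y $ i) absolutely_integrable_on {0..T}" by (rule L2_per_absolutely_integrable[OF L2])
  qed (use T_pos in \<open>auto intro!: continuous_intros cw1 cu1\<close>)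
  define A2 where "A2 y = 2 * complex_of_real (\<alpha> y)" for y
  define W2 where "W2 y = acc y (w y) (w1 y) + rot (v y)" for y
  \<comment> \<open>The boundary form is \<open>e\<close> minus the products
    \<open>w $ i * u1 $ i\<close>. The part \<open>e\<close> contains no derivative of
    \<open>u1\<close> and is treated by the classical fundamental theorem; the products are covered
    by the weak integration by parts in \<open>comp\<close>.\<close>
  define e where "e = (\<lambda>y. u y $ 1 * w1 y $ 1 + u y $ 2 * w1 y $ 2
     + A2 y * (w y $ 1 * u y $ 2 - w y $ 2 * u y $ 1))"
  define e' where "e' = (\<lambda>y. (u y $ 1 * W2 y $ 1 + u1 y $ 1 * w1 y $ 1) + (u y $ 2 * W2 y $ 2 + u1 y $ 2 * w1 y $ 2)
     + (A2 y * ((w y $ 1 * u1 y $ 2 + w1 y $ 1 * u y $ 2) - (w y $ 2 * u1 y $ 1 + w1 y $ 2 * u y $ 1))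
       + 2 * of_real (\<beta> y) * (w y $ 1 * u y $ 2 - w y $ 2 * u y $ 1)))"
  have "(e' has_integral (e T - e 0)) {0..T}"
  proof (rule fundamental_theorem_of_calculus)
    fix y
    have c: "((\<lambda>y. g y $ i) has_vector_derivative d $ i) (at y)"
      if "(g has_vector_derivative d) (at y)" for g :: "real \<Rightarrow> complex^2" and d i
      by (rule bounded_linear.has_vector_derivative[OF bounded_linear_vec_nth that])
    have a: "(A2 has_vector_derivative 2 * of_real (\<beta> y)) (at y)" unfolding A2_def
      using d\<alpha>[of y] by (intro has_vector_derivative_mult_right has_vector_derivative_of_real)
        (simp add: has_real_derivative_iff_has_vector_derivative)
    note D = c[OF du] c[OF dw(1)] c[OF dw(2)[folded W2_def]] a
    have "(e has_vector_derivative e' y) (at y)"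
      unfolding e_def e'_def
      by (intro has_vector_derivative_add has_vector_derivative_mult has_vector_derivative_diff D)
    then show "(e has_vector_derivative e' y) (at y within {0..T})" by (rule has_vector_derivative_at_within)
  qed (use T_pos in auto)
  from has_integral_diff[OF has_integral_diff[OF this comp[of 1]] comp[of 2]]
  have "((\<lambda>y. e' y - (w y $ 1 * u2 y $ 1 + w1 y $ 1 * u1 y $ 1) - (w y $ 2 * u2 y $ 2 + w1 y $ 2 * u1 y $ 2))
     has_integral conc T (w T) (w1 T) (u T) (u1 T) - conc 0 (w 0) (w1 0) (u 0) (u1 0)) {0..T}"
    by (rule back_subst[of "\<lambda>I. (_ has_integral I) _"]) (simp add: e_def conc_def A2_def algebra_simps)
  moreover have "AE y in lborel. symp (u y) (v y) - symp (w y) (z y) =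
      e' y - (w y $ 1 * u2 y $ 1 + w1 y $ 1 * u1 y $ 1) - (w y $ 2 * u2 y $ 2 + w1 y $ 2 * u1 y $ 2)"
    using ae
  proof eventually_elim
    case (elim y)
    show ?case unfolding elim e'_def symp_def Lval_def A2_def W2_def acc_def rot_def
      by (simp add: algebra_simps)
  qed
  ultimately have "((\<lambda>y. symp (u y) (v y) - symp (w y) (z y)) has_integral
      conc T (w T) (w1 T) (u T) (u1 T) - conc 0 (w 0) (w1 0) (u 0) (u1 0)) {0..T}"
    by (rule_tac integrable_spike_AE)
  then show ?thesis using that du per by blast
qed

text \<open>The classical counterpart, in which neither function has to be periodic. The boundary
  terms then carry the defects of both functions.\<close>

lemma green_sol:
  assumes u: "sol z u u1" and w: "sol v w w1"
  shows "((\<lambda>y. symp (u y) (v y) - symp (w y) (z y)) has_integral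
      conc T (w T) (w1 T) (u T) (u1 T) - conc 0 (w 0) (w1 0) (u 0) (u1 0)) {0..T}"
proof (rule fundamental_theorem_of_calculus)
  fix y
  have du: "(u has_vector_derivative u1 y) (at y)" "(u1 has_vector_derivative acc y (u y) (u1 y) + rot (z y)) (at y)"
    and dw: "(w has_vector_derivative w1 y) (at y)" "(w1 has_vector_derivative acc y (w y) (w1 y) + rot (v y)) (at y)"
    using u w by (auto simp: sol_def)
  have c: "((\<lambda>y. g y $ i) has_vector_derivative d $ i) (at y)"
    if "(g has_vector_derivative d) (at y)" for g :: "real \<Rightarrow> complex^2" and d i
    by (rule bounded_linear.has_vector_derivative[OF bounded_linear_vec_nth that])
  define A2 where "A2 y = 2 * complex_of_real (\<alpha> y)" for y
  have a: "(A2 has_vector_derivative 2 * of_real (\<beta> y)) (at y)" unfolding A2_def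
    using d\<alpha>[of y] by (intro has_vector_derivative_mult_right has_vector_derivative_of_real)
      (simp add: has_real_derivative_iff_has_vector_derivative)
  note D = c[OF du(1)] c[OF du(2)] c[OF dw(1)] c[OF dw(2)] a
  let ?U = "acc y (u y) (u1 y) + rot (z y)" and ?W = "acc y (w y) (w1 y) + rot (v y)"
  have "((\<lambda>y. conc y (w y) (w1 y) (u y) (u1 y)) has_vector_derivative
      (u y $ 1 * ?W $ 1 + u1 y $ 1 * w1 y $ 1) - (w y $ 1 * ?U $ 1 + w1 y $ 1 * u1 y $ 1)
      + (u y $ 2 * ?W $ 2 + u1 y $ 2 * w1 y $ 2) - (w y $ 2 * ?U $ 2 + w1 y $ 2 * u1 y $ 2)
      + (A2 y * ((w y $ 1 * u1 y $ 2 + w1 y $ 1 * u y $ 2) - (w y $ 2 * u1 y $ 1 + w1 y $ 2 * u y $ 1))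
       + 2 * of_real (\<beta> y) * (w y $ 1 * u y $ 2 - w y $ 2 * u y $ 1))) (at y)"
    unfolding conc_def A2_def[symmetric]
    by (intro has_vector_derivative_add has_vector_derivative_mult has_vector_derivative_diff D)
  moreover have "(u y $ 1 * ?W $ 1 + u1 y $ 1 * w1 y $ 1) - (w y $ 1 * ?U $ 1 + w1 y $ 1 * u1 y $ 1)
      + (u y $ 2 * ?W $ 2 + u1 y $ 2 * w1 y $ 2) - (w y $ 2 * ?U $ 2 + w1 y $ 2 * u1 y $ 2)
      + (A2 y * ((w y $ 1 * u1 y $ 2 + w1 y $ 1 * u y $ 2) - (w y $ 2 * u1 y $ 1 + w1 y $ 2 * u y $ 1))
       + 2 * of_real (\<beta> y) * (w y $ 1 * u y $ 2 - w y $ 2 * u y $ 1)) = symp (u y) (v y) - symp (w y) (z y)"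
    by (simp add: A2_def acc_def rot_def symp_def algebra_simps)
  ultimately have "((\<lambda>y. conc y (w y) (w1 y) (u y) (u1 y)) has_vector_derivative
      symp (u y) (v y) - symp (w y) (z y)) (at y)" by simp
  then show "((\<lambda>y. conc y (w y) (w1 y) (u y) (u1 y)) has_vector_derivative
      symp (u y) (v y) - symp (w y) (z y)) (at y within {0..T})"
    by (rule has_vector_derivative_at_within)
qed (use T_pos in auto)

text \<open>With \<open>L = J H\<close> for symmetric \<open>H\<close>, transposing gives
  \<open>w^t J L = - (H w)^t\<close>, and \<open>H w = - J v\<close>, so the result is
  \<open>- v^t J\<close>. The boundary terms cancel by periodicity.\<close>

lemma left_mult_op:
  assumes w: "sol v w w1" and wp: "\<And>y. w (y + T) = w y"
    and v: "continuous_on UNIV v" "\<And>y. v (y + T) = v y"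
  shows "left_mult T (\<lambda>y. w y v* Jmat) op (\<lambda>y. - (v y v* Jmat))"
proof -
  have J: "(x v* Jmat) = vector [x $ 2, - x $ 1]" for x
    by (simp add: vec_eq_2 vector_matrix_mult_def Jmat_def sum_2)
  have w1p: "\<And>y. w1 (y + T) = w1 y" by (rule sol_periodic_derivative[OF w wp])
  have cw: "continuous_on UNIV w" by (rule sol_continuous[OF w])
  have "row_pairing T (\<lambda>y. w y v* Jmat) z = row_pairing T (\<lambda>y. - (v y v* Jmat)) u" if uz: "(u, z) \<in> op" for u z
  proof -
    obtain u1 where u1: "\<And>y. (u has_vector_derivative u1 y) (at y)" "\<And>y. u (y + T) = u y" "\<And>y. u1 (y + T) = u1 y"
      and I: "((\<lambda>y. symp (u y) (v y) - symp (w y) (z y)) has_integral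
      conc T (w T) (w1 T) (u T) (u1 T) - conc 0 (w 0) (w1 0) (u 0) (u1 0)) {0..T}"
      by (rule green_op[OF uz w]) blast
    have "conc T (w T) (w1 T) (u T) (u1 T) = conc 0 (w 0) (w1 0) (u 0) (u1 0)"
      using wp[of 0] w1p[of 0] u1(2,3)[of 0] per(1)[of 0] by (simp add: conc_def)
    with I have I: "((\<lambda>y. symp (u y) (v y) - symp (w y) (z y)) has_integral 0) {0..T}" by simp
    have cu: "continuous_on UNIV u"
      using u1(1) by (auto intro!: continuous_at_imp_continuous_on has_vector_derivative_continuous)
    have "(\<lambda>y. symp (u y) (v y)) integrable_on {0..T}" unfolding symp_def
      by (intro integrable_continuous_real continuous_intros continuous_on_subset[OF cu] continuous_on_subset[OF v(1)]) auto
    from has_integral_diff[OF integrable_integral[OF this] I]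
    have "((\<lambda>y. symp (w y) (z y)) has_integral integral {0..T} (\<lambda>y. symp (u y) (v y))) {0..T}" by simp
    then have "integral {0..T} (\<lambda>y. symp (w y) (z y)) = integral {0..T} (\<lambda>y. symp (u y) (v y))"
      by (rule integral_unique)
    moreover have "(\<Sum>i\<in>UNIV. (w y v* Jmat) $ i * z y $ i) = symp (w y) (z y)"
      "(\<Sum>i\<in>UNIV. (- (v y v* Jmat)) $ i * u y $ i) = symp (u y) (v y)" for y
      by (simp_all add: J sum_2 symp_def)
    ultimately show ?thesis unfolding row_pairing_def by simp
  qed
  moreover have "L2_per T (\<lambda>y. w y v* Jmat)" "L2_per T (\<lambda>y. - (v y v* Jmat))"
    unfolding J by (rule L2_per_continuous; use wp v cw in \<open>auto intro!: continuous_intros\<close>)+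
  ultimately show ?thesis unfolding left_mult_def by auto
qed

end

subsection \<open>Dimension counts\<close>

text \<open>The hypothesis \<open>indep\<close> says that the functions \<open>h i\<close> are
  independent modulo the span of \<open>W\<close>. It also forces \<open>h\<close> to be injective
  on \<open>I\<close> with values outside \<open>W\<close>, which is why cardinalities add.\<close>

lemma cfun_extension:
  fixes h :: "'i \<Rightarrow> real \<Rightarrow> complex^2" and W :: "(real \<Rightarrow> complex^2) set"
  assumes I: "finite I" and W: "finite W" "cfun.independent W"
    and indep: "\<And>w \<gamma>. w \<in> cfun.span W \<Longrightarrow> w + (\<Sum>i\<in>I. (\<lambda>y. \<gamma> i *s h i y)) = 0 \<Longrightarrow> \<forall>i\<in>I. \<gamma> i = 0"
  shows "cfun.independent (W \<union> h ` I)" "card (W \<union> h ` I) = card W + card I"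
    "cfun.span (W \<union> h ` I) = {w + (\<Sum>i\<in>I. (\<lambda>y. \<gamma> i *s h i y)) | w \<gamma>. w \<in> cfun.span W}"
proof -
  have span: "cfun.span (W \<union> h ` J) = {w + (\<Sum>i\<in>J. (\<lambda>y. \<gamma> i *s h i y)) | w \<gamma>. w \<in> cfun.span W}"
    if "finite J" for J
    using that
  proof (induction J)
    case (insert j J)
    have "cfun.span (W \<union> h ` insert j J) = {x. \<exists>k. x - (\<lambda>y. k *s h j y) \<in> cfun.span (W \<union> h ` J)}"
      by (simp add: cfun.span_insert)
    also have "\<dots> = {w + (\<Sum>i\<in>insert j J. (\<lambda>y. \<gamma> i *s h i y)) | w \<gamma>. w \<in> cfun.span W}"
    proof safe
      fix x k assume "x - (\<lambda>y. k *s h j y) \<in> cfun.span (W \<union> h ` J)"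
      then obtain w \<gamma> where w: "w \<in> cfun.span W" "x - (\<lambda>y. k *s h j y) = w + (\<Sum>i\<in>J. (\<lambda>y. \<gamma> i *s h i y))"
        unfolding insert.IH by blast
      have "(\<Sum>i\<in>J. (\<lambda>y. (\<gamma>(j := k)) i *s h i y)) = (\<Sum>i\<in>J. (\<lambda>y. \<gamma> i *s h i y))"
        by (rule sum.cong) (use insert.hyps in auto)
      then have "x = w + (\<Sum>i\<in>insert j J. (\<lambda>y. (\<gamma>(j := k)) i *s h i y))"
        using w(2) insert.hyps by (simp add: algebra_simps)
      then show "\<exists>w \<gamma>. x = w + (\<Sum>i\<in>insert j J. (\<lambda>y. \<gamma> i *s h i y)) \<and> w \<in> cfun.span W"
        using w(1) by blast
    next
      fix w \<gamma> assume w: "w \<in> cfun.span W"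
      have "w + (\<Sum>i\<in>insert j J. (\<lambda>y. \<gamma> i *s h i y)) - (\<lambda>y. \<gamma> j *s h j y) = w + (\<Sum>i\<in>J. (\<lambda>y. \<gamma> i *s h i y))"
        using insert.hyps by (simp add: algebra_simps)
      then show "\<exists>k. w + (\<Sum>i\<in>insert j J. (\<lambda>y. \<gamma> i *s h i y)) - (\<lambda>y. k *s h j y) \<in> cfun.span (W \<union> h ` J)"
        unfolding insert.IH using w by blast
    qed
    finally show ?case .
  qed simp
  show "cfun.span (W \<union> h ` I) = {w + (\<Sum>i\<in>I. (\<lambda>y. \<gamma> i *s h i y)) | w \<gamma>. w \<in> cfun.span W}"
    by (rule span[OF I])
  have "cfun.independent (W \<union> h ` J) \<and> card (W \<union> h ` J) = card W + card J" if "J \<subseteq> I" for J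
    using finite_subset[OF that I] that
  proof (induction J)
    case (insert j J)
    have nin: "h j \<notin> cfun.span (W \<union> h ` J)"
    proof
      assume "h j \<in> cfun.span (W \<union> h ` J)"
      then obtain w \<gamma> where w: "w \<in> cfun.span W" "h j = w + (\<Sum>i\<in>J. (\<lambda>y. \<gamma> i *s h i y))"
        unfolding span[OF insert.hyps(1)] by blast
      \<comment> \<open>If \<open>h j\<close> were in the span, moving it to the other side would
        give a relation with coefficient -1 at \<open>j\<close>.\<close>
      define \<delta> where "\<delta> i = (if i = j then -1 else if i \<in> J then \<gamma> i else 0)" for i
      have "(\<Sum>i\<in>I. (\<lambda>y. \<delta> i *s h i y)) = (\<Sum>i\<in>insert j J. (\<lambda>y. \<delta> i *s h i y))"
        by (rule sum.mono_neutral_right) (use I insert.prems in \<open>auto simp: \<delta>_def zero_fun_def\<close>)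
      also have "\<dots> = (\<lambda>y. \<delta> j *s h j y) + (\<Sum>i\<in>J. (\<lambda>y. \<delta> i *s h i y))"
        using insert.hyps by simp
      also have "(\<Sum>i\<in>J. (\<lambda>y. \<delta> i *s h i y)) = (\<Sum>i\<in>J. (\<lambda>y. \<gamma> i *s h i y))"
        by (rule sum.cong) (use insert.hyps in \<open>auto simp: \<delta>_def\<close>)
      also have "(\<lambda>y. \<delta> j *s h j y) = - h j" by (simp add: \<delta>_def fun_eq_iff)
      finally have "(\<Sum>i\<in>I. (\<lambda>y. \<delta> i *s h i y)) = - h j + (\<Sum>i\<in>J. (\<lambda>y. \<gamma> i *s h i y))" .
      moreover have "x + (- (x + z) + z) = 0" for x z :: "real \<Rightarrow> complex^2" by (simp add: fun_eq_iff)
      ultimately have "w + (\<Sum>i\<in>I. (\<lambda>y. \<delta> i *s h i y)) = 0" using w(2) by metis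
      from indep[OF w(1) this] have "\<delta> j = 0" using insert.prems by auto
      then show False by (simp add: \<delta>_def)
    qed
    have "h j \<notin> W \<union> h ` J"
    proof
      assume "h j \<in> W \<union> h ` J"
      then have "h j \<in> cfun.span (W \<union> h ` J)" by (rule cfun.span_base)
      with nin show False by contradiction
    qed
    have IH: "cfun.independent (W \<union> h ` J)" "card (W \<union> h ` J) = card W + card J"
      using insert.IH insert.prems by auto
    have "cfun.independent (insert (h j) (W \<union> h ` J))" by (rule cfun.independent_insertI[OF nin IH(1)])
    moreover have "card (insert (h j) (W \<union> h ` J)) = Suc (card (W \<union> h ` J))"
      by (rule card_insert_disjoint) (use W(1) insert.hyps(1) \<open>h j \<notin> W \<union> h ` J\<close> in auto)
    moreover have "W \<union> h ` insert j J = insert (h j) (W \<union> h ` J)" by auto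
    ultimately show ?case unfolding IH(2) using insert.hyps by (simp only: card_insert_disjoint) simp
  qed (use W in simp)
  from this[of I] show "cfun.independent (W \<union> h ` I)" "card (W \<union> h ` I) = card W + card I" by auto
qed

abbreviation comb :: "(real^'n) set \<Rightarrow> (real^'n \<Rightarrow> complex) \<Rightarrow> 'n \<Rightarrow> complex" where
  "comb Bs \<gamma> \<equiv> \<lambda>j. \<Sum>b\<in>Bs. \<gamma> b * of_real (b $ j)"

text \<open>\<open>B\<close> is real, so the real and imaginary parts of a complex kernel vector are
  kernel vectors; a real basis of the kernel therefore also spans over the complex numbers. This
  links complex dimensions of kernels of the operator to real dimensions of kernels of
  matrices.\<close>

lemma complex_kernel:
  fixes B :: "real^'n^'n"
  assumes Bs: "independent Bs" "ker_mat B \<subseteq> span Bs" and fin: "finite Bs"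
    and c: "\<And>i. (\<Sum>j\<in>UNIV. of_real (B $ i $ j) * c j) = (0::complex)"
  obtains \<gamma> where "\<And>j. c j = (comb Bs \<gamma> j)"
proof -
  define x where "x = (\<chi> j. Re (c j))"
  define x' where "x' = (\<chi> j. Im (c j))"
  have "x \<in> ker_mat B" "x' \<in> ker_mat B"
    using arg_cong[OF c, of Re] arg_cong[OF c, of Im]
    by (auto simp: ker_mat_def x_def x'_def vec_eq_iff matrix_vector_mult_def)
  then have "x \<in> span Bs" "x' \<in> span Bs" using Bs by auto
  then obtain r r' where r: "x = (\<Sum>b\<in>Bs. r b *\<^sub>R b)" "x' = (\<Sum>b\<in>Bs. r' b *\<^sub>R b)"
    unfolding span_finite[OF fin] by auto
  show ?thesis
  proof (rule that[of "\<lambda>b. Complex (r b) (r' b)"])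
    fix j
    have "Re (c j) = (\<Sum>b\<in>Bs. r b * b $ j)" "Im (c j) = (\<Sum>b\<in>Bs. r' b * b $ j)"
      using arg_cong[OF r(1), of "\<lambda>x. x $ j"] arg_cong[OF r(2), of "\<lambda>x. x $ j"]
      by (auto simp: x_def x'_def)
    then show "c j = (\<Sum>b\<in>Bs. Complex (r b) (r' b) * of_real (b $ j))"
      by (simp add: complex_eq_iff)
  qed
qed

lemma complex_independent:
  fixes Bs :: "(real^'n) set"
  assumes Bs: "independent Bs" and fin: "finite Bs"
    and z: "\<And>j. (comb Bs \<gamma> j) = (0::complex)" and b: "b \<in> Bs"
  shows "\<gamma> b = 0"
proof -
  have "(\<Sum>b\<in>Bs. Re (\<gamma> b) *\<^sub>R b) = 0" "(\<Sum>b\<in>Bs. Im (\<gamma> b) *\<^sub>R b) = 0"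
    using arg_cong[OF z, of Re] arg_cong[OF z, of Im] by (auto simp: vec_eq_iff)
  then have "Re (\<gamma> b) = 0" "Im (\<gamma> b) = 0"
    using independentD[OF Bs fin subset_refl, of "\<lambda>b. Re (\<gamma> b)" b]
      independentD[OF Bs fin subset_refl, of "\<lambda>b. Im (\<gamma> b)" b] b by blast+
  then show ?thesis by (simp add: complex_eq_iff)
qed

subsection \<open>Jordan chains of a periodic operator\<close>

context periodic_operator
begin

text \<open>The classical form of the graph of the operator. Every right-hand side occurring in a
  kernel of a power is 0 or in the domain, hence continuous and periodic, so there
  \<open>csol\<close> and \<open>op\<close> agree.\<close>

definition csol :: "(real \<Rightarrow> complex^2) \<Rightarrow> (real \<Rightarrow> complex^2) \<Rightarrow> bool" where
  "csol u v \<longleftrightarrow> continuous_on UNIV v \<and> (\<forall>y. v (y + T) = v y) \<and> (\<forall>y. u (y + T) = u y) \<and> (\<exists>u1. sol v u u1)"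

lemma csol_op: "csol u v \<Longrightarrow> (u, v) \<in> op"
  unfolding csol_def using sol_op by blast

lemma op_domain:
  assumes "(u, v) \<in> op" shows "continuous_on UNIV u" "u (y + T) = u y"
proof -
  obtain u' u'' where H: "H2_per T u u' u''" using assms unfolding op_def by blast
  then show "u (y + T) = u y" by (simp add: H2_per_def)
  show "continuous_on UNIV u"
    using H by (auto simp: H2_per_def intro!: continuous_at_imp_continuous_on has_vector_derivative_continuous)
qed

lemma op_csol: "(u, v) \<in> op \<Longrightarrow> continuous_on UNIV v \<Longrightarrow> (\<And>y. v (y + T) = v y) \<Longrightarrow> csol u v"
  unfolding csol_def using op_sol by blast

lemma csol_add: "csol u v \<Longrightarrow> csol u' v' \<Longrightarrow> csol (u + u') (v + v')"
  unfolding csol_def plus_fun_def using sol_add by (auto intro!: continuous_intros) blast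

lemma csol_smult: "csol u v \<Longrightarrow> csol (\<lambda>y. c *s u y) (\<lambda>y. c *s v y)"
proof -
  have bl: "bounded_linear (\<lambda>x :: complex^2. c *s x)"
    by (rule linear_conv_bounded_linear[THEN iffD1], rule linearI) (auto simp: vec_eq_2 algebra_simps)
  show "csol u v \<Longrightarrow> csol (\<lambda>y. c *s u y) (\<lambda>y. c *s v y)"
    unfolding csol_def
    by (elim conjE exE, intro conjI exI[of _ "\<lambda>y. c *s _ y"] bounded_linear.continuous_on[OF bl])
       (auto intro: sol_smult)
qed

lemma sol_zero: "sol (\<lambda>y. 0) (\<lambda>y. 0) (\<lambda>y. 0)"
proof -
  have "acc y 0 0 + rot 0 = 0" for y by (simp add: acc_def rot_def vec_eq_2)
  then show ?thesis by (simp add: sol_def)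
qed

lemma csol_0: "csol 0 0"
  unfolding csol_def zero_fun_def using sol_zero by auto

lemma csol_sum: "(\<And>i. i \<in> I \<Longrightarrow> csol (u i) (v i)) \<Longrightarrow> csol (\<Sum>i\<in>I. u i) (\<Sum>i\<in>I. v i)"
  by (induction I rule: infinite_finite_induct) (auto intro: csol_0 csol_add)

lemma csol_diff: "csol u v \<Longrightarrow> csol u' v' \<Longrightarrow> csol (u - u') (v - v')"
proof -
  assume a: "csol u v" "csol u' v'"
  have "csol (u + (\<lambda>y. -1 *s u' y)) (v + (\<lambda>y. -1 *s v' y))" by (intro csol_add csol_smult a)
  moreover have "x + (\<lambda>y. -1 *s x' y) = x - x'" for x x' :: "real \<Rightarrow> complex^2" by (simp add: fun_eq_iff)
  ultimately show ?thesis by simp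
qed

lemma csol_functional: "csol u v \<Longrightarrow> csol u v' \<Longrightarrow> v = v'"
  unfolding csol_def using sol_functional by blast

lemma ker_pow_1: "ker_pow op 1 = {u. csol u 0}"
  unfolding ker_pow_def by (auto intro: csol_op op_csol simp: zero_fun_def)

text \<open>The first application of the operator is split off. The intermediate function
  \<open>w\<close> is in the domain because at least one more application follows, so it is
  continuous.\<close>

lemma ker_pow_Suc: "ker_pow op (Suc (Suc k)) = {u. \<exists>w \<in> ker_pow op (Suc k). csol u w}"
proof -
  have dom: "\<exists>v. (w, v) \<in> op" if "(w, 0) \<in> op ^^ Suc k" for w using relpow_Suc_D2[OF that] by blast
  have "(u, 0) \<in> op ^^ Suc (Suc k) \<longleftrightarrow> (\<exists>w. (u, w) \<in> op \<and> (w, 0) \<in> op ^^ Suc k)" for u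
    using relpow_Suc_D2[of u 0 "Suc k" op] relpow_Suc_I2[of u _ op 0 "Suc k"] by blast
  then have iff: "u \<in> ker_pow op (Suc (Suc k)) \<longleftrightarrow> (\<exists>w. (u, w) \<in> op \<and> w \<in> ker_pow op (Suc k))" for u
    unfolding ker_pow_def mem_Collect_eq .
  have "(u, w) \<in> op \<longleftrightarrow> csol u w" if "w \<in> ker_pow op (Suc k)" for u w
  proof -
    have "(w, 0) \<in> op ^^ Suc k" using that unfolding ker_pow_def mem_Collect_eq .
    then obtain v where "(w, v) \<in> op" using dom by blast
    then show ?thesis using op_domain op_csol csol_op by blast
  qed
  then show ?thesis using iff by blast
qed

lemma ker_pow_mono: "ker_pow op (Suc k) \<subseteq> ker_pow op (Suc (Suc k))"
proof (induction k)
  case 0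
  have "0 \<in> ker_pow op 1" using csol_0 ker_pow_1 by auto
  then show ?case using ker_pow_1 unfolding ker_pow_Suc by auto
next
  case (Suc k)
  moreover have "ker_pow op (Suc (Suc k)) = {u. \<exists>w \<in> ker_pow op (Suc k). csol u w}"
    "ker_pow op (Suc (Suc (Suc k))) = {u. \<exists>w \<in> ker_pow op (Suc (Suc k)). csol u w}"
    by (rule ker_pow_Suc)+
  ultimately show ?case by blast
qed

end

text \<open>In the application \<open>p0\<close>, \<open>p2\<close> are the symmetry modes, \<open>pE\<close>, \<open>pk\<close>, \<open>pw\<close> the derivatives of the wave
  in \<open>E\<close>, \<open>\<kappa>\<close>, \<open>\<omega>\<close>, and \<open>ps = (0, y A / 2)\<close>; primes denote \<open>y\<close>-derivatives. The numbers \<open>T\<^sub>a\<close>, \<open>\<eta>\<^sub>a\<close>, \<open>M\<^sub>a\<close> are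
  written \<open>Ta\<close>, \<open>ha\<close>, \<open>Ma\<close>, and \<open>q\<close> is \<open>a\<^sub>-\<^sup>2\<close>.\<close>

locale jordan = periodic_operator +
  fixes p0 p0' p2 p2' pE pE' pk pk' pw pw' ps ps' :: "real \<Rightarrow> complex^2"
    and TE Tk Tw hE hk hw ME Mk Mw M q \<kappa> \<sigma> :: real
  assumes s0: "sol (\<lambda>y. 0) p0 p0'" and s2: "sol (\<lambda>y. 0) p2 p2'" and sE: "sol (\<lambda>y. 0) pE pE'"
    and sk: "sol (\<lambda>y. 0) pk pk'" and sw: "sol p0 pw pw'" and ss: "sol p2 ps ps'"
    and per0: "\<And>y. p0 (y + T) = p0 y" and per2: "\<And>y. p2 (y + T) = p2 y"
    and shE: "\<And>y. pE (y + T) = pE y - of_real TE *s p2 y + of_real hE *s p0 y"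
    and shk: "\<And>y. pk (y + T) = pk y - of_real Tk *s p2 y + of_real hk *s p0 y"
    and shw: "\<And>y. pw (y + T) = pw y - of_real Tw *s p2 y + of_real hw *s p0 y"
    and shs: "\<And>y. ps (y + T) = ps y + of_real (T / 2) *s p0 y"
    and ic_span: "\<And>x x'. \<exists>c0 c2 cE ck. x = c0 *s p0 0 + c2 *s p2 0 + cE *s pE 0 + ck *s pk 0 \<and>
        x' = c0 *s p0' 0 + c2 *s p2' 0 + cE *s pE' 0 + ck *s pk' 0"
    and c02: "conc 0 (p0 0) (p0' 0) (p2 0) (p2' 0) = 0"
    and c0E: "conc 0 (p0 0) (p0' 0) (pE 0) (pE' 0) = 0"
    and c0k: "conc 0 (p0 0) (p0' 0) (pk 0) (pk' 0) = -1"
    and c2E: "conc 0 (p2 0) (p2' 0) (pE 0) (pE' 0) = -1"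
    and c2k: "conc 0 (p2 0) (p2' 0) (pk 0) (pk' 0) = 0"
    and I02: "((\<lambda>y. symp (p0 y) (p2 y)) has_integral 0) {0..T}"
    and I0E: "((\<lambda>y. symp (p0 y) (pE y)) has_integral of_real ((ME - TE * q) / 2)) {0..T}"
    and I0k: "((\<lambda>y. symp (p0 y) (pk y)) has_integral of_real ((Mk - Tk * q) / 2)) {0..T}"
    and I0w: "((\<lambda>y. symp (p0 y) (pw y)) has_integral of_real ((Mw - Tw * q) / 2)) {0..T}"
    and I0s: "((\<lambda>y. symp (p0 y) (ps y)) has_integral 0) {0..T}"
    and I2E: "((\<lambda>y. symp (p2 y) (pE y)) has_integral of_real ((\<kappa> * TE - q * hE) / 2)) {0..T}"
    and I2k: "((\<lambda>y. symp (p2 y) (pk y)) has_integral of_real ((T + \<kappa> * Tk - q * hk) / 2)) {0..T}"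
    and I2w: "((\<lambda>y. symp (p2 y) (pw y)) has_integral of_real ((\<kappa> * Tw - q * hw) / 2)) {0..T}"
    and I2s: "((\<lambda>y. symp (p2 y) (ps y)) has_integral of_real ((M - T * q) / 4)) {0..T}"
    and \<sigma>: "\<sigma> = TE * hk - Tk * hE"
begin

section \<open>Combinations of the six basic functions\<close>

definition cmb :: "complex \<Rightarrow> complex \<Rightarrow> complex \<Rightarrow> complex \<Rightarrow> complex \<Rightarrow> complex \<Rightarrow> real \<Rightarrow> complex^2" where
  "cmb c0 c2 cE ck cw cs y = c0 *s p0 y + c2 *s p2 y + cE *s pE y + ck *s pk y + cw *s pw y + cs *s ps y"

definition cmb' :: "complex \<Rightarrow> complex \<Rightarrow> complex \<Rightarrow> complex \<Rightarrow> complex \<Rightarrow> complex \<Rightarrow> real \<Rightarrow> complex^2" where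
  "cmb' c0 c2 cE ck cw cs y = c0 *s p0' y + c2 *s p2' y + cE *s pE' y + ck *s pk' y + cw *s pw' y + cs *s ps' y"

text \<open>For a combination of the basic functions, \<open>rh\<close> and \<open>- rT\<close> are
  the components of its defect along \<open>p0\<close> and \<open>p2\<close>. Once these vanish,
  \<open>rM / 2\<close> and \<open>rD / 2\<close> are its pairings with \<open>p0\<close> and
  \<open>p2\<close>.\<close>

abbreviation "rh cE ck cw cs \<equiv> cE * complex_of_real hE + ck * complex_of_real hk + cw * complex_of_real hw
  + cs * complex_of_real (T / 2)"
abbreviation "rT cE ck cw \<equiv> cE * complex_of_real TE + ck * complex_of_real Tk + cw * complex_of_real Tw"
abbreviation "rM cE ck cw \<equiv> cE * complex_of_real ME + ck * complex_of_real Mk + cw * complex_of_real Mw"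
abbreviation "rD ck cs \<equiv> ck * complex_of_real T + cs * complex_of_real (M / 2)"

lemma cmb_add: "cmb c0 c2 cE ck cw cs y + cmb d0 d2 dE dk dw ds y =
    cmb (c0 + d0) (c2 + d2) (cE + dE) (ck + dk) (cw + dw) (cs + ds) y"
  by (simp add: cmb_def vec_eq_2 algebra_simps)

lemma cmb_smult: "c *s cmb c0 c2 cE ck cw cs y = cmb (c * c0) (c * c2) (c * cE) (c * ck) (c * cw) (c * cs) y"
  by (simp add: cmb_def vec_eq_2 algebra_simps)

lemma cmb_zero: "cmb 0 0 0 0 0 0 = 0" by (simp add: cmb_def fun_eq_iff)

text \<open>The operator annihilates the first four functions and sends \<open>pw\<close> to
  \<open>p0\<close> and \<open>ps\<close> to \<open>p2\<close>, so on coefficients it is a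
  shift.\<close>

lemma sol_cmb: "sol (cmb cw cs 0 0 0 0) (cmb c0 c2 cE ck cw cs) (cmb' c0 c2 cE ck cw cs)"
proof -
  have "sol (\<lambda>y. c0 *s 0 + c2 *s 0 + cE *s 0 + ck *s 0 + cw *s p0 y + cs *s p2 y)
     (cmb c0 c2 cE ck cw cs) (cmb' c0 c2 cE ck cw cs)"
    unfolding cmb_def[abs_def] cmb'_def[abs_def]
    by (intro sol_add sol_smult s0 s2 sE sk sw ss)
  moreover have "(\<lambda>y. c0 *s 0 + c2 *s 0 + cE *s 0 + ck *s 0 + cw *s p0 y + cs *s p2 y) = cmb cw cs 0 0 0 0"
    by (simp add: cmb_def fun_eq_iff)
  ultimately show ?thesis by simp
qed

lemma cmb_shift: "cmb c0 c2 cE ck cw cs (y + T) = cmb c0 c2 cE ck cw cs y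
    + (rh cE ck cw cs) *s p0 y
    - (rT cE ck cw) *s p2 y"
  unfolding cmb_def per0 per2 shE shk shw shs by (simp add: vec_eq_2 algebra_simps)

lemma conc_linear:
  "conc y w w1 (u + v) (u1 + v1) = conc y w w1 u u1 + conc y w w1 v v1"
  "conc y w w1 (c *s u) (c *s u1) = c * conc y w w1 u u1"
  "conc y u u1 w w1 = - conc y w w1 u u1" "conc y u u1 u u1 = 0"
  by (simp_all add: conc_def algebra_simps)

text \<open>The boundary form pairs \<open>p0\<close> with \<open>pk\<close> and \<open>p2\<close>
  with \<open>pE\<close>, and hence reads off the coefficients of a homogeneous solution.\<close>

lemma conc_cmb:
  "conc 0 (p0 0) (p0' 0) (cmb c0 c2 cE ck 0 0 0) (cmb' c0 c2 cE ck 0 0 0) = - ck"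
  "conc 0 (p2 0) (p2' 0) (cmb c0 c2 cE ck 0 0 0) (cmb' c0 c2 cE ck 0 0 0) = - cE"
  "conc 0 (pE 0) (pE' 0) (cmb c0 c2 0 0 0 0 0) (cmb' c0 c2 0 0 0 0 0) = c2"
  "conc 0 (pk 0) (pk' 0) (cmb c0 c2 0 0 0 0 0) (cmb' c0 c2 0 0 0 0 0) = c0"
  using c02 c0E c0k c2E c2k conc_linear(3)[of 0 "p2 0" "p2' 0" "p0 0" "p0' 0"]
    conc_linear(3)[of 0 "pE 0" "pE' 0" "p0 0" "p0' 0"] conc_linear(3)[of 0 "pE 0" "pE' 0" "p2 0" "p2' 0"]
    conc_linear(3)[of 0 "pk 0" "pk' 0" "p0 0" "p0' 0"] conc_linear(3)[of 0 "pk 0" "pk' 0" "p2 0" "p2' 0"]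
  by (simp_all add: cmb_def cmb'_def conc_linear(1,2,4))

text \<open>For homogeneous solutions the boundary form at 0 detects all four coefficients. Applying
  the operator to a general relation leaves a homogeneous one in \<open>cw\<close> and
  \<open>cs\<close>, so these vanish first.\<close>

lemma cmb_eq_0:
  assumes "\<And>y. cmb c0 c2 cE ck cw cs y = 0"
  shows "c0 = 0 \<and> c2 = 0 \<and> cE = 0 \<and> ck = 0 \<and> cw = 0 \<and> cs = 0"
proof -
  have deriv0: "cmb' d0 d2 dE dk dw ds y = 0" if "\<And>y. cmb d0 d2 dE dk dw ds y = 0" for d0 d2 dE dk dw ds y
  proof -
    have "(cmb d0 d2 dE dk dw ds has_vector_derivative cmb' d0 d2 dE dk dw ds y) (at y)"
      using sol_cmb unfolding sol_def by blast
    moreover have "cmb d0 d2 dE dk dw ds = (\<lambda>y. 0)" using that by auto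
    ultimately show ?thesis
      using vector_derivative_unique_at has_vector_derivative_const by metis
  qed
  have homog: "d0 = 0 \<and> d2 = 0 \<and> dE = 0 \<and> dk = 0" if 0: "\<And>y. cmb d0 d2 dE dk 0 0 y = 0" for d0 d2 dE dk
  proof -
    have "conc 0 w w1 0 0 = 0" for w w1 by (simp add: conc_def)
    then have 1: "dk = 0" "dE = 0"
      using conc_cmb(1,2)[of d0 d2 dE dk] 0[of 0] deriv0[OF 0, of 0] by simp_all
    moreover have "d2 = 0" "d0 = 0"
      using conc_cmb(3,4)[of d0 d2] 0[of 0] deriv0[OF 0, of 0] 1 \<open>\<And>w1 w. conc 0 w w1 0 0 = 0\<close> by simp_all
    ultimately show ?thesis by simp
  qed
  have "cmb cw cs 0 0 0 0 y = 0" for y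
  proof -
    have "cmb c0 c2 cE ck cw cs = (\<lambda>y. 0)" using assms by auto
    then have "sol (cmb cw cs 0 0 0 0) (\<lambda>y. 0) (cmb' c0 c2 cE ck cw cs)"
      using sol_cmb[of cw cs c0 c2 cE ck] by simp
    then show ?thesis by (rule sol_functional[OF _ sol_zero])
  qed
  from homog[OF this] have "cw = 0" "cs = 0" by auto
  moreover have "c0 = 0 \<and> c2 = 0 \<and> cE = 0 \<and> ck = 0"
    using homog[of c0 c2 cE ck] assms calculation by blast
  ultimately show ?thesis by simp
qed

lemma cmb_periodic_iff:
  "(\<forall>y. cmb c0 c2 cE ck cw cs (y + T) = cmb c0 c2 cE ck cw cs y) \<longleftrightarrow>
    rh cE ck cw cs = 0 \<and> rT cE ck cw = 0"
proof -
  have "(\<forall>y. cmb c0 c2 cE ck cw cs (y + T) = cmb c0 c2 cE ck cw cs y) \<longleftrightarrow>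
     (\<forall>y. cmb (rh cE ck cw cs) (- (rT cE ck cw)) 0 0 0 0 y = 0)"
    unfolding cmb_shift by (auto simp: cmb_def vec_eq_2 algebra_simps)
  also have "\<dots> \<longleftrightarrow> rh cE ck cw cs = 0 \<and> rT cE ck cw = 0"
  proof
    assume "\<forall>y. cmb (rh cE ck cw cs) (- (rT cE ck cw)) 0 0 0 0 y = 0"
    from cmb_eq_0[OF this[rule_format]]
    show "rh cE ck cw cs = 0 \<and> rT cE ck cw = 0"
      by (simp only: neg_equal_0_iff_equal)
  next
    assume "rh cE ck cw cs = 0 \<and> rT cE ck cw = 0"
    then show "\<forall>y. cmb (rh cE ck cw cs) (- (rT cE ck cw)) 0 0 0 0 y = 0"
      by (simp only: minus_zero cmb_zero zero_fun_apply simp_thms)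
  qed
  finally show ?thesis .
qed

lemma homogeneous_solution:
  assumes "sol (\<lambda>y. 0) u u1"
  obtains c0 c2 cE ck where "u = cmb c0 c2 cE ck 0 0" "u1 = cmb' c0 c2 cE ck 0 0"
proof -
  obtain c0 c2 cE ck where c: "u 0 = cmb c0 c2 cE ck 0 0 0" "u1 0 = cmb' c0 c2 cE ck 0 0 0"
    using ic_span[of "u 0" "u1 0"] by (auto simp: cmb_def cmb'_def)
  have "sol (\<lambda>y. 0) (cmb c0 c2 cE ck 0 0) (cmb' c0 c2 cE ck 0 0)"
    using sol_cmb[of 0 0 c0 c2 cE ck] by (simp add: cmb_zero zero_fun_def)
  from sol_diff[OF assms this]
  have s: "sol (\<lambda>y. 0) (\<lambda>y. u y - cmb c0 c2 cE ck 0 0 y) (\<lambda>y. u1 y - cmb' c0 c2 cE ck 0 0 y)" by simp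
  have "u y - cmb c0 c2 cE ck 0 0 y = 0" "u1 y - cmb' c0 c2 cE ck 0 0 y = 0" for y
    using sol_unique_0[OF s, of y] c by auto
  then show ?thesis using that[of c0 c2 cE ck] by (auto simp: fun_eq_iff)
qed

lemma inhomogeneous_solution:
  assumes "sol (cmb cw cs 0 0 0 0) u u1"
  obtains c0 c2 cE ck where "u = cmb c0 c2 cE ck cw cs"
proof -
  have "sol (\<lambda>y. 0) (\<lambda>y. u y - cmb 0 0 0 0 cw cs y) (\<lambda>y. u1 y - cmb' 0 0 0 0 cw cs y)"
    using sol_diff[OF assms sol_cmb[of cw cs 0 0 0 0]] by simp
  then obtain c0 c2 cE ck where "(\<lambda>y. u y - cmb 0 0 0 0 cw cs y) = cmb c0 c2 cE ck 0 0"
    by (rule homogeneous_solution)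
  then have "u y = cmb c0 c2 cE ck 0 0 y + cmb 0 0 0 0 cw cs y" for y
    by (auto simp: fun_eq_iff algebra_simps)
  then have "u = cmb c0 c2 cE ck cw cs" by (simp add: cmb_add fun_eq_iff)
  then show ?thesis using that by blast
qed

lemma csol_cmb:
  fixes c0 c2 cE ck cw cs :: complex
  assumes "rh cE ck cw cs = 0" "rT cE ck cw = 0"
  shows "csol (cmb c0 c2 cE ck cw cs) (cmb cw cs 0 0 0 0)"
  unfolding csol_def
proof (intro conjI)
  show "continuous_on UNIV (cmb cw cs 0 0 0 0)" by (rule sol_continuous[OF sol_cmb])
  show "\<forall>y. cmb cw cs 0 0 0 0 (y + T) = cmb cw cs 0 0 0 0 y" by (simp add: cmb_periodic_iff)
  show "\<forall>y. cmb c0 c2 cE ck cw cs (y + T) = cmb c0 c2 cE ck cw cs y"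
    using assms by (simp only: cmb_periodic_iff simp_thms)
  show "\<exists>u1. sol (cmb cw cs 0 0 0 0) (cmb c0 c2 cE ck cw cs) u1" using sol_cmb by blast
qed

lemma csol_cmbD:
  assumes "csol u (cmb cw cs 0 0 0 0)"
  obtains c0 c2 cE ck :: complex where "u = cmb c0 c2 cE ck cw cs"
    "rh cE ck cw cs = 0" "rT cE ck cw = 0"
proof -
  obtain u1 where "sol (cmb cw cs 0 0 0 0) u u1" using assms by (auto simp: csol_def)
  then obtain c0 c2 cE ck where u: "u = cmb c0 c2 cE ck cw cs" by (rule inhomogeneous_solution)
  have "\<forall>y. cmb c0 c2 cE ck cw cs (y + T) = cmb c0 c2 cE ck cw cs y"
    using assms u by (simp add: csol_def)
  then show ?thesis using that[OF u] unfolding cmb_periodic_iff by blast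
qed

lemma ker_pow_1_iff:
  "ker_pow op 1 = {cmb c0 c2 cE ck 0 0 | c0 c2 cE ck. cE * complex_of_real hE + ck * of_real hk = 0 \<and> cE * complex_of_real TE + ck * of_real Tk = 0}"
  unfolding ker_pow_1
proof safe
  fix u assume "csol u 0"
  then have "csol u (cmb 0 0 0 0 0 0)" by (simp add: cmb_zero)
  then obtain c0 c2 cE ck :: complex where "u = cmb c0 c2 cE ck 0 0"
    "cE * hE + ck * hk = 0" "cE * TE + ck * Tk = 0"
    by (rule csol_cmbD) simp
  then show "\<exists>c0 c2 cE ck. u = cmb c0 c2 cE ck 0 0 \<and> cE * complex_of_real hE + ck * of_real hk = 0
      \<and> cE * complex_of_real TE + ck * of_real Tk = 0" by auto
next
  fix c0 c2 cE ck :: complex assume "cE * hE + ck * hk = 0" "cE * TE + ck * Tk = 0"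
  then show "csol (cmb c0 c2 cE ck 0 0) 0" using csol_cmb[of cE ck 0 0 c0 c2] by (simp add: cmb_zero)
qed

lemma cmb_fun_smult: "(\<lambda>y. c *s cmb c0 c2 cE ck cw cs y) = cmb (c * c0) (c * c2) (c * cE) (c * ck) (c * cw) (c * cs)"
  by (simp add: cmb_smult fun_eq_iff)

lemma cmb_fun_add: "cmb c0 c2 cE ck cw cs + cmb d0 d2 dE dk dw ds =
    cmb (c0 + d0) (c2 + d2) (cE + dE) (ck + dk) (cw + dw) (cs + ds)"
  by (simp add: cmb_add fun_eq_iff)

lemma cmb_fun_sum: "(\<Sum>i\<in>I. cmb (c0 i) (c2 i) (cE i) (ck i) (cw i) (cs i)) =
    cmb (\<Sum>i\<in>I. c0 i) (\<Sum>i\<in>I. c2 i) (\<Sum>i\<in>I. cE i) (\<Sum>i\<in>I. ck i) (\<Sum>i\<in>I. cw i) (\<Sum>i\<in>I. cs i)"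
  by (induction I rule: infinite_finite_induct) (auto simp: cmb_zero cmb_fun_add)

lemma cmb_fun_eq_0: "cmb c0 c2 cE ck cw cs = 0 \<Longrightarrow>
    c0 = 0 \<and> c2 = 0 \<and> cE = 0 \<and> ck = 0 \<and> cw = 0 \<and> cs = 0"
  by (rule cmb_eq_0) simp

lemma basis_02: "cfun.independent {cmb 1 0 0 0 0 0, cmb 0 1 0 0 0 0}"
  "card {cmb 1 0 0 0 0 0, cmb 0 1 0 0 0 0} = 2"
  "cfun.span {cmb 1 0 0 0 0 0, cmb 0 1 0 0 0 0} = {cmb c0 c2 0 0 0 0 | c0 c2. True}"
proof -
  define h where "h b = (if b then cmb 1 0 0 0 0 0 else cmb 0 1 0 0 0 0)" for b
  have s: "(\<Sum>b\<in>UNIV. (\<lambda>y. \<gamma> b *s h b y)) = cmb (\<gamma> True) (\<gamma> False) 0 0 0 0" for \<gamma>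
    by (simp add: UNIV_bool h_def cmb_fun_smult cmb_fun_add)
  have i: "\<forall>b\<in>UNIV. \<gamma> b = 0" if "w \<in> cfun.span {}" "w + (\<Sum>b\<in>UNIV. (\<lambda>y. \<gamma> b *s h b y)) = 0" for w \<gamma>
    using that cmb_fun_eq_0[of "\<gamma> True" "\<gamma> False" 0 0 0 0] unfolding s by (auto simp: UNIV_bool)
  note E = cfun_extension[of UNIV "{}" h, OF finite_class.finite_UNIV finite.emptyI cfun.independent_empty i, simplified]
  have img: "range h = {cmb 1 0 0 0 0 0, cmb 0 1 0 0 0 0}" by (auto simp: h_def UNIV_bool)
  show "cfun.independent {cmb 1 0 0 0 0 0, cmb 0 1 0 0 0 0}"
    "card {cmb 1 0 0 0 0 0, cmb 0 1 0 0 0 0} = 2"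
    using E(1,2) unfolding img by auto
  show "cfun.span {cmb 1 0 0 0 0 0, cmb 0 1 0 0 0 0} = {cmb c0 c2 0 0 0 0 | c0 c2. True}"
  proof -
    have "\<exists>\<gamma>. cmb c0 c2 0 0 0 0 = cmb (\<gamma> True) (\<gamma> False) 0 0 0 0" for c0 c2
      by (rule exI[of _ "\<lambda>b. if b then c0 else c2"]) simp
    then show ?thesis using E(3) unfolding img s by auto
  qed
qed

text \<open>\<open>B\<close> is any matrix with the right kernel, so one count serves both the
  Jacobian of the period and phase and the Hessian of the action. The span of \<open>p0\<close>,
  \<open>p2\<close> is extended by one combination of \<open>pE\<close>, \<open>pk\<close> for each
  basis vector of the kernel.\<close>

lemma dim_ker_pow_1:
  fixes B :: "real^2^2"
  assumes B: "\<And>x. x \<in> ker_mat B \<longleftrightarrow> x $ 1 * TE + x $ 2 * Tk = 0 \<and> x $ 1 * hE + x $ 2 * hk = 0"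
    and Bc: "\<And>c :: 2 \<Rightarrow> complex. c 1 * TE + c 2 * Tk = 0 \<Longrightarrow> c 1 * hE + c 2 * hk = 0 \<Longrightarrow>
      (\<forall>i. (\<Sum>j\<in>UNIV. of_real (B $ i $ j) * c j) = 0)"
  shows "cfun.dim (ker_pow op 1) = 2 + dim (ker_mat B)"
proof -
  obtain Bs where Bs: "Bs \<subseteq> ker_mat B" "independent Bs" "ker_mat B \<subseteq> span Bs" "card Bs = dim (ker_mat B)"
    by (rule basis_exists)
  have fin: "finite Bs" using Bs(2) independent_imp_finite by blast
  define h where "h b = cmb 0 0 (of_real (b $ 1)) (of_real (b $ 2)) 0 0" for b :: "real^2"
  let ?W = "{cmb 1 0 0 0 0 0, cmb 0 1 0 0 0 0}"
  have s: "(\<Sum>b\<in>Bs. (\<lambda>y. \<gamma> b *s h b y)) =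
      cmb 0 0 (comb Bs \<gamma> 1) (comb Bs \<gamma> 2) 0 0" for \<gamma>
    by (simp add: h_def cmb_fun_smult cmb_fun_sum)
  have i: "\<forall>b\<in>Bs. \<gamma> b = 0" if w: "w \<in> cfun.span ?W" and z: "w + (\<Sum>b\<in>Bs. (\<lambda>y. \<gamma> b *s h b y)) = 0" for w \<gamma>
  proof -
    obtain c0 c2 where "w = cmb c0 c2 0 0 0 0" using w unfolding basis_02(3) by blast
    then have "cmb c0 c2 (comb Bs \<gamma> 1) (comb Bs \<gamma> 2) 0 0 = 0"
      using z unfolding s by (simp add: cmb_fun_add)
    from cmb_fun_eq_0[OF this] have "\<forall>j. (comb Bs \<gamma> j) = 0" by (simp add: forall_2)
    then show ?thesis using complex_independent[OF Bs(2) fin] by blast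
  qed
  note E = cfun_extension[OF fin _ basis_02(1) i]
  have "cfun.span (?W \<union> h ` Bs) = ker_pow op 1"
  proof -
    have "cfun.span (?W \<union> h ` Bs) =
        {cmb c0 c2 (comb Bs \<gamma> 1) (comb Bs \<gamma> 2) 0 0 | c0 c2 \<gamma>. True}"
    proof -
      have "cfun.span (?W \<union> h ` Bs) = {w + (\<Sum>i\<in>Bs. (\<lambda>y. \<gamma> i *s h i y)) | w \<gamma>. w \<in> cfun.span ?W}"
        by (rule E(3)) auto
      also have "\<dots> = {cmb c0 c2 (comb Bs \<gamma> 1) (comb Bs \<gamma> 2) 0 0 | c0 c2 \<gamma>. True}"
        unfolding s basis_02(3)
      proof (intro equalityI subsetI)
        fix x assume "x \<in> {w + cmb 0 0 (comb Bs \<gamma> 1) (comb Bs \<gamma> 2) 0 0 | w \<gamma>. w \<in> {cmb c0 c2 0 0 0 0 | c0 c2. True}}"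
        then obtain c0 c2 \<gamma> where "x = cmb c0 c2 0 0 0 0 + cmb 0 0 (comb Bs \<gamma> 1) (comb Bs \<gamma> 2) 0 0" by blast
        then have "x = cmb c0 c2 (comb Bs \<gamma> 1) (comb Bs \<gamma> 2) 0 0" by (simp add: cmb_fun_add)
        then show "x \<in> {cmb c0 c2 (comb Bs \<gamma> 1) (comb Bs \<gamma> 2) 0 0 | c0 c2 \<gamma>. True}" by blast
      next
        fix x assume "x \<in> {cmb c0 c2 (comb Bs \<gamma> 1) (comb Bs \<gamma> 2) 0 0 | c0 c2 \<gamma>. True}"
        then obtain c0 c2 \<gamma> where "x = cmb c0 c2 (comb Bs \<gamma> 1) (comb Bs \<gamma> 2) 0 0" by blast
        then have "x = cmb c0 c2 0 0 0 0 + cmb 0 0 (comb Bs \<gamma> 1) (comb Bs \<gamma> 2) 0 0" by (simp add: cmb_fun_add)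
        then show "x \<in> {w + cmb 0 0 (comb Bs \<gamma> 1) (comb Bs \<gamma> 2) 0 0 | w \<gamma>. w \<in> {cmb c0 c2 0 0 0 0 | c0 c2. True}}" by blast
      qed
      finally show ?thesis .
    qed
    also have "\<dots> = ker_pow op 1" unfolding ker_pow_1_iff
    proof safe
      fix c0 c2 \<gamma>
      have "(comb Bs \<gamma> 1) * of_real x + (comb Bs \<gamma> 2) * of_real y
        = (\<Sum>b\<in>Bs. \<gamma> b * complex_of_real (b $ 1 * x + b $ 2 * y))" for x y :: real
        unfolding sum_distrib_right sum.distrib[symmetric] by (rule sum.cong) (simp_all add: algebra_simps)
      moreover have "b $ 1 * TE + b $ 2 * Tk = 0" "b $ 1 * hE + b $ 2 * hk = 0" if "b \<in> Bs" for b
        using B Bs(1) that by blast+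
      ultimately have "(comb Bs \<gamma> 1) * hE + (comb Bs \<gamma> 2) * hk = 0"
        "(comb Bs \<gamma> 1) * TE + (comb Bs \<gamma> 2) * Tk = 0"
        by (simp_all del: of_real_add of_real_mult)
      then show "\<exists>c0' c2' cE ck. cmb c0 c2 (comb Bs \<gamma> 1) (comb Bs \<gamma> 2) 0 0
          = cmb c0' c2' cE ck 0 0 \<and> cE * complex_of_real hE + ck * of_real hk = 0
          \<and> cE * complex_of_real TE + ck * of_real Tk = 0" by blast
    next
      fix c0 c2 cE ck :: complex assume c: "cE * hE + ck * hk = 0" "cE * TE + ck * Tk = 0"
      define c where "c j = (if j = 1 then cE else ck)" for j :: 2
      have c12: "c 1 = cE" "c 2 = ck" by (auto simp: c_def)
      have "\<forall>i. (\<Sum>j\<in>UNIV. of_real (B $ i $ j) * c j) = 0" by (rule Bc) (use c c12 in auto)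
      then obtain \<gamma> where "\<And>j. c j = (comb Bs \<gamma> j)"
        using complex_kernel[OF Bs(2,3) fin, of c] by blast
      from this[of 1] this[of 2]
      show "\<exists>c0' c2' \<gamma>. cmb c0 c2 cE ck 0 0 =
          cmb c0' c2' (comb Bs \<gamma> 1) (comb Bs \<gamma> 2) 0 0 \<and> True"
        unfolding c12 by blast
    qed
    finally show ?thesis .
  qed
  then have "cfun.dim (ker_pow op 1) = cfun.dim (cfun.span (?W \<union> h ` Bs))" by simp
  also have "\<dots> = card (?W \<union> h ` Bs)"
    unfolding cfun.dim_span using E(1) by (intro cfun.dim_eq_card_independent) auto
  also have "\<dots> = card ?W + card Bs" by (rule E(2)) auto
  finally show ?thesis using basis_02(2) Bs(4) by simp
qed

end

lemma vector_4 [simp]: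
  "(vector [x, y, z, w] :: 'a::zero^4) $ 1 = x" "(vector [x, y, z, w] :: 'a^4) $ 2 = y"
  "(vector [x, y, z, w] :: 'a^4) $ 3 = z" "(vector [x, y, z, w] :: 'a^4) $ 4 = w"
  unfolding vector_def by simp_all

context jordan
begin

text \<open>\<open>s1\<close> and \<open>s2\<close> are the brackets of period and phase in
  \<open>\<kappa>, \<omega>\<close> and in \<open>\<omega>, E\<close>, and \<open>j0\<close> to
  \<open>j3\<close> are the four vectors of the theorem. The coefficients in \<open>j1\<close> and
  \<open>j3\<close> solve \<open>rh = rT = 0\<close> by Cramer's rule, multiplied by
  \<open>\<sigma>\<close>.\<close>

definition "s1 = Tk * hw - Tw * hk"
definition "s2 = Tw * hE - TE * hw"
definition "j0 = cmb (of_real \<sigma>) 0 0 0 0 0"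
definition "j1 = cmb 0 0 (of_real s1) (of_real s2) (of_real \<sigma>) 0"
definition "j2 = cmb 0 (of_real \<sigma>) 0 0 0 0"
definition "j3 = cmb 0 0 (of_real (T * Tk / 2)) (of_real (- (T * TE / 2))) 0 (of_real \<sigma>)"

lemma csol_j: "csol j0 0" "csol j1 j0" "csol j2 0" "csol j3 j2"
proof -
  show "csol j0 0" "csol j2 0"
    using csol_cmb[of 0 0 0 0] by (simp_all add: j0_def j2_def cmb_zero)
  have "s1 * hE + s2 * hk + \<sigma> * hw + 0 * (T / 2) = 0" "s1 * TE + s2 * Tk + \<sigma> * Tw = 0"
    by (simp_all add: s1_def s2_def \<sigma> algebra_simps)
  then have "complex_of_real (s1 * hE + s2 * hk + \<sigma> * hw + 0 * (T / 2)) = 0"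
    "complex_of_real (s1 * TE + s2 * Tk + \<sigma> * Tw) = 0" by (simp_all only: of_real_0)
  then show "csol j1 j0"
    unfolding j0_def j1_def by (intro csol_cmb) (simp_all only: of_real_add of_real_mult of_real_0)
  have "T * Tk / 2 * hE + - (T * TE / 2) * hk + 0 * hw + \<sigma> * (T / 2) = 0"
    "T * Tk / 2 * TE + - (T * TE / 2) * Tk + 0 * Tw = 0"
    by (simp_all add: \<sigma> algebra_simps)
  then have "complex_of_real (T * Tk / 2 * hE + - (T * TE / 2) * hk + 0 * hw + \<sigma> * (T / 2)) = 0"
    "complex_of_real (T * Tk / 2 * TE + - (T * TE / 2) * Tk + 0 * Tw) = 0" by (simp_all only: of_real_0)
  then show "csol j3 j2"
    unfolding j2_def j3_def by (intro csol_cmb) (simp_all only: of_real_add of_real_mult of_real_0)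
qed

lemma cramer:
  fixes x y r r' :: complex
  assumes "x * hE + y * hk = r" "x * TE + y * Tk = r'"
  shows "of_real \<sigma> * x = r' * hk - r * Tk" "of_real \<sigma> * y = r * TE - r' * hE"
  unfolding \<sigma> assms[symmetric] by (simp_all add: algebra_simps)

lemma ker_pow_1_nondegenerate:
  assumes "\<sigma> \<noteq> 0" shows "ker_pow op 1 = {cmb c0 c2 0 0 0 0 | c0 c2. True}"
  unfolding ker_pow_1_iff
proof safe
  fix c0 c2 cE ck :: complex assume "cE * hE + ck * hk = 0" "cE * TE + ck * Tk = 0"
  from cramer[OF this] have "cE = 0" "ck = 0" using assms by auto
  then show "\<exists>c0' c2'. cmb c0 c2 cE ck 0 0 = cmb c0' c2' 0 0 0 0 \<and> True" by blast
next
  fix c0 c2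
  show "\<exists>c0' c2' cE ck. cmb c0 c2 0 0 0 0 = cmb c0' c2' cE ck 0 0 \<and>
      cE * complex_of_real hE + ck * of_real hk = 0 \<and> cE * complex_of_real TE + ck * of_real Tk = 0"
    by (intro exI[of _ c0] exI[of _ c2] exI[of _ 0]) simp
qed

lemma ker_pow_2_iff:
  assumes "\<sigma> \<noteq> 0"
  shows "ker_pow op 2 = {cmb c0 c2 cE ck cw cs | c0 c2 cE ck cw cs.
    rh cE ck cw cs = 0 \<and>
    rT cE ck cw = 0}"
proof -
  have "ker_pow op 2 = {u. \<exists>w \<in> ker_pow op 1. csol u w}"
    using ker_pow_Suc[of 0] by (simp add: numeral_2_eq_2)
  also have "\<dots> = {u. \<exists>cw cs. csol u (cmb cw cs 0 0 0 0)}"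
    unfolding ker_pow_1_nondegenerate[OF assms] by blast
  finally have k: "ker_pow op 2 = {u. \<exists>cw cs. csol u (cmb cw cs 0 0 0 0)}" .
  show ?thesis unfolding k
  proof (intro equalityI subsetI)
    fix u assume "u \<in> {u. \<exists>cw cs. csol u (cmb cw cs 0 0 0 0)}"
    then obtain cw cs where "csol u (cmb cw cs 0 0 0 0)" by blast
    then show "u \<in> {cmb c0 c2 cE ck cw cs | c0 c2 cE ck cw cs.
      rh cE ck cw cs = 0 \<and>
      rT cE ck cw = 0}"
      by (rule csol_cmbD) blast
  qed (use csol_cmb in blast)
qed

definition "js = (!) [j0, j1, j2, j3]"

abbreviation jc :: "(nat \<Rightarrow> complex) \<Rightarrow> real \<Rightarrow> complex^2" where
  "jc \<gamma> \<equiv> cmb (\<gamma> 0 * \<sigma>) (\<gamma> 2 * \<sigma>) (\<gamma> 1 * s1 + \<gamma> 3 * of_real (T * Tk / 2)) (\<gamma> 1 * s2 - \<gamma> 3 * of_real (T * TE / 2))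
    (\<gamma> 1 * \<sigma>) (\<gamma> 3 * \<sigma>)"

lemma sum_js: "(\<Sum>i\<in>{0, 1, 2, 3::nat}. (\<lambda>y. \<gamma> i *s js i y)) =
    jc \<gamma>"
  by (simp add: js_def j0_def j1_def j2_def j3_def cmb_fun_smult cmb_fun_add numeral_2_eq_2 numeral_3_eq_3
      del: of_real_divide of_real_mult)

lemma js_image: "js ` {0, 1, 2, 3} = {j0, j1, j2, j3}"
  by (simp add: js_def numeral_2_eq_2 numeral_3_eq_3)

lemma basis_j:
  assumes \<sigma>0: "\<sigma> \<noteq> 0"
  shows "cfun.independent {j0, j1, j2, j3}" "card {j0, j1, j2, j3} = 4" "distinct [j0, j1, j2, j3]"
    "cfun.span {j0, j1, j2, j3} = ker_pow op 2"
proof -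
  have i: "\<forall>i\<in>{0, 1, 2, 3::nat}. \<gamma> i = 0"
    if "w \<in> cfun.span {}" "w + (\<Sum>i\<in>{0, 1, 2, 3::nat}. (\<lambda>y. \<gamma> i *s js i y)) = 0" for w \<gamma>
  proof -
    have "w = 0" using that(1) by simp
    then have "(\<Sum>i\<in>{0, 1, 2, 3::nat}. (\<lambda>y. \<gamma> i *s js i y)) = 0" using that(2) by (simp only: add_0_left)
    from cmb_fun_eq_0[OF this[unfolded sum_js]] show ?thesis using \<sigma>0 by auto
  qed
  have fin: "finite {0, 1, 2, 3::nat}" by simp
  have E: "cfun.independent ({} \<union> js ` {0, 1, 2, 3})" "card ({} \<union> js ` {0, 1, 2, 3}) = card ({} :: (real \<Rightarrow> complex^2) set) + card {0, 1, 2, 3::nat}"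
    "cfun.span ({} \<union> js ` {0, 1, 2, 3}) = {w + (\<Sum>i\<in>{0, 1, 2, 3}. (\<lambda>y. \<gamma> i *s js i y)) | w \<gamma>. w \<in> cfun.span {}}"
    by (rule cfun_extension[OF fin finite.emptyI cfun.independent_empty i]; assumption)+
  note E = E[unfolded js_image Un_empty_left]
  show "cfun.independent {j0, j1, j2, j3}" by (rule E(1))
  show c: "card {j0, j1, j2, j3} = 4" using E(2) by simp
  then show "distinct [j0, j1, j2, j3]" by (intro card_distinct) simp
  have "cfun.span {j0, j1, j2, j3} = {(\<Sum>i\<in>{0, 1, 2, 3::nat}. (\<lambda>y. \<gamma> i *s js i y)) | \<gamma>. True}"
    unfolding E(3) cfun.span_empty by simp
  also have "\<dots> = ker_pow op 2"
    unfolding sum_js ker_pow_2_iff[OF \<sigma>0]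
  proof (intro equalityI subsetI)
    fix x assume "x \<in> {jc \<gamma> | \<gamma> :: nat \<Rightarrow> complex. True}"
    then obtain \<gamma> :: "nat \<Rightarrow> complex" where x: "x = jc \<gamma>" by blast
    have "(\<gamma> 1 * s1 + \<gamma> 3 * of_real (T * Tk / 2)) * complex_of_real hE + (\<gamma> 1 * s2 - \<gamma> 3 * of_real (T * TE / 2)) * of_real hk
       + (\<gamma> 1 * \<sigma>) * of_real hw + (\<gamma> 3 * \<sigma>) * of_real (T / 2) = 0"
      "(\<gamma> 1 * s1 + \<gamma> 3 * of_real (T * Tk / 2)) * complex_of_real TE + (\<gamma> 1 * s2 - \<gamma> 3 * of_real (T * TE / 2)) * of_real Tk
       + (\<gamma> 1 * \<sigma>) * of_real Tw = 0"
      by (simp_all add: s1_def s2_def \<sigma> algebra_simps add_divide_distrib[symmetric] diff_divide_distrib[symmetric])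
    then show "x \<in> {cmb c0 c2 cE ck cw cs | c0 c2 cE ck cw cs.
      rh cE ck cw cs = 0 \<and>
      rT cE ck cw = 0}"
      unfolding x by blast
  next
    fix x assume "x \<in> {cmb c0 c2 cE ck cw cs | c0 c2 cE ck cw cs.
      rh cE ck cw cs = 0 \<and>
      rT cE ck cw = 0}"
    then obtain c0 c2 cE ck cw cs where x: "x = cmb c0 c2 cE ck cw cs"
      and r: "rh cE ck cw cs = 0"
        "rT cE ck cw = 0" by blast
    have r': "cE * complex_of_real hE + ck * of_real hk = - (cw * of_real hw + cs * of_real (T / 2))"
      "cE * complex_of_real TE + ck * of_real Tk = - (cw * of_real Tw)"
      using r by (simp_all only: eq_neg_iff_add_eq_0 add.assoc)
    \<comment> \<open>The coefficients at \<open>p0\<close>, \<open>p2\<close>, \<open>pw\<close>,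
      \<open>ps\<close> fix \<open>\<gamma>\<close>, since each of these functions occurs in exactly
      one \<open>j\<close> and with factor \<open>\<sigma>\<close>. Those at \<open>pE\<close>,
      \<open>pk\<close> then agree by Cramer's rule.\<close>
    define \<gamma> where "\<gamma> i = (if i = 0 then c0 else if i = 1 then cw else if i = (2::nat) then c2 else cs) / of_real \<sigma>" for i
    have g: "\<gamma> 0 * \<sigma> = c0" "\<gamma> 2 * \<sigma> = c2" "\<gamma> 1 * \<sigma> = cw" "\<gamma> 3 * \<sigma> = cs"
      using \<sigma>0 by (simp_all add: \<gamma>_def)
    have "of_real \<sigma> * (\<gamma> 1 * s1 + \<gamma> 3 * of_real (T * Tk / 2)) = (\<gamma> 1 * \<sigma>) * s1 + (\<gamma> 3 * \<sigma>) * of_real (T * Tk / 2)"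
      "of_real \<sigma> * (\<gamma> 1 * s2 - \<gamma> 3 * of_real (T * TE / 2)) = (\<gamma> 1 * \<sigma>) * s2 - (\<gamma> 3 * \<sigma>) * of_real (T * TE / 2)"
      by (simp_all add: algebra_simps)
    moreover have "of_real \<sigma> * cE = cw * s1 + cs * of_real (T * Tk / 2)"
      "of_real \<sigma> * ck = cw * s2 - cs * of_real (T * TE / 2)"
      unfolding cramer[OF r'] by (simp_all add: s1_def s2_def algebra_simps)
    ultimately have "of_real \<sigma> * (\<gamma> 1 * s1 + \<gamma> 3 * of_real (T * Tk / 2)) = of_real \<sigma> * cE"
      "of_real \<sigma> * (\<gamma> 1 * s2 - \<gamma> 3 * of_real (T * TE / 2)) = of_real \<sigma> * ck"
      unfolding g by simp_all
    then have "\<gamma> 1 * s1 + \<gamma> 3 * of_real (T * Tk / 2) = cE" "\<gamma> 1 * s2 - \<gamma> 3 * of_real (T * TE / 2) = ck"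
      using \<sigma>0 by simp_all
    then have "x = jc \<gamma>" unfolding g x by simp
    then show "x \<in> {jc \<gamma> | \<gamma> :: nat \<Rightarrow> complex. True}" by blast
  qed
  finally show "cfun.span {j0, j1, j2, j3} = ker_pow op 2" .
qed

section \<open>Solvability and the kernel of the third power\<close>

lemma symp_linear:
  "symp p (u + v) = symp p u + symp p v" "symp p (c *s u) = c * symp p u" "symp p p = 0" "symp u p = - symp p u"
  by (simp_all add: symp_def algebra_simps)

lemma symp_cmb: "symp p (cmb c0 c2 cE ck cw cs y) = c0 * symp p (p0 y) + c2 * symp p (p2 y) + cE * symp p (pE y)
    + ck * symp p (pk y) + cw * symp p (pw y) + cs * symp p (ps y)"
  by (simp add: cmb_def symp_linear(1,2))

text \<open>The boundary terms in Green's identity are the components of the defect \<open>u(y + T) - u(y)\<close>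
  along the two nonperiodic homogeneous solutions.\<close>

lemma defect:
  assumes u: "sol (cmb c0 c2 cE ck cw cs) u u1"
    and row: "rh cE ck cw cs = 0"
      "rT cE ck cw = 0"
  obtains d0 d2 where "\<And>y. u (y + T) = u y + cmb d0 d2 ((rD ck cs) / 2)
      ((rM cE ck cw) / 2) 0 0 y"
    "\<And>y. u1 (y + T) = u1 y + cmb' d0 d2 ((rD ck cs) / 2)
      ((rM cE ck cw) / 2) 0 0 y"
proof -
  let ?w = "cmb c0 c2 cE ck cw cs"
  have wp: "?w (y + T) = ?w y" for y using cmb_periodic_iff row by blast
  have "sol (\<lambda>y. 0) (\<lambda>y. u (y + T) - u y) (\<lambda>y. u1 (y + T) - u1 y)"
    using sol_diff[OF sol_shift[OF u] u] by (simp add: wp)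
  then obtain d0 d2 dE dk where d: "(\<lambda>y. u (y + T) - u y) = cmb d0 d2 dE dk 0 0"
    "(\<lambda>y. u1 (y + T) - u1 y) = cmb' d0 d2 dE dk 0 0" by (rule homogeneous_solution)
  have per': "p0' (y + T) = p0' y" "p2' (y + T) = p2' y" for y
    using sol_periodic_derivative[OF s0 per0] sol_periodic_derivative[OF s2 per2] by auto
  \<comment> \<open>Against a periodic homogeneous solution the boundary forms at \<open>T\<close>
    and at 0 differ only by the form evaluated on the defect of \<open>u\<close>.\<close>
  have bd: "conc T (w T) (w1 T) (u T) (u1 T) - conc 0 (w 0) (w1 0) (u 0) (u1 0)
      = conc 0 (w 0) (w1 0) (cmb d0 d2 dE dk 0 0 0) (cmb' d0 d2 dE dk 0 0 0)"
    if "w T = w 0" "w1 T = w1 0" for w w1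
  proof -
    have "conc T x x1 z z1 = conc 0 x x1 z z1" for x x1 z z1
      using per(1)[of 0] by (simp add: conc_def)
    moreover have "u T = u 0 + cmb d0 d2 dE dk 0 0 0" "u1 T = u1 0 + cmb' d0 d2 dE dk 0 0 0"
      using fun_cong[OF d(1), of 0] fun_cong[OF d(2), of 0] by (simp_all add: algebra_simps)
    ultimately show ?thesis using that by (simp add: conc_linear(1))
  qed
  have s0': "symp x 0 = 0" for x by (simp add: symp_def)
  have "((\<lambda>y. symp (p0 y) (?w y)) has_integral c0 * 0 + c2 * 0 + cE * of_real ((ME - TE * q) / 2)
      + ck * of_real ((Mk - Tk * q) / 2) + cw * of_real ((Mw - Tw * q) / 2) + cs * 0) {0..T}"
    unfolding symp_cmb
    by (intro has_integral_add has_integral_mult_right I02 I0E I0k I0w I0s) (simp add: symp_linear)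
  moreover have "((\<lambda>y. symp (u y) 0 - symp (p0 y) (?w y)) has_integral - dk) {0..T}"
    using green_sol[OF u s0] bd[of p0 p0'] per0[of 0] per'(1)[of 0] conc_cmb(1) by simp
  from has_integral_neg[OF this] have "((\<lambda>y. symp (p0 y) (?w y)) has_integral dk) {0..T}"
    by (simp add: s0')
  ultimately have "dk = c0 * 0 + c2 * 0 + cE * of_real ((ME - TE * q) / 2)
      + ck * of_real ((Mk - Tk * q) / 2) + cw * of_real ((Mw - Tw * q) / 2) + cs * 0"
    by (rule has_integral_unique[rotated])
  \<comment> \<open>The terms in \<open>q\<close> and, further below, in \<open>\<kappa>\<close>
    carry a factor \<open>rT\<close> or \<open>rh\<close>, so they vanish for a periodic right-hand
    side.\<close>
  also have "\<dots> = (rM cE ck cw) / 2 - (rT cE ck cw) * q / 2"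
    by (simp add: algebra_simps add_divide_distrib diff_divide_distrib)
  finally have dk: "dk = (rM cE ck cw) / 2" unfolding row(2) by simp
  have I20: "((\<lambda>y. symp (p2 y) (p0 y)) has_integral 0) {0..T}"
    using has_integral_neg[OF I02] by (subst symp_linear(4)) simp
  have "((\<lambda>y. symp (p2 y) (?w y)) has_integral c0 * 0 + c2 * 0 + cE * of_real ((\<kappa> * TE - q * hE) / 2)
      + ck * of_real ((T + \<kappa> * Tk - q * hk) / 2) + cw * of_real ((\<kappa> * Tw - q * hw) / 2)
      + cs * of_real ((M - T * q) / 4)) {0..T}"
    unfolding symp_cmb
    by (intro has_integral_add has_integral_mult_right I20 I2E I2k I2w I2s) (simp add: symp_linear)
  moreover have "((\<lambda>y. symp (u y) 0 - symp (p2 y) (?w y)) has_integral - dE) {0..T}"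
    using green_sol[OF u s2] bd[of p2 p2'] per2[of 0] per'(2)[of 0] conc_cmb(2) by simp
  from has_integral_neg[OF this] have "((\<lambda>y. symp (p2 y) (?w y)) has_integral dE) {0..T}"
    by (simp add: s0')
  ultimately have "dE = c0 * 0 + c2 * 0 + cE * of_real ((\<kappa> * TE - q * hE) / 2)
      + ck * of_real ((T + \<kappa> * Tk - q * hk) / 2) + cw * of_real ((\<kappa> * Tw - q * hw) / 2)
      + cs * of_real ((M - T * q) / 4)"
    by (rule has_integral_unique[rotated])
  also have "\<dots> = (rD ck cs) / 2 + (rT cE ck cw) * \<kappa> / 2
      - (rh cE ck cw cs) * q / 2"
    by (simp add: algebra_simps add_divide_distrib diff_divide_distrib)
  finally have dE: "dE = (rD ck cs) / 2" unfolding row by simp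
  show ?thesis
    by (rule that[of d0 d2]) (use d in \<open>auto simp: dE dk fun_eq_iff algebra_simps\<close>)
qed

text \<open>A Fredholm alternative: vanishing pairings leave a defect in the span of
  \<open>p0\<close>, \<open>p2\<close>, and adding multiples of \<open>pE\<close>, \<open>pk\<close>
  changes that part by the matrix with determinant \<open>\<sigma>\<close> up to sign.\<close>

lemma solvable_iff:
  assumes \<sigma>0: "\<sigma> \<noteq> 0"
    and row: "rh cE ck cw cs = 0"
      "rT cE ck cw = 0"
  shows "(\<exists>u. csol u (cmb c0 c2 cE ck cw cs)) \<longleftrightarrow>
    rM cE ck cw = 0 \<and> rD ck cs = 0"
    (is "?L \<longleftrightarrow> ?R")
proof
  assume ?L
  then obtain u u1 where u: "sol (cmb c0 c2 cE ck cw cs) u u1" "\<And>y. u (y + T) = u y" by (auto simp: csol_def)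
  obtain d0 d2 where d: "\<And>y. u (y + T) = u y + cmb d0 d2 ((rD ck cs) / 2)
      ((rM cE ck cw) / 2) 0 0 y"
    "\<And>y. u1 (y + T) = u1 y + cmb' d0 d2 ((rD ck cs) / 2)
      ((rM cE ck cw) / 2) 0 0 y" by (rule defect[OF u(1) row]) blast
  from d(1) have "cmb d0 d2 ((rD ck cs) / 2) ((rM cE ck cw) / 2) 0 0 y = 0" for y
    using u(2) by simp
  from cmb_eq_0[OF this] show ?R by simp
next
  assume R: ?R
  let ?w = "cmb c0 c2 cE ck cw cs"
  have wc: "continuous_on UNIV ?w" by (rule sol_continuous[OF sol_cmb])
  have wp: "?w (y + T) = ?w y" for y using cmb_periodic_iff row by blast
  obtain u u1 where u: "sol ?w u u1" using sol_exists[OF wc] .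
  obtain d0 d2 where d': "\<And>y. u (y + T) = u y + cmb d0 d2 ((rD ck cs) / 2)
      ((rM cE ck cw) / 2) 0 0 y"
    "\<And>y. u1 (y + T) = u1 y + cmb' d0 d2 ((rD ck cs) / 2)
      ((rM cE ck cw) / 2) 0 0 y" by (rule defect[OF u row]) blast
  have d: "u (y + T) = u y + cmb d0 d2 0 0 0 0 y" for y
    using d'(1)[of y] unfolding conjunct1[OF R] conjunct2[OF R] by simp
  \<comment> \<open>Together with \<open>bk\<close> this is the Cramer solution of the two equations
    in \<open>b\<close>, which state that the corrected function has no defect.\<close>
  define bE where "bE = (d2 * hk + d0 * Tk) / of_real \<sigma>"
  define bk where "bk = - (d0 * TE + d2 * hE) / of_real \<sigma>"
  have b: "d0 + bE * hE + bk * hk = 0" "d2 - (bE * TE + bk * Tk) = 0"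
  proof -
    have s: "of_real \<sigma> * bE = d2 * hk + d0 * Tk" "of_real \<sigma> * bk = - (d0 * TE + d2 * hE)"
      using \<sigma>0 by (simp_all add: bE_def bk_def)
    have "of_real \<sigma> * (d0 + bE * hE + bk * hk) = of_real \<sigma> * d0 + (of_real \<sigma> * bE) * hE + (of_real \<sigma> * bk) * hk"
      "of_real \<sigma> * (d2 - (bE * TE + bk * Tk)) = of_real \<sigma> * d2 - (of_real \<sigma> * bE) * TE - (of_real \<sigma> * bk) * Tk"
      by (simp_all add: algebra_simps)
    then have "of_real \<sigma> * (d0 + bE * hE + bk * hk) = 0" "of_real \<sigma> * (d2 - (bE * TE + bk * Tk)) = 0"
      unfolding s by (simp_all add: \<sigma> algebra_simps)
    then show "d0 + bE * hE + bk * hk = 0" "d2 - (bE * TE + bk * Tk) = 0" using \<sigma>0 by auto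
  qed
  define v where "v y = u y + cmb 0 0 bE bk 0 0 y" for y
  define v1 where "v1 y = u1 y + cmb' 0 0 bE bk 0 0 y" for y
  have "sol (\<lambda>y. ?w y + cmb 0 0 0 0 0 0 y) v v1"
    unfolding v_def[abs_def] v1_def[abs_def] by (rule sol_add[OF u sol_cmb])
  then have sv: "sol ?w v v1" by (simp add: cmb_zero)
  have "v (y + T) - v y = (d0 + bE * hE + bk * hk) *s p0 y + (d2 - (bE * TE + bk * Tk)) *s p2 y" for y
    unfolding v_def d cmb_shift by (simp add: cmb_def vec_eq_2 algebra_simps)
  then have "v (y + T) = v y" for y unfolding b by simp
  then show ?L unfolding csol_def using wc wp sv by blast
qed

text \<open>A function is in the third kernel iff its image is in the second. Modulo
  \<open>p0\<close> and \<open>p2\<close>, the members of the second kernel that lie in the range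
  correspond to the kernel of \<open>D\<close>, so one preimage per basis vector of that kernel is
  added to \<open>j0\<close> to \<open>j3\<close>.\<close>

lemma ker_pow_3_span:
  fixes D :: "real^4^4"
  assumes \<sigma>0: "\<sigma> \<noteq> 0"
    and D: "D = vector [vector [- hk, - hE, - hw, T], vector [Tk, TE, Tw, 0],
      vector [- Mk / 2, - ME / 2, - Mw / 2, 0], vector [T, 0, 0, - M]]"
  obtains Bs h where "Bs \<subseteq> ker_mat D" "independent Bs" "card Bs = dim (ker_mat D)" "finite Bs"
    "cfun.independent ({j0, j1, j2, j3} \<union> h ` Bs)" "card ({j0, j1, j2, j3} \<union> h ` Bs) = 4 + card Bs"
    "cfun.span ({j0, j1, j2, j3} \<union> h ` Bs) = ker_pow op 3"
proof -
  obtain Bs where Bs: "Bs \<subseteq> ker_mat D" "independent Bs" "ker_mat D \<subseteq> span Bs" "card Bs = dim (ker_mat D)"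
    by (rule basis_exists)
  have fin: "finite Bs" using Bs(2) independent_imp_finite by blast
  \<comment> \<open>the entries of a vector in the kernel of \<open>D\<close> are the coefficients of \<open>pk\<close>, \<open>pE\<close>, \<open>pw\<close> and
    \<open>- 1 / 2\<close> times that of \<open>ps\<close>\<close>
  define \<Psi> where "\<Psi> c = cmb 0 0 (c 2) (c 1) (c 3) (- 2 * c 4)" for c :: "4 \<Rightarrow> complex"
  have rows: "- hk * b $ 1 - hE * b $ 2 - hw * b $ 3 + T * b $ 4 = 0" "Tk * b $ 1 + TE * b $ 2 + Tw * b $ 3 = 0"
    "Mk * b $ 1 + ME * b $ 2 + Mw * b $ 3 = 0" "T * b $ 1 - M * b $ 4 = 0" if "b \<in> Bs" for b
  proof -
    have "D *v b = 0" using Bs(1) that by (auto simp: ker_mat_def)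
    then show "- hk * b $ 1 - hE * b $ 2 - hw * b $ 3 + T * b $ 4 = 0" "Tk * b $ 1 + TE * b $ 2 + Tw * b $ 3 = 0"
      "Mk * b $ 1 + ME * b $ 2 + Mw * b $ 3 = 0" "T * b $ 1 - M * b $ 4 = 0"
      by (auto simp: D vec_eq_iff forall_4 matrix_vector_mult_def sum_4 algebra_simps add_divide_distrib[symmetric])
  qed
  have crows: "of_real (b $ 2) * complex_of_real hE + of_real (b $ 1) * of_real hk + of_real (b $ 3) * of_real hw
        + (- 2 * of_real (b $ 4)) * of_real (T / 2) = 0"
    "of_real (b $ 2) * complex_of_real TE + of_real (b $ 1) * of_real Tk + of_real (b $ 3) * of_real Tw = 0"
    "of_real (b $ 2) * complex_of_real ME + of_real (b $ 1) * of_real Mk + of_real (b $ 3) * of_real Mw = 0"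
    "of_real (b $ 1) * complex_of_real T + (- 2 * of_real (b $ 4)) * of_real (M / 2) = 0" if "b \<in> Bs" for b
  proof -
    have "complex_of_real (- (- hk * b $ 1 - hE * b $ 2 - hw * b $ 3 + T * b $ 4)) = 0"
      "complex_of_real (Tk * b $ 1 + TE * b $ 2 + Tw * b $ 3) = 0"
      "complex_of_real (Mk * b $ 1 + ME * b $ 2 + Mw * b $ 3) = 0" "complex_of_real (T * b $ 1 - M * b $ 4) = 0"
      unfolding rows[OF that] by simp_all
    then show "of_real (b $ 2) * complex_of_real hE + of_real (b $ 1) * of_real hk + of_real (b $ 3) * of_real hw
        + (- 2 * of_real (b $ 4)) * of_real (T / 2) = 0"
      "of_real (b $ 2) * complex_of_real TE + of_real (b $ 1) * of_real Tk + of_real (b $ 3) * of_real Tw = 0"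
      "of_real (b $ 2) * complex_of_real ME + of_real (b $ 1) * of_real Mk + of_real (b $ 3) * of_real Mw = 0"
      "of_real (b $ 1) * complex_of_real T + (- 2 * of_real (b $ 4)) * of_real (M / 2) = 0"
      by (simp_all add: algebra_simps)
  qed
  have "\<exists>u. csol u (\<Psi> (\<lambda>j. of_real (b $ j)))" if "b \<in> Bs" for b
    unfolding \<Psi>_def using solvable_iff[OF \<sigma>0 crows(1,2)[OF that], of 0 0] crows(3,4)[OF that] by blast
  then obtain h where h: "\<And>b. b \<in> Bs \<Longrightarrow> csol (h b) (\<Psi> (\<lambda>j. of_real (b $ j)))" by metis
  have sum\<Psi>: "(\<Sum>b\<in>Bs. (\<lambda>y. \<gamma> b *s \<Psi> (\<lambda>j. of_real (b $ j)) y)) = \<Psi> (comb Bs \<gamma>)" for \<gamma>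
    unfolding \<Psi>_def cmb_fun_smult cmb_fun_sum by (simp add: sum_distrib_left sum_negf mult_ac)
  have hsum: "csol (\<Sum>b\<in>Bs. (\<lambda>y. \<gamma> b *s h b y)) (\<Psi> (comb Bs \<gamma>))" for \<gamma>
    unfolding sum\<Psi>[symmetric] by (intro csol_sum csol_smult h)
  have ker2: "\<exists>c0 c2. csol w (cmb c0 c2 0 0 0 0)" if "w \<in> ker_pow op 2" for w
    using that ker_pow_Suc[of 0] ker_pow_1_nondegenerate[OF \<sigma>0] by (auto simp: numeral_2_eq_2)
  have ker2I: "w \<in> ker_pow op 2" if "csol w (cmb c0 c2 0 0 0 0)" for w c0 c2
    using that ker_pow_Suc[of 0] ker_pow_1_nondegenerate[OF \<sigma>0] by (auto simp: numeral_2_eq_2)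
  have indep: "\<forall>b\<in>Bs. \<gamma> b = 0"
    if "w \<in> cfun.span {j0, j1, j2, j3}" "w + (\<Sum>b\<in>Bs. (\<lambda>y. \<gamma> b *s h b y)) = 0" for w \<gamma>
  proof -
    have "w \<in> ker_pow op 2" using that(1) basis_j(4)[OF \<sigma>0] by simp
    then obtain c0 c2 where w: "csol w (cmb c0 c2 0 0 0 0)" using ker2 by blast
    \<comment> \<open>Applying the operator to the relation replaces each chosen preimage by its
      explicit combination, where independence of the basic functions is available.\<close>
    have "csol 0 (cmb c0 c2 0 0 0 0 + \<Psi> (comb Bs \<gamma>))"
      using csol_add[OF w hsum[of \<gamma>]] unfolding that(2) .
    then have "cmb c0 c2 0 0 0 0 + \<Psi> (comb Bs \<gamma>) = 0"
      using csol_functional csol_0 by blast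
    from cmb_fun_eq_0[OF this[unfolded \<Psi>_def cmb_fun_add]]
    have "\<forall>j. (comb Bs \<gamma> j) = 0" by (simp add: forall_4)
    then show ?thesis using complex_independent[OF Bs(2) fin] by blast
  qed
  have finW: "finite {j0, j1, j2, j3}" by simp
  have E: "cfun.independent ({j0, j1, j2, j3} \<union> h ` Bs)"
    "card ({j0, j1, j2, j3} \<union> h ` Bs) = card {j0, j1, j2, j3} + card Bs"
    "cfun.span ({j0, j1, j2, j3} \<union> h ` Bs) =
      {w + (\<Sum>b\<in>Bs. (\<lambda>y. \<gamma> b *s h b y)) | w \<gamma>. w \<in> cfun.span {j0, j1, j2, j3}}"
    by (rule cfun_extension[OF fin finW basis_j(1)[OF \<sigma>0] indep]; assumption)+
  have "cfun.span ({j0, j1, j2, j3} \<union> h ` Bs) = ker_pow op 3"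
  proof (intro equalityI subsetI)
    have k3: "ker_pow op 3 = {u. \<exists>w \<in> ker_pow op 2. csol u w}"
      using ker_pow_Suc[of 1] by (simp add: numeral_2_eq_2 numeral_3_eq_3)
    {
      fix x assume "x \<in> cfun.span ({j0, j1, j2, j3} \<union> h ` Bs)"
      then obtain w \<gamma> where x: "x = w + (\<Sum>b\<in>Bs. (\<lambda>y. \<gamma> b *s h b y))" "w \<in> ker_pow op 2"
        unfolding E(3) basis_j(4)[OF \<sigma>0] by blast
      obtain c0 c2 where w: "csol w (cmb c0 c2 0 0 0 0)" using ker2 x(2) by blast
      have "csol x (cmb c0 c2 0 0 0 0 + \<Psi> (comb Bs \<gamma>))"
        unfolding x(1) by (rule csol_add[OF w hsum])
      moreover have "csol (cmb c0 c2 0 0 0 0 + \<Psi> (comb Bs \<gamma>))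
          (cmb (comb Bs \<gamma> 3) (- 2 * (comb Bs \<gamma> 4)) 0 0 0 0)"
      proof -
        have 1: "(comb Bs \<gamma> 2) * complex_of_real hE + (comb Bs \<gamma> 1) * of_real hk
            + (comb Bs \<gamma> 3) * of_real hw
            + (- 2 * (comb Bs \<gamma> 4)) * of_real (T / 2) =
           (\<Sum>b\<in>Bs. \<gamma> b * (of_real (b $ 2) * complex_of_real hE + of_real (b $ 1) * of_real hk + of_real (b $ 3) * of_real hw
        + (- 2 * of_real (b $ 4)) * of_real (T / 2)))"
          unfolding sum_distrib_right sum_distrib_left sum.distrib[symmetric]
          by (rule sum.cong) (simp_all add: algebra_simps)
        have 2: "(comb Bs \<gamma> 2) * complex_of_real TE + (comb Bs \<gamma> 1) * of_real Tk
            + (comb Bs \<gamma> 3) * of_real Tw =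
           (\<Sum>b\<in>Bs. \<gamma> b * (of_real (b $ 2) * complex_of_real TE + of_real (b $ 1) * of_real Tk + of_real (b $ 3) * of_real Tw))"
          unfolding sum_distrib_right sum_distrib_left sum.distrib[symmetric]
          by (rule sum.cong) (simp_all add: algebra_simps)
        show ?thesis unfolding \<Psi>_def cmb_fun_add add_0_left add_0_right
          by (rule csol_cmb; unfold 1 2) (simp_all only: crows mult_zero_right sum.neutral_const cong: sum.cong)
      qed
      ultimately have "csol x (cmb c0 c2 0 0 0 0 + \<Psi> (comb Bs \<gamma>))"
        "cmb c0 c2 0 0 0 0 + \<Psi> (comb Bs \<gamma>) \<in> ker_pow op 2"
        using ker2I by blast+
      then show "x \<in> ker_pow op 3" unfolding k3 by blast
    }
    fix x assume "x \<in> ker_pow op 3"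
    then obtain w where w: "csol x w" "w \<in> ker_pow op 2" unfolding k3 by blast
    then obtain c0 c2 cE ck cw cs where wc: "w = cmb c0 c2 cE ck cw cs"
      and r: "rh cE ck cw cs = 0"
        "rT cE ck cw = 0"
      unfolding ker_pow_2_iff[OF \<sigma>0] by blast
    have r': "rM cE ck cw = 0"
      "rD ck cs = 0"
      using solvable_iff[OF \<sigma>0 r, of c0 c2] w(1) wc by blast+
    \<comment> \<open>The inverse of the coordinates used in \<open>\<Psi>\<close>; the rows of
      \<open>D\<close> applied to \<open>c\<close> are \<open>- rh\<close>, \<open>rT\<close>,
      \<open>- rM / 2\<close> and \<open>rD\<close>.\<close>
    define c :: "4 \<Rightarrow> complex" where "c j = (if j = 1 then ck else if j = 2 then cE else if j = 3 then cw else - cs / 2)" for j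
    have c: "c 1 = ck" "c 2 = cE" "c 3 = cw" "c 4 = - cs / 2" by (simp_all add: c_def)
    have "\<forall>i. (\<Sum>j\<in>UNIV. of_real (D $ i $ j) * c j) = 0"
    proof -
      have "(\<Sum>j\<in>UNIV. of_real (D $ 1 $ j) * c j) =
          - (rh cE ck cw cs)"
        "(\<Sum>j\<in>UNIV. of_real (D $ 2 $ j) * c j) = rT cE ck cw"
        "(\<Sum>j\<in>UNIV. of_real (D $ 3 $ j) * c j) = - (rM cE ck cw) / 2"
        "(\<Sum>j\<in>UNIV. of_real (D $ 4 $ j) * c j) = rD ck cs"
        unfolding D by (simp_all add: sum_4 c algebra_simps add_divide_distrib)
      then show ?thesis unfolding forall_4 r r' by simp
    qed
    then obtain \<gamma> where \<gamma>: "\<And>j. c j = (comb Bs \<gamma> j)"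
      using complex_kernel[OF Bs(2,3) fin, of c] by blast
    have "w = cmb c0 c2 0 0 0 0 + \<Psi> c" unfolding \<Psi>_def c wc cmb_fun_add by simp
    moreover have "csol (\<Sum>b\<in>Bs. (\<lambda>y. \<gamma> b *s h b y)) (\<Psi> c)"
      using hsum[of \<gamma>] by (simp add: \<gamma>[symmetric] cong: if_cong)
    ultimately have "csol (x - (\<Sum>b\<in>Bs. (\<lambda>y. \<gamma> b *s h b y))) (cmb c0 c2 0 0 0 0)"
      using csol_diff[OF w(1)] by fastforce
    then have "x - (\<Sum>b\<in>Bs. (\<lambda>y. \<gamma> b *s h b y)) \<in> cfun.span {j0, j1, j2, j3}"
      using ker2I basis_j(4)[OF \<sigma>0] by simp
    moreover have "x = (x - (\<Sum>b\<in>Bs. (\<lambda>y. \<gamma> b *s h b y))) + (\<Sum>b\<in>Bs. (\<lambda>y. \<gamma> b *s h b y))" by simp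
    ultimately show "x \<in> cfun.span ({j0, j1, j2, j3} \<union> h ` Bs)"
      unfolding E(3) by blast
  qed
  then show ?thesis
    using that[OF Bs(1,2,4) fin E(1)] E(2) basis_j(2)[OF \<sigma>0] by simp
qed

lemma nondegenerate_kernels:
  fixes D :: "real^4^4"
  assumes \<sigma>0: "\<sigma> \<noteq> 0"
    and D: "D = vector [vector [- hk, - hE, - hw, T], vector [Tk, TE, Tw, 0],
      vector [- Mk / 2, - ME / 2, - Mw / 2, 0], vector [T, 0, 0, - M]]"
  shows "int (cfun.dim (ker_pow op 3)) - int (cfun.dim (ker_pow op 2)) = int (dim (ker_mat D))"
    "det D \<noteq> 0 \<Longrightarrow> gen_kernel op = cfun.span {j0, j1, j2, j3}"
    "det D \<noteq> 0 \<Longrightarrow> jordan_chain op us \<Longrightarrow> length us \<le> 2"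
proof -
  obtain Bs h where Bs: "Bs \<subseteq> ker_mat D" "independent Bs" "card Bs = dim (ker_mat D)" "finite Bs"
    "cfun.independent ({j0, j1, j2, j3} \<union> h ` Bs)" "card ({j0, j1, j2, j3} \<union> h ` Bs) = 4 + card Bs"
    "cfun.span ({j0, j1, j2, j3} \<union> h ` Bs) = ker_pow op 3"
    by (rule ker_pow_3_span[OF \<sigma>0 D])
  have "cfun.dim (ker_pow op 3) = card ({j0, j1, j2, j3} \<union> h ` Bs)"
    unfolding Bs(7)[symmetric] cfun.dim_span by (rule cfun.dim_eq_card_independent[OF Bs(5)])
  moreover have "cfun.dim (ker_pow op 2) = card {j0, j1, j2, j3}"
    unfolding basis_j(4)[OF \<sigma>0, symmetric] cfun.dim_span
    by (rule cfun.dim_eq_card_independent[OF basis_j(1)[OF \<sigma>0]])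
  ultimately show "int (cfun.dim (ker_pow op 3)) - int (cfun.dim (ker_pow op 2)) = int (dim (ker_mat D))"
    using Bs(3,6) basis_j(2)[OF \<sigma>0] by simp
  assume det: "det D \<noteq> 0"
  have "Bs = {}"
  proof -
    have "b = 0" if "b \<in> Bs" for b
    proof -
      have "D *v b = 0" using Bs(1) that by (auto simp: ker_mat_def)
      moreover have "invertible D" using det by (simp add: invertible_det_nz)
      ultimately show ?thesis by (metis invertible_def matrix_left_invertible_ker)
    qed
    then show ?thesis using Bs(2) dependent_zero by (metis all_not_in_conv)
  qed
  then have k32: "ker_pow op 3 = ker_pow op 2" using Bs(7) basis_j(4)[OF \<sigma>0] by simp
  \<comment> \<open>Each kernel determines the next one, so equality of the second and the third
    propagates to all higher powers.\<close>
  have kS: "ker_pow op (Suc (Suc k)) = ker_pow op 2" for k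
  proof (induction k)
    case (Suc k)
    have "ker_pow op (Suc (Suc (Suc k))) = {u. \<exists>w \<in> ker_pow op 2. csol u w}"
      using ker_pow_Suc[of "Suc k"] Suc by simp
    also have "\<dots> = ker_pow op 3"
      using ker_pow_Suc[of 1] by (simp add: numeral_2_eq_2 numeral_3_eq_3)
    finally show ?case using k32 by simp
  qed (simp add: numeral_2_eq_2)
  show "gen_kernel op = cfun.span {j0, j1, j2, j3}"
    unfolding basis_j(4)[OF \<sigma>0] gen_kernel_def
  proof (intro equalityI UN_least)
    fix k
    have "ker_pow op 1 \<subseteq> ker_pow op 2" using ker_pow_mono[of 0] by (simp add: numeral_2_eq_2)
    moreover have "ker_pow op 0 \<subseteq> ker_pow op 1" unfolding ker_pow_1 using csol_0 by (auto simp: ker_pow_def)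
    ultimately show "ker_pow op k \<subseteq> ker_pow op 2"
      using kS by (cases k rule: nat.exhaust[case_product nat.exhaust[of "k - 1"]]) (auto simp: gr0_conv_Suc)
  qed blast
  \<comment> \<open>The third member of a longer chain would be in the third kernel, hence in the
    second; two applications of the operator then give 0, but they also give the
    eigenvector.\<close>
  show "length us \<le> 2" if chain: "jordan_chain op us"
  proof (rule ccontr)
    assume "\<not> length us \<le> 2"
    then have l: "Suc 0 < length us" "Suc 1 < length us" by auto
    have c: "us ! 0 \<noteq> 0" "(us ! 0, 0) \<in> op" "(us ! 1, us ! 0) \<in> op" "(us ! 2, us ! 1) \<in> op"
      using chain l unfolding jordan_chain_def by (auto simp: numeral_2_eq_2)
    have cs: "csol (us ! 0) 0" "csol (us ! 1) (us ! 0)" "csol (us ! 2) (us ! 1)"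
      using ker_pow_1 c(2) op_csol[OF c(3)] op_domain[OF c(2)] op_csol[OF c(4)] op_domain[OF c(3)]
      by (auto simp: ker_pow_def)
    have k2: "ker_pow op 2 = {u. \<exists>w \<in> ker_pow op 1. csol u w}"
      using ker_pow_Suc[of 0] by (simp add: numeral_2_eq_2)
    have k3: "ker_pow op 3 = {u. \<exists>w \<in> ker_pow op 2. csol u w}"
      using ker_pow_Suc[of 1] by (simp add: numeral_2_eq_2 numeral_3_eq_3)
    have "us ! 2 \<in> ker_pow op 3" unfolding k3 k2 ker_pow_1 using cs by blast
    then obtain w where w: "csol w 0" "csol (us ! 2) w" unfolding k32 k2 ker_pow_1 by blast
    then have "w = us ! 1" using csol_functional cs(3) by blast
    then have "us ! 0 = 0" using csol_functional w(1) cs(2) by blast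
    then show False using c(1) by contradiction
  qed
qed

end

subsection \<open>The linearization about a wave\<close>

lemma has_vector_derivative_cvec:
  assumes "(r has_real_derivative r') (at y)" "(i has_real_derivative i') (at y)"
  shows "((\<lambda>y. cvec (r y) (i y)) has_vector_derivative cvec r' i') (at y)"
  using assms unfolding has_vector_derivative_vec_2 cvec_def vector_2
  by (auto intro!: has_vector_derivative_of_real simp: has_real_derivative_iff_has_vector_derivative)

lemma smult_cvec: "of_real c *s cvec a b = cvec (c * a) (c * b)"
  by (simp add: cvec_def vec_eq_2)

lemma add_cvec: "cvec a b + cvec c d = cvec (a + c) (b + d)"
  by (simp add: cvec_def vec_eq_2)

lemma diff_cvec: "cvec a b - cvec c d = cvec (a - c) (b - d)"
  by (simp add: cvec_def vec_eq_2)

lemma symp_cvec: "symp (cvec a b) (cvec c d) = of_real (b * c - a * d)"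
  by (simp add: symp_def cvec_def)

lemma has_integral_of_real:
  "(g has_integral I) X \<Longrightarrow> ((\<lambda>y. complex_of_real (g y)) has_integral of_real I) X"
  for g :: "real \<Rightarrow> real"
  using has_integral_linear[OF _ bounded_linear_of_real, of g I X] by (simp add: comp_def)

lemma has_integral_antiderivative:
  assumes "\<And>y. (H has_real_derivative h y) (at y)" "a \<le> b"
  shows "(h has_integral (H b - H a)) {a..b}"
  by (rule fundamental_theorem_of_calculus)
     (use assms in \<open>auto simp: has_real_derivative_iff_has_vector_derivative[symmetric] intro: has_field_derivative_at_within\<close>)

context periodic_operator
begin

lemma sol_cvec:
  assumes "\<And>y. (r has_real_derivative r1 y) (at y)" "\<And>y. (i has_real_derivative i1 y) (at y)"
    "\<And>y. (r1 has_real_derivative (V y - Q y) * r y + \<beta> y * i y + 2 * \<alpha> y * i1 y - v2 y) (at y)"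
    "\<And>y. (i1 has_real_derivative V y * i y - \<beta> y * r y - 2 * \<alpha> y * r1 y + v1 y) (at y)"
  shows "sol (\<lambda>y. cvec (v1 y) (v2 y)) (\<lambda>y. cvec (r y) (i y)) (\<lambda>y. cvec (r1 y) (i1 y))"
proof -
  have "acc y (cvec (r y) (i y)) (cvec (r1 y) (i1 y)) + rot (cvec (v1 y) (v2 y)) =
      cvec ((V y - Q y) * r y + \<beta> y * i y + 2 * \<alpha> y * i1 y - v2 y) (V y * i y - \<beta> y * r y - 2 * \<alpha> y * r1 y + v1 y)" for y
    by (simp add: acc_def rot_def cvec_def vec_eq_2)
  then show ?thesis unfolding sol_def using assms by (auto intro!: has_vector_derivative_cvec)
qed

lemma conc_cvec: "conc y (cvec a b) (cvec a' b') (cvec c d) (cvec c' d') =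
    of_real (c * a' - a * c' + d * b' - b * d' + 2 * \<alpha> y * (a * d - b * c))"
  by (simp add: conc_def cvec_def)

lemma left_mult_csol: "csol w v \<Longrightarrow> left_mult T (\<lambda>y. w y v* Jmat) op (\<lambda>y. - (v y v* Jmat))"
  unfolding csol_def using left_mult_op by blast

end

context wave
begin

definition "\<alpha> y = \<kappa> / (A y)\<^sup>2"
definition "\<beta> y = - (2 * \<kappa> * B y / (A y) ^ 3)"
definition "V y = - \<omega> + (\<alpha> y)\<^sup>2 - \<zeta> * f ((A y)\<^sup>2)"
definition "Q y = 2 * \<zeta> * f1 ((A y)\<^sup>2) * (A y)\<^sup>2"

lemma A_nonzero: "A y \<noteq> 0" using A_pos[of y] by simp

lemma d_divide_A: "((\<lambda>y. c / (A y) ^ n) has_real_derivative - (real n * c / (A y) ^ Suc n) * B y) (at y)"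
  by (rule DERIV_chain2[OF DERIV_const_divide_power[OF A_nonzero] dA])

lemma d\<alpha>: "(\<alpha> has_real_derivative \<beta> y) (at y)"
  unfolding \<alpha>_def[abs_def] using d_divide_A[of \<kappa> 2 y] by (simp add: \<beta>_def numeral_3_eq_3 numeral_2_eq_2)

lemma deriv_S_eq: "deriv S = \<alpha>" by (simp add: deriv_S \<alpha>_def fun_eq_iff)

lemma deriv_deriv_S: "deriv (deriv S) = \<beta>"
  unfolding deriv_S_eq using DERIV_imp_deriv[OF d\<alpha>] by auto

lemma compose_A_continuous:
  assumes "\<And>x. x > 0 \<Longrightarrow> isCont g x" shows "continuous_on UNIV (\<lambda>y. g ((A y)\<^sup>2))"
proof -
  have "isCont (\<lambda>y. (A y)\<^sup>2) y" for y using DERIV_isCont[OF dA] by (intro continuous_intros)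
  then show ?thesis using assms A_nonzero
    by (intro continuous_at_imp_continuous_on ballI isCont_o2[where g = g and f = "\<lambda>y. (A y)\<^sup>2"]) auto
qed

sublocale lin: periodic_operator T \<alpha> \<beta> V Q
proof
  have ca: "continuous_on UNIV \<alpha>"
    using d\<alpha> DERIV_isCont continuous_at_imp_continuous_on by metis
  show "continuous_on UNIV \<beta>"
    unfolding \<beta>_def[abs_def] by (intro continuous_intros continuous_A continuous_B) (simp add: A_nonzero)
  show "continuous_on UNIV V" "continuous_on UNIV Q"
    unfolding V_def[abs_def] Q_def[abs_def]
    by (intro continuous_intros continuous_A ca compose_A_continuous DERIV_isCont[OF f] DERIV_isCont[OF f1]; simp)+
  show "T > 0" by (rule T_pos)
  show "(\<alpha> has_real_derivative \<beta> y) (at y)" for y by (rule d\<alpha>)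
qed (simp_all add: \<alpha>_def \<beta>_def V_def Q_def A_periodic B_periodic)

lemma lin_op_eq: "lin_op f T \<omega> \<zeta> A S = lin.op"
proof -
  have "deriv f ((A y)\<^sup>2) = f1 ((A y)\<^sup>2)" for y
    by (rule DERIV_imp_deriv[OF f]) (simp add: A_nonzero)
  then have "vector [K_op S y (u $ 1) (u' $ 1) - Lminus_op f \<omega> \<zeta> A S y (u $ 2) (u'' $ 2),
           Lplus_op f \<omega> \<zeta> A S y (u $ 1) (u'' $ 1) + K_op S y (u $ 2) (u' $ 2)] = lin.Lval y u u' u''"
    for y u u' u''
    by (simp add: vec_eq_2 lin.Lval_def K_op_def Lminus_op_def Lplus_op_def deriv_deriv_S)
       (simp add: deriv_S_eq V_def Q_def algebra_simps)
  then show ?thesis unfolding lin_op_def lin.op_def by simp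
qed

section \<open>The symmetry modes of the wave\<close>

lemma G_A: "G (A y) = V y * A y"
  using A_nonzero[of y]
  by (simp add: G_def V_def \<alpha>_def field_simps power2_eq_square power3_eq_cube power_divide)

text \<open>Eliminating the phase turns the centrifugal term into
  \<open>\<kappa>\<^sup>2 / A ^ 3\<close>, with derivative
  \<open>- 3 * \<kappa>\<^sup>2 / A ^ 4\<close>, whereas \<open>V\<close> contains
  \<open>+ \<kappa>\<^sup>2 / A ^ 4\<close>. In the operator the difference is supplied by the
  coupling to the phase component.\<close>

lemma G'_A: "G' (A y) = V y - Q y - 4 * \<kappa>\<^sup>2 / (A y) ^ 4"
  using A_nonzero[of y]
  by (simp add: G'_def V_def Q_def \<alpha>_def power_divide algebra_simps)

definition "p0 y = cvec 0 (A y)"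
definition "p0' y = cvec 0 (B y)"
definition "p2 y = cvec (B y) (A y * \<alpha> y)"
definition "p2' y = cvec (G (A y)) (- (\<kappa> * B y / (A y)\<^sup>2))"
definition "ps y = cvec 0 (y * A y / 2)"
definition "ps' y = cvec 0 ((A y + y * B y) / 2)"

lemma sol_p0: "lin.sol (\<lambda>y. 0) p0 p0'"
proof -
  have "lin.sol (\<lambda>y. cvec 0 0) (\<lambda>y. cvec 0 (A y)) (\<lambda>y. cvec 0 (B y))"
  proof (rule lin.sol_cvec)
    fix y
    have "(V y - Q y) * 0 + \<beta> y * A y + 2 * \<alpha> y * B y - 0 = 0"
      using A_nonzero[of y] by (simp add: \<alpha>_def \<beta>_def field_simps power2_eq_square power3_eq_cube)
    then show "((\<lambda>y. 0) has_real_derivative (V y - Q y) * 0 + \<beta> y * A y + 2 * \<alpha> y * B y - 0) (at y)" by simp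
    show "(B has_real_derivative V y * A y - \<beta> y * 0 - 2 * \<alpha> y * 0 + 0) (at y)"
      using dB[of y] by (simp add: G_A)
  qed (auto intro: dA)
  moreover have "cvec 0 0 = 0" by (simp add: cvec_def vec_eq_2)
  ultimately show ?thesis by (simp add: p0_def[abs_def] p0'_def[abs_def])
qed

lemma A_\<alpha>: "A y * \<alpha> y = \<kappa> / A y"
  using A_nonzero[of y] by (simp add: \<alpha>_def power2_eq_square)

lemma sol_p2: "lin.sol (\<lambda>y. 0) p2 p2'"
proof -
  have "lin.sol (\<lambda>y. cvec 0 0) (\<lambda>y. cvec (B y) (\<kappa> / A y)) (\<lambda>y. cvec (G (A y)) (- (\<kappa> * B y / (A y)\<^sup>2)))"
  proof (rule lin.sol_cvec)
    fix y
    note nz = A_nonzero[of y]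
    show "(B has_real_derivative G (A y)) (at y)" by (rule dB)
    show "((\<lambda>y. \<kappa> / A y) has_real_derivative - (\<kappa> * B y / (A y)\<^sup>2)) (at y)"
      using d_divide_A[of \<kappa> 1 y] by (simp add: numeral_2_eq_2)
    have "G' (A y) * B y = (V y - Q y) * B y + \<beta> y * (\<kappa> / A y) + 2 * \<alpha> y * - (\<kappa> * B y / (A y)\<^sup>2) - 0"
      using nz unfolding G'_A \<alpha>_def \<beta>_def by (simp add: field_simps eval_nat_numeral)
    then show "((\<lambda>y. G (A y)) has_real_derivative
        (V y - Q y) * B y + \<beta> y * (\<kappa> / A y) + 2 * \<alpha> y * - (\<kappa> * B y / (A y)\<^sup>2) - 0) (at y)"
      using DERIV_chain2[OF dG[OF A_pos] dA, of y] by simp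
    have "((\<lambda>y. - (B y * (\<kappa> / (A y)\<^sup>2))) has_real_derivative
        - (G (A y) * (\<kappa> / (A y)\<^sup>2) + - (real 2 * \<kappa> / (A y) ^ Suc 2) * B y * B y)) (at y)"
      by (intro DERIV_minus DERIV_mult dB d_divide_A)
    moreover have "- (G (A y) * (\<kappa> / (A y)\<^sup>2) + - (real 2 * \<kappa> / (A y) ^ Suc 2) * B y * B y) =
        V y * (\<kappa> / A y) - \<beta> y * B y - 2 * \<alpha> y * G (A y) + 0"
      using nz unfolding G_A \<alpha>_def \<beta>_def by (simp add: field_simps eval_nat_numeral)
    ultimately show "((\<lambda>y. - (\<kappa> * B y / (A y)\<^sup>2)) has_real_derivative
        V y * (\<kappa> / A y) - \<beta> y * B y - 2 * \<alpha> y * G (A y) + 0) (at y)" by (simp add: mult.commute)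
  qed
  moreover have "cvec 0 0 = 0" by (simp add: cvec_def vec_eq_2)
  ultimately show ?thesis by (simp add: p2_def[abs_def] p2'_def[abs_def] A_\<alpha>)
qed

text \<open>The generator of Galilean boosts. The operator annihilates \<open>p0 = (0, A)\<close>,
  so on \<open>y / 2\<close> times it only the commutator terms \<open>A_y\<close> and
  \<open>A S_y\<close> survive.\<close>

lemma sol_ps: "lin.sol p2 ps ps'"
  unfolding p2_def[abs_def] ps_def[abs_def] ps'_def[abs_def]
proof (rule lin.sol_cvec)
  fix y
  note nz = A_nonzero[of y]
  show "((\<lambda>y. y * A y / 2) has_real_derivative (A y + y * B y) / 2) (at y)"
    by (auto intro!: derivative_eq_intros dA simp: algebra_simps)
  have "(V y - Q y) * 0 + \<beta> y * (y * A y / 2) + 2 * \<alpha> y * ((A y + y * B y) / 2) - A y * \<alpha> y = 0"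
    using nz unfolding \<alpha>_def \<beta>_def by (simp add: field_simps eval_nat_numeral)
  then show "((\<lambda>y. 0) has_real_derivative
      (V y - Q y) * 0 + \<beta> y * (y * A y / 2) + 2 * \<alpha> y * ((A y + y * B y) / 2) - A y * \<alpha> y) (at y)" by simp
  have "((\<lambda>y. (A y + y * B y) / 2) has_real_derivative (B y + (1 * B y + G (A y) * y)) / 2) (at y)"
    by (intro DERIV_cdivide DERIV_add DERIV_mult dA dB DERIV_ident)
  then show "((\<lambda>y. (A y + y * B y) / 2) has_real_derivative V y * (y * A y / 2) - \<beta> y * 0 - 2 * \<alpha> y * 0 + B y) (at y)"
    by (rule back_subst[of "\<lambda>D. (_ has_real_derivative D) _"]) (simp add: G_A field_simps)
qed simp

lemma p_periodic: "p0 (y + T) = p0 y" "p2 (y + T) = p2 y"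
  "ps (y + T) = ps y + of_real (T / 2) *s p0 y"
  unfolding p0_def p2_def ps_def A_periodic B_periodic lin.per smult_cvec add_cvec
  by (simp_all add: field_simps)

lemma conc_p02: "lin.conc 0 (p0 0) (p0' 0) (p2 0) (p2' 0) = 0"
  unfolding p0_def p0'_def p2_def p2'_def lin.conc_cvec by (simp add: B_0)

lemma integral_p02: "((\<lambda>y. symp (p0 y) (p2 y)) has_integral 0) {0..T}"
proof -
  have "((\<lambda>y. (A y)\<^sup>2 / 2) has_real_derivative A y * B y) (at y)" for y
    by (auto intro!: derivative_eq_intros dA)
  from has_integral_of_real[OF has_integral_antiderivative[OF this, of 0 T]] T_pos
  show ?thesis unfolding p0_def p2_def symp_cvec by (simp add: A_T A_0)
qed

lemma integral_p0s: "((\<lambda>y. symp (p0 y) (ps y)) has_integral 0) {0..T}"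
  unfolding p0_def ps_def symp_cvec by simp

lemma integral_p2s:
  "((\<lambda>y. symp (p2 y) (ps y)) has_integral of_real ((2 * integral {a..b} (\<lambda>x. x\<^sup>2 / sqrt (R x)) - T * a\<^sup>2) / 4)) {0..T}"
proof -
  obtain m where m: "m 0 = 0" "\<And>y. (m has_real_derivative (A y)\<^sup>2) (at y)"
    using antiderivative_exists[of "\<lambda>y. (A y)\<^sup>2"] continuous_A[of UNIV]
    unfolding has_real_derivative_iff_has_vector_derivative by (auto intro!: continuous_intros)
  \<comment> \<open>Integration by parts: \<open>- y * A * B / 2\<close> is \<open>- y / 4\<close>
    times the derivative of \<open>A\<^sup>2\<close>.\<close>
  have "((\<lambda>y. m y / 4 - y * ((A y)\<^sup>2 / 4)) has_real_derivative A y * \<alpha> y * 0 - B y * (y * A y / 2)) (at y)" for y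
  proof -
    have "((\<lambda>y. m y / 4 - y * ((A y * A y) / 4)) has_real_derivative
        (A y)\<^sup>2 / 4 - (1 * ((A y * A y) / 4) + (B y * A y + B y * A y) / 4 * y)) (at y)"
      by (intro DERIV_diff DERIV_cdivide DERIV_mult DERIV_ident m(2) dA)
    then show ?thesis
      by (simp add: power2_eq_square) (erule back_subst[of "\<lambda>D. (_ has_real_derivative D) _"], simp add: field_simps)
  qed
  from has_integral_of_real[OF has_integral_antiderivative[OF this, of 0 T]] T_pos
  show ?thesis unfolding p2_def ps_def symp_cvec M_eq[OF m(2,1)]
    by (simp add: A_T m(1) diff_divide_distrib)
qed

end

text \<open>What the linear theory has to know about the derivative \<open>(z, \<xi>)\<close> of the
  wave in the direction \<open>(e, k, w)\<close>: its equations, its data at 0, its defect and its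
  pairing with the rotation mode. The family itself no longer occurs.\<close>

locale wave_tangent = wave +
  fixes e k w T' \<eta>' M' :: real and z z1 \<xi> :: "real \<Rightarrow> real"
  assumes dz: "\<And>y. (z has_real_derivative z1 y) (at y)"
    and dz1: "\<And>y. (z1 has_real_derivative G' (A y) * z y + (- w * A y + 2 * \<kappa> * k / (A y) ^ 3)) (at y)"
    and d\<xi>: "\<And>y. (\<xi> has_real_derivative k / (A y)\<^sup>2 - 2 * \<kappa> * z y / (A y) ^ 3) (at y)"
    and z1_0: "z1 0 = 0" and \<xi>_0: "\<xi> 0 = 0"
    and z_0: "2 * G a * z 0 + (2 * e - w * a\<^sup>2 - 2 * \<kappa> * k / a\<^sup>2) = 0"
    and z_shift: "\<And>y. z (y + T) = z y - T' * B y"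
    and \<xi>_shift: "\<And>y. \<xi> (y + T) = \<xi> y + \<eta>' - T' * (\<kappa> / (A y)\<^sup>2)"
    and mass: "((\<lambda>y. A y * z y) has_integral (M' - T' * a\<^sup>2) / 2) {0..T}"
begin

definition "\<phi> y = cvec (z y) (A y * \<xi> y)"
definition "\<phi>' y = cvec (z1 y) (B y * \<xi> y + (k / A y - 2 * \<kappa> * z y / (A y)\<^sup>2))"

text \<open>In the profile equations for \<open>(A, S)\<close> the numbers \<open>E\<close> and
  \<open>\<kappa>\<close> are constants of integration and only \<open>\<omega>\<close> is a
  coefficient; so differentiating them in a direction leaves the source
  \<open>w * p0\<close>.\<close>

lemma sol_\<phi>: "lin.sol (\<lambda>y. of_real w *s p0 y) \<phi> \<phi>'"
  unfolding p0_def[abs_def] \<phi>_def[abs_def] \<phi>'_def[abs_def] smult_cvec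
proof (rule lin.sol_cvec)
  fix y
  note nz = A_nonzero[of y]
  show "(z has_real_derivative z1 y) (at y)" by (rule dz)
  have "((\<lambda>y. A y * \<xi> y) has_real_derivative B y * \<xi> y + (k / (A y)\<^sup>2 - 2 * \<kappa> * z y / (A y) ^ 3) * A y) (at y)"
    by (intro DERIV_mult dA d\<xi>)
  then show "((\<lambda>y. A y * \<xi> y) has_real_derivative B y * \<xi> y + (k / A y - 2 * \<kappa> * z y / (A y)\<^sup>2)) (at y)"
    by (rule back_subst[of "\<lambda>D. (_ has_real_derivative D) _"])
       (use nz in \<open>simp add: field_simps eval_nat_numeral\<close>)
  show "(z1 has_real_derivative (V y - Q y) * z y + \<beta> y * (A y * \<xi> y) +
      2 * \<alpha> y * (B y * \<xi> y + (k / A y - 2 * \<kappa> * z y / (A y)\<^sup>2)) - w * A y) (at y)"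
    using dz1[of y]
    by (rule back_subst[of "\<lambda>D. (_ has_real_derivative D) _"])
       (use nz in \<open>simp add: G'_A \<alpha>_def \<beta>_def field_simps eval_nat_numeral\<close>)
  have "((\<lambda>y. B y * \<xi> y + (k / (A y) ^ 1 - z y * (2 * \<kappa> / (A y)\<^sup>2))) has_real_derivative
      (G (A y) * \<xi> y + (k / (A y)\<^sup>2 - 2 * \<kappa> * z y / (A y) ^ 3) * B y) + (- (real 1 * k / (A y) ^ Suc 1) * B y
       - (z1 y * (2 * \<kappa> / (A y)\<^sup>2) + - (real 2 * (2 * \<kappa>) / (A y) ^ Suc 2) * B y * z y))) (at y)"
    by (intro DERIV_add DERIV_mult DERIV_diff dB d\<xi> d_divide_A dz)
  moreover have "(\<lambda>y. B y * \<xi> y + (k / (A y) ^ 1 - z y * (2 * \<kappa> / (A y)\<^sup>2))) =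
      (\<lambda>y. B y * \<xi> y + (k / A y - 2 * \<kappa> * z y / (A y)\<^sup>2))" by (simp add: mult.commute)
  moreover have "(G (A y) * \<xi> y + (k / (A y)\<^sup>2 - 2 * \<kappa> * z y / (A y) ^ 3) * B y) + (- (real 1 * k / (A y) ^ Suc 1) * B y
       - (z1 y * (2 * \<kappa> / (A y)\<^sup>2) + - (real 2 * (2 * \<kappa>) / (A y) ^ Suc 2) * B y * z y)) =
      V y * (A y * \<xi> y) - \<beta> y * z y - 2 * \<alpha> y * z1 y + w * 0"
    using nz by (simp add: G_A \<alpha>_def \<beta>_def field_simps eval_nat_numeral)
  ultimately show "((\<lambda>y. B y * \<xi> y + (k / A y - 2 * \<kappa> * z y / (A y)\<^sup>2)) has_real_derivative
      V y * (A y * \<xi> y) - \<beta> y * z y - 2 * \<alpha> y * z1 y + w * 0) (at y)" by simp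
qed

lemma \<phi>_shift: "\<phi> (y + T) = \<phi> y - of_real T' *s p2 y + of_real \<eta>' *s p0 y"
  unfolding \<phi>_def p2_def p0_def z_shift \<xi>_shift A_periodic smult_cvec add_cvec diff_cvec \<alpha>_def
  by (simp add: algebra_simps)

lemma conc_p0: "lin.conc 0 (p0 0) (p0' 0) (\<phi> 0) (\<phi>' 0) = of_real (- k)"
  unfolding p0_def p0'_def \<phi>_def \<phi>'_def lin.conc_cvec using a_pos
  by (simp add: B_0 A_0 z1_0 \<xi>_0 \<alpha>_def field_simps power2_eq_square)

text \<open>At \<open>y = 0\<close> the form reduces to
  \<open>G a * z 0 - \<kappa> * k / a\<^sup>2\<close>, and the varied energy identity eliminates the
  unknown \<open>z 0\<close>.\<close>

lemma conc_p2: "lin.conc 0 (p2 0) (p2' 0) (\<phi> 0) (\<phi>' 0) = of_real (- e + w * a\<^sup>2 / 2)"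
proof -
  have "G a * z 0 = - e + w * a\<^sup>2 / 2 + \<kappa> * k / a\<^sup>2" using z_0 by (simp add: field_simps)
  moreover have "lin.conc 0 (p2 0) (p2' 0) (\<phi> 0) (\<phi>' 0) = of_real (G a * z 0 - \<kappa> * k / a\<^sup>2)"
    unfolding p2_def p2'_def \<phi>_def \<phi>'_def lin.conc_cvec A_\<alpha> using a_pos
    by (simp add: B_0 A_0 z1_0 \<xi>_0 \<alpha>_def field_simps eval_nat_numeral)
  ultimately show ?thesis by simp
qed

lemma integral_p0: "((\<lambda>y. symp (p0 y) (\<phi> y)) has_integral of_real ((M' - T' * a\<^sup>2) / 2)) {0..T}"
  using has_integral_of_real[OF mass] unfolding p0_def \<phi>_def symp_cvec by simp

lemma integral_p2:
  "((\<lambda>y. symp (p2 y) (\<phi> y)) has_integral of_real ((T * k + \<kappa> * T' - a\<^sup>2 * \<eta>') / 2)) {0..T}"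
proof -
  \<comment> \<open>The derivative of \<open>- A\<^sup>2 * \<xi> / 2\<close> contains both terms of
    the integrand; the constant \<open>k / 2\<close> that it leaves over is compensated by
    \<open>k * y / 2\<close>.\<close>
  have "((\<lambda>y. k * y / 2 - (A y)\<^sup>2 / 2 * \<xi> y) has_real_derivative A y * \<alpha> y * z y - B y * (A y * \<xi> y)) (at y)" for y
  proof -
    have "((\<lambda>y. k * y / 2 - (A y)\<^sup>2 / 2 * \<xi> y) has_real_derivative
        k / 2 - (A y * B y * \<xi> y + (k / (A y)\<^sup>2 - 2 * \<kappa> * z y / (A y) ^ 3) * ((A y)\<^sup>2 / 2))) (at y)"
    proof -
      have "((\<lambda>y. k * y / 2 - (A y * A y) / 2 * \<xi> y) has_real_derivative
        (k * 1) / 2 - ((B y * A y + B y * A y) / 2 * \<xi> y + (k / (A y)\<^sup>2 - 2 * \<kappa> * z y / (A y) ^ 3) * ((A y * A y) / 2))) (at y)"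
        by (intro DERIV_diff DERIV_cdivide DERIV_mult DERIV_cmult DERIV_ident d\<xi> dA)
      then show ?thesis by (simp add: power2_eq_square mult.commute)
    qed
    moreover have "k / 2 - (A y * B y * \<xi> y + (k / (A y)\<^sup>2 - 2 * \<kappa> * z y / (A y) ^ 3) * ((A y)\<^sup>2 / 2)) =
        A y * \<alpha> y * z y - B y * (A y * \<xi> y)"
      using A_nonzero[of y] unfolding \<alpha>_def by (simp add: field_simps eval_nat_numeral)
    ultimately show ?thesis by (rule back_subst[of "\<lambda>D. (_ has_real_derivative D) _"])
  qed
  from has_integral_of_real[OF has_integral_antiderivative[OF this, of 0 T]] T_pos
  have "((\<lambda>y. symp (p2 y) (\<phi> y)) has_integral of_real (k * T / 2 - a\<^sup>2 / 2 * \<xi> T)) {0..T}"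
    unfolding p2_def \<phi>_def symp_cvec by (simp add: A_T \<xi>_0)
  moreover have "k * T / 2 - a\<^sup>2 / 2 * \<xi> T = (T * k + \<kappa> * T' - a\<^sup>2 * \<eta>') / 2"
    using \<xi>_shift[of 0] a_pos by (simp add: \<xi>_0 A_0 field_simps)
  ultimately show ?thesis by (simp only:)
qed

end

context wave
begin

text \<open>Green's identity for two tangent solutions gives the symmetry of the second derivatives
  of the action without a second differentiation of the integral.\<close>

lemma tangent_reciprocity:
  assumes "wave_tangent f f1 f2 F E \<kappa> \<omega> \<zeta> a b T A B S e k w T1 h1 M1 z z1 \<xi>"
    and "wave_tangent f f1 f2 F E \<kappa> \<omega> \<zeta> a b T A B S e' k' w' T2 h2 M2 y y1 \<upsilon>"
  shows "w' * (M1 - T1 * a\<^sup>2) / 2 - w * (M2 - T2 * a\<^sup>2) / 2 =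
    T2 * (- e + w * a\<^sup>2 / 2) + h2 * k - T1 * (- e' + w' * a\<^sup>2 / 2) - h1 * k'"
proof -
  interpret t1: wave_tangent f f1 f2 F E \<kappa> \<omega> \<zeta> a b T A B S e k w T1 h1 M1 z z1 \<xi> by (rule assms)
  interpret t2: wave_tangent f f1 f2 F E \<kappa> \<omega> \<zeta> a b T A B S e' k' w' T2 h2 M2 y y1 \<upsilon> by (rule assms)
  let ?c = "\<lambda>x x' u u'. lin.conc 0 x x' u u'"
  \<comment> \<open>Uniqueness of derivatives carries the shift rule over to the
    \<open>y\<close>-derivative, so both arguments of the boundary form are known at
    \<open>T\<close> in terms of 0.\<close>
  have derivative_shift: "\<phi>' (y + T) = \<phi>' y - of_real T' *s p2' y + of_real \<eta>' *s p0' y"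
    if s: "lin.sol v \<phi> \<phi>'" and sh: "\<And>y. \<phi> (y + T) = \<phi> y - of_real T' *s p2 y + of_real \<eta>' *s p0 y"
    for v \<phi> \<phi>' T' \<eta>' y
  proof -
    have bl: "bounded_linear (\<lambda>x :: complex^2. c *s x)" for c
      by (rule linear_conv_bounded_linear[THEN iffD1], rule linearI) (auto simp: vec_eq_2 algebra_simps)
    have "((\<lambda>y. \<phi> (y + T)) has_vector_derivative \<phi>' (y + T)) (at y)"
      using lin.sol_shift[OF s] by (simp add: lin.sol_def)
    moreover have "((\<lambda>y. \<phi> (y + T)) has_vector_derivative \<phi>' y - of_real T' *s p2' y + of_real \<eta>' *s p0' y) (at y)"
      unfolding sh using s sol_p0 sol_p2
      by (intro has_vector_derivative_add has_vector_derivative_diff bounded_linear.has_vector_derivative[OF bl])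
         (simp_all add: lin.sol_def)
    ultimately show ?thesis by (rule vector_derivative_unique_at)
  qed
  have sh1: "t1.\<phi> T = t1.\<phi> 0 - of_real T1 *s p2 0 + of_real h1 *s p0 0"
    "t1.\<phi>' T = t1.\<phi>' 0 - of_real T1 *s p2' 0 + of_real h1 *s p0' 0"
    using t1.\<phi>_shift[of 0] derivative_shift[OF t1.sol_\<phi> t1.\<phi>_shift, of 0] by simp_all
  have sh2: "t2.\<phi> T = t2.\<phi> 0 - of_real T2 *s p2 0 + of_real h2 *s p0 0"
    "t2.\<phi>' T = t2.\<phi>' 0 - of_real T2 *s p2' 0 + of_real h2 *s p0' 0"
    using t2.\<phi>_shift[of 0] derivative_shift[OF t2.sol_\<phi> t2.\<phi>_shift, of 0] by simp_all
  have alin: "?c (x1 - c *s y1 + d *s z1) (x1' - c *s y1' + d *s z1') u u' =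
      ?c x1 x1' u u' - c * ?c y1 y1' u u' + d * ?c z1 z1' u u'"
    "?c u u' (x1 - c *s y1 + d *s z1) (x1' - c *s y1' + d *s z1') =
      ?c u u' x1 x1' - c * ?c u u' y1 y1' + d * ?c u u' z1 z1'"
    "?c x1 x1' x1 x1' = 0" for x1 x1' y1 y1' z1 z1' u u' c d
    by (simp_all add: lin.conc_def algebra_simps)
  have anti: "?c u u' x x' = - ?c x x' u u'" for u u' x x' by (simp add: lin.conc_def algebra_simps)
  have cT: "lin.conc T x x' u u' = ?c x x' u u'" for x x' u u'
    using lin.per(1)[of 0] by (simp add: lin.conc_def)
  have "lin.conc T (t1.\<phi> T) (t1.\<phi>' T) (t2.\<phi> T) (t2.\<phi>' T) - lin.conc 0 (t1.\<phi> 0) (t1.\<phi>' 0) (t2.\<phi> 0) (t2.\<phi>' 0)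
      = of_real (T2 * (- e + w * a\<^sup>2 / 2) + h2 * k - T1 * (- e' + w' * a\<^sup>2 / 2) - h1 * k')"
    unfolding cT sh1 sh2 alin
    unfolding anti[of "t1.\<phi> 0" "t1.\<phi>' 0" "p2 0"] anti[of "t1.\<phi> 0" "t1.\<phi>' 0" "p0 0"] anti[of "p2 0" "p2' 0" "p0 0"]
      conc_p02 t1.conc_p0 t1.conc_p2 t2.conc_p0 t2.conc_p2
    by (simp add: algebra_simps)
  with lin.green_sol[OF t2.sol_\<phi> t1.sol_\<phi>]
  have "((\<lambda>y. symp (t2.\<phi> y) (of_real w *s p0 y) - symp (t1.\<phi> y) (of_real w' *s p0 y)) has_integral
     of_real (T2 * (- e + w * a\<^sup>2 / 2) + h2 * k - T1 * (- e' + w' * a\<^sup>2 / 2) - h1 * k')) {0..T}" by simp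
  moreover have "((\<lambda>y. symp (t2.\<phi> y) (of_real w *s p0 y) - symp (t1.\<phi> y) (of_real w' *s p0 y)) has_integral
     of_real w' * of_real ((M1 - T1 * a\<^sup>2) / 2) - of_real w * of_real ((M2 - T2 * a\<^sup>2) / 2)) {0..T}"
  proof -
    have "(\<lambda>y. symp (t2.\<phi> y) (of_real w *s p0 y) - symp (t1.\<phi> y) (of_real w' *s p0 y)) =
        (\<lambda>y. of_real w' * symp (p0 y) (t1.\<phi> y) - of_real w * symp (p0 y) (t2.\<phi> y))"
      by (simp add: symp_def fun_eq_iff algebra_simps)
    then show ?thesis
      by (simp only:) (intro has_integral_diff has_integral_mult_right t1.integral_p0 t2.integral_p0)
  qed
  ultimately have "complex_of_real (T2 * (- e + w * a\<^sup>2 / 2) + h2 * k - T1 * (- e' + w' * a\<^sup>2 / 2) - h1 * k') =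
      of_real w' * of_real ((M1 - T1 * a\<^sup>2) / 2) - of_real w * of_real ((M2 - T2 * a\<^sup>2) / 2)"
    by (rule has_integral_unique)
  also have "\<dots> = of_real (w' * ((M1 - T1 * a\<^sup>2) / 2) - w * ((M2 - T2 * a\<^sup>2) / 2))" by simp
  finally show ?thesis unfolding of_real_eq_iff by simp
qed

end

lemma (in wave_line) tangent_exists:
  obtains T' \<eta>' M' z z1 \<xi> where
    "wave_tangent f f1 f2 F E \<kappa> \<omega> \<zeta> (am (E, \<kappa>, \<omega>, \<zeta>)) (ap (E, \<kappa>, \<omega>, \<zeta>)) (T (E, \<kappa>, \<omega>, \<zeta>))
       (A (E, \<kappa>, \<omega>, \<zeta>)) (deriv (A (E, \<kappa>, \<omega>, \<zeta>))) (S (E, \<kappa>, \<omega>, \<zeta>)) e k w T' \<eta>' M' z z1 \<xi>"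
    "((\<lambda>s. T (line s)) has_real_derivative T') (at 0)" "((\<lambda>s. \<eta> (line s)) has_real_derivative \<eta>') (at 0)"
    "((\<lambda>s. M (line s)) has_real_derivative M') (at 0)"
    "((\<lambda>s. K (line s)) has_real_derivative
       e * T (E, \<kappa>, \<omega>, \<zeta>) - w * M (E, \<kappa>, \<omega>, \<zeta>) / 2 - k * \<eta> (E, \<kappa>, \<omega>, \<zeta>)) (at 0)"
    "\<And>y. ((\<lambda>s. A (line s) y) has_real_derivative z y) (at 0)"
    "\<And>y. ((\<lambda>s. S (line s) y) has_real_derivative \<xi> y) (at 0)"
proof -
  obtain z z1 where z: "udiff As z" "udiff Bs z1" "\<And>y. (z has_real_derivative z1 y) (at y)"
    "\<And>y. (z1 has_real_derivative base.G' (As 0 y) * z y + g1 (As 0 y)) (at y)" "z1 0 = 0"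
    by (rule linearized_solution) blast
  interpret v: wave_variation f f1 f2 F U am ap T \<eta> M K A S E \<kappa> \<omega> \<zeta> e k w z z1
    by unfold_locales (rule z)+
  obtain M' where M': "(Ms has_real_derivative M') (at 0)"
    "((\<lambda>y. As 0 y * z y) has_integral (M' - v.T' * (lo 0)\<^sup>2) / 2) {0..Ts 0}"
    by (rule v.mass_variation)
  obtain \<eta>' \<xi> where \<xi>: "(\<eta>s has_real_derivative \<eta>') (at 0)" "\<xi> 0 = 0"
    "\<And>y. ((\<lambda>s. Ss s y) has_real_derivative \<xi> y) (at 0)"
    "\<And>y. (\<xi> has_real_derivative k / (As 0 y)\<^sup>2 - 2 * \<kappa> * z y / (As 0 y) ^ 3) (at y)"
    "\<And>y. \<xi> (y + Ts 0) = \<xi> y + \<eta>' - v.T' * (\<kappa> / (As 0 y)\<^sup>2)"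
    by (rule v.phase_variation) blast
  have "wave_tangent f f1 f2 F E \<kappa> \<omega> \<zeta> (lo 0) (hi 0) (Ts 0) (As 0) (Bs 0) (Ss 0) e k w v.T' \<eta>' M' z z1 \<xi>"
    by unfold_locales
       (use z(3-5) \<xi> M'(2) v.z_0 v.z_shift in \<open>auto simp: g1_def r1_def\<close>)
  then have t: "wave_tangent f f1 f2 F E \<kappa> \<omega> \<zeta> (am (E, \<kappa>, \<omega>, \<zeta>)) (ap (E, \<kappa>, \<omega>, \<zeta>)) (T (E, \<kappa>, \<omega>, \<zeta>))
       (A (E, \<kappa>, \<omega>, \<zeta>)) (deriv (A (E, \<kappa>, \<omega>, \<zeta>))) (S (E, \<kappa>, \<omega>, \<zeta>)) e k w v.T' \<eta>' M' z z1 \<xi>"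
    unfolding lo_def hi_def Ts_def As_def Bs_def Ss_def line_0 .
  show ?thesis
    by (rule that[OF t]) (use v.dT \<xi>(1,3) M'(1) v.action_variation udiff_pointwise[OF z(1)] in
      \<open>simp_all add: Ts_def[abs_def] \<eta>s_def[abs_def] Ms_def[abs_def] Ks_def[abs_def] As_def Ss_def line_0\<close>)
qed

subsection \<open>The moments and their second derivatives\<close>

context wave_family
begin

lemma d_eqI:
  "((\<lambda>s. P (E + s * 1, \<kappa> + s * 0, \<omega> + s * 0, \<zeta>)) has_real_derivative D) (at 0) \<Longrightarrow> d\<^sub>E P (E, \<kappa>, \<omega>, \<zeta>) = D"
  "((\<lambda>s. P (E + s * 0, \<kappa> + s * 1, \<omega> + s * 0, \<zeta>)) has_real_derivative D) (at 0) \<Longrightarrow> d\<^sub>\<kappa> P (E, \<kappa>, \<omega>, \<zeta>) = D"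
  "((\<lambda>s. P (E + s * 0, \<kappa> + s * 0, \<omega> + s * 1, \<zeta>)) has_real_derivative D) (at 0) \<Longrightarrow> d\<^sub>\<omega> P (E, \<kappa>, \<omega>, \<zeta>) = D"
proof -
  have shift: "deriv g c = D" if "((\<lambda>s. g (c + s)) has_real_derivative D) (at 0)" for g :: "real \<Rightarrow> real" and c
    using that DERIV_shift[of g D 0 c] by (intro DERIV_imp_deriv) (simp add: add.commute)
  show "((\<lambda>s. P (E + s * 1, \<kappa> + s * 0, \<omega> + s * 0, \<zeta>)) has_real_derivative D) (at 0) \<Longrightarrow> d\<^sub>E P (E, \<kappa>, \<omega>, \<zeta>) = D"
    "((\<lambda>s. P (E + s * 0, \<kappa> + s * 1, \<omega> + s * 0, \<zeta>)) has_real_derivative D) (at 0) \<Longrightarrow> d\<^sub>\<kappa> P (E, \<kappa>, \<omega>, \<zeta>) = D"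
    "((\<lambda>s. P (E + s * 0, \<kappa> + s * 0, \<omega> + s * 1, \<zeta>)) has_real_derivative D) (at 0) \<Longrightarrow> d\<^sub>\<omega> P (E, \<kappa>, \<omega>, \<zeta>) = D"
    using shift[of "\<lambda>e. P (e, \<kappa>, \<omega>, \<zeta>)" E] shift[of "\<lambda>k. P (E, k, \<omega>, \<zeta>)" \<kappa>]
      shift[of "\<lambda>w. P (E, \<kappa>, w, \<zeta>)" \<omega>]
    by (simp_all add: d\<^sub>E_def d\<^sub>\<kappa>_def d\<^sub>\<omega>_def)
qed

lemma wave_line: "(E, \<kappa>, \<omega>, \<zeta>) \<in> U \<Longrightarrow> wave_line f f1 f2 F U am ap T \<eta> M K A S E \<kappa> \<omega> \<zeta>"
  by unfold_locales

lemma dK: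
  assumes "q \<in> U" shows "d\<^sub>E K q = T q" "d\<^sub>\<kappa> K q = - \<eta> q" "d\<^sub>\<omega> K q = - M q / 2"
proof -
  obtain E \<kappa> \<omega> \<zeta> where q: "q = (E, \<kappa>, \<omega>, \<zeta>)" by (cases q)
  note L = wave_line[OF assms[unfolded q]]
  have *: "((\<lambda>s. K (E + s * e, \<kappa> + s * k, \<omega> + s * w, \<zeta>)) has_real_derivative
       e * T (E, \<kappa>, \<omega>, \<zeta>) - w * M (E, \<kappa>, \<omega>, \<zeta>) / 2 - k * \<eta> (E, \<kappa>, \<omega>, \<zeta>)) (at 0)" for e k w
    by (rule wave_line.tangent_exists[OF L, of e k w]) (simp add: wave_line.line_def[OF L])
  show "d\<^sub>E K q = T q" "d\<^sub>\<kappa> K q = - \<eta> q" "d\<^sub>\<omega> K q = - M q / 2"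
    unfolding q using d_eqI(1)[OF *[of 1 0 0]] d_eqI(2)[OF *[of 0 1 0]] d_eqI(3)[OF *[of 0 0 1]] by simp_all
qed

text \<open>The formulas for the first derivatives of the action hold on all of \<open>U\<close>,
  hence near the base point of each line. Second derivatives of the action are thereby first
  derivatives of the other moments.\<close>

lemma derivative_transfer:
  assumes q: "(E, \<kappa>, \<omega>, \<zeta>) \<in> U" and PQ: "\<And>q. q \<in> U \<Longrightarrow> P q = Q q"
    and Q: "((\<lambda>s. Q (E + s * e, \<kappa> + s * k, \<omega> + s * w, \<zeta>)) has_real_derivative D) (at 0)"
  shows "((\<lambda>s. P (E + s * e, \<kappa> + s * k, \<omega> + s * w, \<zeta>)) has_real_derivative D) (at 0)"
proof -
  have "\<forall>\<^sub>F s in nhds 0. (E + s * e, \<kappa> + s * k, \<omega> + s * w, \<zeta>) \<in> U"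
    using wave_line.line_in_U[OF wave_line[OF q], of e k w] by (simp add: wave_line.line_def[OF wave_line[OF q]])
  then have "\<forall>\<^sub>F s in nhds 0. P (E + s * e, \<kappa> + s * k, \<omega> + s * w, \<zeta>) = Q (E + s * e, \<kappa> + s * k, \<omega> + s * w, \<zeta>)"
    by (rule eventually_mono) (rule PQ)
  then show ?thesis using Q by (subst DERIV_cong_ev[OF refl _ refl])
qed

end

section \<open>Smoothness and kernels of real matrices\<close>

lemma smooth_on_differentiable:
  assumes "smooth_on U g" "q \<in> U" shows "g differentiable (at q)"
proof -
  have "Ck_on (Suc 0) U g" using assms(1) unfolding smooth_on_def by blast
  then show ?thesis using assms(2) unfolding Ck_on.simps by blast
qed

lemma Ck_on_real_derivative:
  fixes g :: "real \<Rightarrow> real"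
  assumes "Ck_on (Suc k) U g"
  obtains g' where "\<And>x. x \<in> U \<Longrightarrow> (g has_real_derivative g' x) (at x)" "Ck_on k U g'"
proof (rule that)
  show "Ck_on k U (\<lambda>x. frechet_derivative g (at x) 1)" using assms unfolding Ck_on.simps by simp
  fix x assume "x \<in> U"
  then have "g differentiable (at x)" using assms unfolding Ck_on.simps by blast
  then have d: "(g has_derivative frechet_derivative g (at x)) (at x)" by (simp add: frechet_derivative_works)
  have "frechet_derivative g (at x) h = frechet_derivative g (at x) 1 * h" for h
    using linear_scale[OF has_derivative_linear[OF d], of h 1] by (simp add: mult.commute)
  then have "frechet_derivative g (at x) = (*) (frechet_derivative g (at x) 1)" by (rule ext)
  then show "(g has_real_derivative frechet_derivative g (at x) 1) (at x)"
    unfolding has_field_derivative_def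
    by (rule back_subst[of "\<lambda>D. (g has_derivative D) (at x)", OF d])
qed

lemma ker_mat_2:
  "x \<in> ker_mat (vector [vector [a, b], vector [c, d]] :: real^2^2) \<longleftrightarrow>
     x $ 1 * a + x $ 2 * b = 0 \<and> x $ 1 * c + x $ 2 * d = 0"
  by (simp add: ker_mat_def vec_eq_2 matrix_vector_mult_def sum_2 mult.commute)

lemma dim_ker_mat_pos:
  fixes B :: "real^'n^'n"
  assumes "det B = 0" shows "dim (ker_mat B) > 0"
proof -
  have "\<not> invertible B" using assms by (simp add: invertible_det_nz)
  then obtain x where "B *v x = 0" "x \<noteq> 0"
    unfolding invertible_left_inverse matrix_left_invertible_ker by blast
  then have "\<not> ker_mat B \<subseteq> {0}" by (auto simp: ker_mat_def)
  then show ?thesis using dim_eq_0 by blast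
qed

theorem theorem1:
  fixes f F :: "real \<Rightarrow> real"
    and E \<kappa> \<omega> \<zeta> :: real and p :: params and U :: "params set"
    and am ap :: "params \<Rightarrow> real"
    and A S :: "params \<Rightarrow> real \<Rightarrow> real"
    and T \<eta> M K :: "params \<Rightarrow> real"
    and \<sigma> :: real and D :: "real^4^4"
    and L :: "((real \<Rightarrow> complex^2) \<times> (real \<Rightarrow> complex^2)) set"
    and u0 u1 u2 u3 v0 v1 v2 v3 :: "real \<Rightarrow> complex^2"
  assumes f_smooth: "smooth_on {0<..} f"
    and F_antideriv: "\<And>x. x > 0 \<Longrightarrow> (F has_real_derivative f x) (at x)"
    and F_indep: "indep_from_1_x_inverse F"
    and p: "p = (E, \<kappa>, \<omega>, \<zeta>)" "p \<in> Omega F"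
    \<comment> \<open>the interval chosen at \<open>p\<close>, continued smoothly to nearby parameters\<close>
    and U: "open U" "p \<in> U" "U \<subseteq> Omega F"
    and endpoints: "\<And>q. q \<in> U \<Longrightarrow> turning_points F q (am q) (ap q)"
    and endpoints_smooth: "smooth_on U am" "smooth_on U ap"
    and T: "T = T_moment F am ap" and \<eta>: "\<eta> = \<eta>_moment F am ap"
    and M: "M = M_moment F am ap" and K: "K = K_moment F am ap"
    and profile: "\<And>q. q \<in> U \<Longrightarrow> wave_profile f F q (am q) (ap q) (T q) (A q) (S q)"
    and nonconst: "\<not> (A p) constant_on UNIV"
    and L: "L = lin_op f (T p) \<omega> \<zeta> (A p) (S p)"
    and \<sigma>: "\<sigma> = bracket T \<eta> d\<^sub>E d\<^sub>\<kappa> p"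
    and D: "D = vector
      [vector [d\<^sub>\<kappa> (d\<^sub>\<kappa> K) p, d\<^sub>E (d\<^sub>\<kappa> K) p, d\<^sub>\<omega> (d\<^sub>\<kappa> K) p, T p],
       vector [d\<^sub>E (d\<^sub>\<kappa> K) p, d\<^sub>E (d\<^sub>E K) p, d\<^sub>\<omega> (d\<^sub>E K) p, 0],
       vector [d\<^sub>\<omega> (d\<^sub>\<kappa> K) p, d\<^sub>\<omega> (d\<^sub>E K) p, d\<^sub>\<omega> (d\<^sub>\<omega> K) p, 0],
       vector [T p, 0, 0, - M p]]"
    and u0: "u0 = (\<lambda>y. \<sigma> *\<^sub>R cvec 0 (A p y))"
    and u2: "u2 = (\<lambda>y. \<sigma> *\<^sub>R cvec (deriv (A p) y) (A p y * deriv (S p) y))"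
    and u1: "u1 = (\<lambda>y.
        \<sigma> *\<^sub>R cvec (d\<^sub>\<omega> (\<lambda>q. A q y) p) (A p y * d\<^sub>\<omega> (\<lambda>q. S q y) p)
      + bracket T \<eta> d\<^sub>\<kappa> d\<^sub>\<omega> p *\<^sub>R cvec (d\<^sub>E (\<lambda>q. A q y) p) (A p y * d\<^sub>E (\<lambda>q. S q y) p)
      + bracket T \<eta> d\<^sub>\<omega> d\<^sub>E p *\<^sub>R cvec (d\<^sub>\<kappa> (\<lambda>q. A q y) p) (A p y * d\<^sub>\<kappa> (\<lambda>q. S q y) p))"
    and u3: "u3 = (\<lambda>y.
        \<sigma> *\<^sub>R cvec 0 (y * A p y / 2)
      + (T p * d\<^sub>\<kappa> T p / 2) *\<^sub>R cvec (d\<^sub>E (\<lambda>q. A q y) p) (A p y * d\<^sub>E (\<lambda>q. S q y) p)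
      - (T p * d\<^sub>E T p / 2) *\<^sub>R cvec (d\<^sub>\<kappa> (\<lambda>q. A q y) p) (A p y * d\<^sub>\<kappa> (\<lambda>q. S q y) p))"
    and v0: "v0 = (\<lambda>y. u1 y v* Jmat)" and v1: "v1 = (\<lambda>y. - (u0 y v* Jmat))"
    and v2: "v2 = (\<lambda>y. u3 y v* Jmat)" and v3: "v3 = (\<lambda>y. - (u2 y v* Jmat))"
  shows
    "((\<forall>u \<in> {u0, u1, u2, u3}. u \<in> Domain L \<and> (\<forall>y. u (y + T p) = u y)) \<and>
      (u0, 0) \<in> L \<and> (u2, 0) \<in> L \<and> (u1, u0) \<in> L \<and> (u3, u2) \<in> L \<and>
      left_mult (T p) v1 L 0 \<and> left_mult (T p) v3 L 0 \<and>
      left_mult (T p) v0 L v1 \<and> left_mult (T p) v2 L v3 \<and>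
      (\<sigma> \<noteq> 0 \<and> det D \<noteq> 0 \<longrightarrow>
         jordan_chain L [u0, u1] \<and> jordan_chain L [u2, u3] \<and>
         distinct [u0, u1, u2, u3] \<and> cfun.independent {u0, u1, u2, u3} \<and>
         gen_kernel L = cfun.span {u0, u1, u2, u3}))
     \<and>
     ((\<sigma> \<noteq> 0 \<longrightarrow> cfun.dim (ker_pow L 1) = 2) \<and>
      (\<sigma> = 0 \<longrightarrow> cfun.dim (ker_pow L 1) > 2) \<and>
      cfun.dim (ker_pow L 1) = 2 + dim (ker_mat
        (vector [vector [d\<^sub>E T p, d\<^sub>\<kappa> T p], vector [d\<^sub>E \<eta> p, d\<^sub>\<kappa> \<eta> p]] :: real^2^2)) \<and>
      cfun.dim (ker_pow L 1) = 2 + dim (ker_mat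
        (vector [vector [d\<^sub>E (d\<^sub>E K) p, d\<^sub>E (d\<^sub>\<kappa> K) p],
                 vector [d\<^sub>E (d\<^sub>\<kappa> K) p, d\<^sub>\<kappa> (d\<^sub>\<kappa> K) p]] :: real^2^2)))
     \<and>
     (\<sigma> \<noteq> 0 \<longrightarrow>
        (det D \<noteq> 0 \<longrightarrow> (\<forall>us. jordan_chain L us \<longrightarrow> length us \<le> 2)) \<and>
        int (cfun.dim (ker_pow L 3)) - int (cfun.dim (ker_pow L 2)) = int (dim (ker_mat D)))"
proof -
  let ?lE = "\<lambda>s. (E + s * 1, \<kappa> + s * 0, \<omega> + s * 0, \<zeta>)"
  let ?lk = "\<lambda>s. (E + s * 0, \<kappa> + s * 1, \<omega> + s * 0, \<zeta>)"
  let ?lw = "\<lambda>s. (E + s * 0, \<kappa> + s * 0, \<omega> + s * 1, \<zeta>)"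
  have "Ck_on (Suc (Suc 0)) {0<..} f" using f_smooth unfolding smooth_on_def by blast
  then obtain f1 where f1: "\<And>x. x \<in> {0<..} \<Longrightarrow> (f has_real_derivative f1 x) (at x)" "Ck_on (Suc 0) {0<..} f1"
    by (rule Ck_on_real_derivative) blast
  obtain f2 where f2: "\<And>x. x \<in> {0<..} \<Longrightarrow> (f1 has_real_derivative f2 x) (at x)" "Ck_on 0 {0<..} f2"
    by (rule Ck_on_real_derivative[OF f1(2)]) blast
  interpret fam: wave_family f f1 f2 F U am ap T \<eta> M K A S
    by unfold_locales
      (use f1(1) f2 F_antideriv U endpoints T \<eta> M K profile smooth_on_differentiable[OF endpoints_smooth(1)]
        smooth_on_differentiable[OF endpoints_smooth(2)] in auto)
  have pU: "(E, \<kappa>, \<omega>, \<zeta>) \<in> U" using U(2) p(1) by simp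
  note wl = fam.wave_line[OF pU]
  note line = wave_line.line_def[OF wl]
  obtain TE hE ME zE zE' \<xi>E where
    tE: "wave_tangent f f1 f2 F E \<kappa> \<omega> \<zeta> (am p) (ap p) (T p) (A p) (deriv (A p)) (S p) 1 0 0 TE hE ME zE zE' \<xi>E"
    and dE: "((\<lambda>s. T (?lE s)) has_real_derivative TE) (at 0)"
    "((\<lambda>s. \<eta> (?lE s)) has_real_derivative hE) (at 0)"
    "((\<lambda>s. M (?lE s)) has_real_derivative ME) (at 0)"
    "\<And>y. ((\<lambda>s. A (?lE s) y) has_real_derivative zE y) (at 0)"
    "\<And>y. ((\<lambda>s. S (?lE s) y) has_real_derivative \<xi>E y) (at 0)"
    unfolding p(1) by (rule wave_line.tangent_exists[OF wl, of 1 0 0, unfolded line]) blast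
  obtain Tk hk Mk zk zk' \<xi>k where
    tk: "wave_tangent f f1 f2 F E \<kappa> \<omega> \<zeta> (am p) (ap p) (T p) (A p) (deriv (A p)) (S p) 0 1 0 Tk hk Mk zk zk' \<xi>k"
    and dk: "((\<lambda>s. T (?lk s)) has_real_derivative Tk) (at 0)"
    "((\<lambda>s. \<eta> (?lk s)) has_real_derivative hk) (at 0)"
    "((\<lambda>s. M (?lk s)) has_real_derivative Mk) (at 0)"
    "\<And>y. ((\<lambda>s. A (?lk s) y) has_real_derivative zk y) (at 0)"
    "\<And>y. ((\<lambda>s. S (?lk s) y) has_real_derivative \<xi>k y) (at 0)"
    unfolding p(1) by (rule wave_line.tangent_exists[OF wl, of 0 1 0, unfolded line]) blast
  obtain Tw hw Mw zw zw' \<xi>w where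
    tw: "wave_tangent f f1 f2 F E \<kappa> \<omega> \<zeta> (am p) (ap p) (T p) (A p) (deriv (A p)) (S p) 0 0 1 Tw hw Mw zw zw' \<xi>w"
    and dw: "((\<lambda>s. T (?lw s)) has_real_derivative Tw) (at 0)"
    "((\<lambda>s. \<eta> (?lw s)) has_real_derivative hw) (at 0)"
    "((\<lambda>s. M (?lw s)) has_real_derivative Mw) (at 0)"
    "\<And>y. ((\<lambda>s. A (?lw s) y) has_real_derivative zw y) (at 0)"
    "\<And>y. ((\<lambda>s. S (?lw s) y) has_real_derivative \<xi>w y) (at 0)"
    unfolding p(1) by (rule wave_line.tangent_exists[OF wl, of 0 0 1, unfolded line]) blast
  have dT: "d\<^sub>E T p = TE" "d\<^sub>\<kappa> T p = Tk" "d\<^sub>\<omega> T p = Tw"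
    and d\<eta>: "d\<^sub>E \<eta> p = hE" "d\<^sub>\<kappa> \<eta> p = hk" "d\<^sub>\<omega> \<eta> p = hw"
    and dA: "\<And>y. d\<^sub>E (\<lambda>q. A q y) p = zE y" "\<And>y. d\<^sub>\<kappa> (\<lambda>q. A q y) p = zk y" "\<And>y. d\<^sub>\<omega> (\<lambda>q. A q y) p = zw y"
    and dS: "\<And>y. d\<^sub>E (\<lambda>q. S q y) p = \<xi>E y" "\<And>y. d\<^sub>\<kappa> (\<lambda>q. S q y) p = \<xi>k y" "\<And>y. d\<^sub>\<omega> (\<lambda>q. S q y) p = \<xi>w y"
    unfolding p(1) by (intro fam.d_eqI dE dk dw)+
  have dK2: "d\<^sub>\<kappa> (d\<^sub>\<kappa> K) p = - hk" "d\<^sub>E (d\<^sub>\<kappa> K) p = - hE" "d\<^sub>\<omega> (d\<^sub>\<kappa> K) p = - hw"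
    "d\<^sub>E (d\<^sub>E K) p = TE" "d\<^sub>\<omega> (d\<^sub>E K) p = Tw" "d\<^sub>\<omega> (d\<^sub>\<omega> K) p = - Mw / 2"
    unfolding p(1)
    by (intro fam.d_eqI fam.derivative_transfer[OF pU fam.dK(1)] fam.derivative_transfer[OF pU fam.dK(2)]
        fam.derivative_transfer[OF pU fam.dK(3)] DERIV_minus DERIV_cdivide dE dk dw; assumption)+
  interpret tE: wave_tangent f f1 f2 F E \<kappa> \<omega> \<zeta> "am p" "ap p" "T p" "A p" "deriv (A p)" "S p" 1 0 0 TE hE ME zE zE' \<xi>E
    by (rule tE)
  interpret tk: wave_tangent f f1 f2 F E \<kappa> \<omega> \<zeta> "am p" "ap p" "T p" "A p" "deriv (A p)" "S p" 0 1 0 Tk hk Mk zk zk' \<xi>k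
    by (rule tk)
  interpret tw: wave_tangent f f1 f2 F E \<kappa> \<omega> \<zeta> "am p" "ap p" "T p" "A p" "deriv (A p)" "S p" 0 0 1 Tw hw Mw zw zw' \<xi>w
    by (rule tw)
  \<comment> \<open>These express equality of the mixed second derivatives of \<open>K\<close>,
    obtained by inserting pairs of unit directions into the reciprocity relation.\<close>
  have sym: "Tk = - hE" "Tw = - ME / 2" "hw = Mk / 2"
    using tE.tangent_reciprocity[OF tE tk] tE.tangent_reciprocity[OF tE tw] tE.tangent_reciprocity[OF tk tw]
    by (simp_all add: field_simps)
  have \<sigma>': "\<sigma> = TE * hk - Tk * hE" by (simp add: \<sigma> bracket_def dT d\<eta>)
  have M_eq: "M p = 2 * integral {am p..ap p} (\<lambda>x. x\<^sup>2 / sqrt (tE.R x))"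
    unfolding M M_moment_def p(1) tE.Rfun_eq[unfolded p(1), symmetric] ..
  have q0: "am p > 0" by (rule tE.a_pos)
  \<comment> \<open>In the direction \<open>e = 1\<close> the energy identity at the minimum reads
    \<open>2 * G * zE 0 + 2 = 0\<close>. In particular \<open>zE 0\<close> is nonzero, so it can
    serve as a pivot below.\<close>
  have zE0: "zE 0 = - 1 / tE.G (am p)" using tE.z_0 tE.G_a by (simp add: field_simps)
  interpret J: jordan "T p" tE.\<alpha> tE.\<beta> tE.V tE.Q tE.p0 tE.p0' tE.p2 tE.p2' tE.\<phi> tE.\<phi>' tk.\<phi> tk.\<phi>' tw.\<phi> tw.\<phi>' tE.ps tE.ps'
    TE Tk Tw hE hk hw ME Mk Mw "M p" "(am p)\<^sup>2" \<kappa> \<sigma>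
  proof unfold_locales
    show "tE.lin.sol (\<lambda>y. 0) tE.p0 tE.p0'" "tE.lin.sol (\<lambda>y. 0) tE.p2 tE.p2'" "tE.lin.sol tE.p2 tE.ps tE.ps'"
      by (rule tE.sol_p0 tE.sol_p2 tE.sol_ps)+
    show "tE.lin.sol (\<lambda>y. 0) tE.\<phi> tE.\<phi>'" "tE.lin.sol (\<lambda>y. 0) tk.\<phi> tk.\<phi>'" "tE.lin.sol tE.p0 tw.\<phi> tw.\<phi>'"
      using tE.sol_\<phi> tk.sol_\<phi> tw.sol_\<phi> by simp_all
    fix x x' :: "complex^2"
    \<comment> \<open>At 0 the system decouples, since \<open>B\<close> and the derivatives of the
      amplitude variations vanish there. \<open>x' $ 1\<close> gives \<open>c2\<close>, and
      \<open>x $ 2\<close> then \<open>c0\<close>; adding \<open>2 * \<kappa> / a\<^sup>2\<close>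
      times \<open>x $ 1\<close> to \<open>x' $ 2\<close> eliminates \<open>cE\<close> and gives
      \<open>ck\<close>, after which \<open>x $ 1\<close> gives \<open>cE\<close>.\<close>
    define ck where "ck = of_real (am p) * x' $ 2 + of_real (2 * \<kappa> / am p) * x $ 1"
    define cE where "cE = (x $ 1 - ck * of_real (zk 0)) / of_real (zE 0)"
    define c2 where "c2 = x' $ 1 / of_real (tE.G (am p))"
    define c0 where "c0 = (x $ 2 - c2 * of_real (\<kappa> / am p)) / of_real (am p)"
    have nz: "of_real (am p) \<noteq> (0::complex)" "of_real (tE.G (am p)) \<noteq> (0::complex)" "of_real (zE 0) \<noteq> (0::complex)"
      using q0 tE.G_a zE0 by simp_all
    have e: "cE * of_real (zE 0) + ck * of_real (zk 0) = x $ 1" "c2 * of_real (tE.G (am p)) = x' $ 1"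
      "c0 * of_real (am p) + c2 * of_real (\<kappa> / am p) = x $ 2"
      using nz by (simp_all add: cE_def c2_def c0_def)
    have "cE * of_real (- 2 * \<kappa> * zE 0 / (am p)\<^sup>2) + ck * of_real (1 / am p - 2 * \<kappa> * zk 0 / (am p)\<^sup>2)
       = ck * of_real (1 / am p) - of_real (2 * \<kappa> / (am p)\<^sup>2) * (cE * of_real (zE 0) + ck * of_real (zk 0))"
      by (simp add: algebra_simps add_divide_distrib)
    also have "\<dots> = x' $ 2" unfolding e(1) unfolding ck_def using nz by (simp add: field_simps power2_eq_square)
    finally have e': "cE * of_real (- 2 * \<kappa> * zE 0 / (am p)\<^sup>2) + ck * of_real (1 / am p - 2 * \<kappa> * zk 0 / (am p)\<^sup>2) = x' $ 2" .
    have "x = c0 *s tE.p0 0 + c2 *s tE.p2 0 + cE *s tE.\<phi> 0 + ck *s tk.\<phi> 0"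
      unfolding tE.p2_def tE.A_\<alpha> unfolding tE.p0_def tE.\<phi>_def tk.\<phi>_def tE.A_0 tE.B_0 tE.\<xi>_0 tk.\<xi>_0 cvec_def
      using e by (simp add: vec_eq_2)
    moreover have "x' = c0 *s tE.p0' 0 + c2 *s tE.p2' 0 + cE *s tE.\<phi>' 0 + ck *s tk.\<phi>' 0"
      unfolding tE.p0'_def tE.p2'_def tE.\<phi>'_def tk.\<phi>'_def tE.A_0 tE.B_0 tE.z1_0 tk.z1_0 cvec_def
      using e e' by (simp add: vec_eq_2)
    ultimately show "\<exists>c0 c2 cE ck. x = c0 *s tE.p0 0 + c2 *s tE.p2 0 + cE *s tE.\<phi> 0 + ck *s tk.\<phi> 0 \<and>
        x' = c0 *s tE.p0' 0 + c2 *s tE.p2' 0 + cE *s tE.\<phi>' 0 + ck *s tk.\<phi>' 0" by blast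
  next
    show "((\<lambda>y. symp (tE.p2 y) (tE.ps y)) has_integral of_real ((M p - T p * (am p)\<^sup>2) / 4)) {0..T p}"
      unfolding M_eq by (rule tE.integral_p2s)
    show "tE.lin.conc 0 (tE.p0 0) (tE.p0' 0) (tE.\<phi> 0) (tE.\<phi>' 0) = 0" "tE.lin.conc 0 (tE.p0 0) (tE.p0' 0) (tk.\<phi> 0) (tk.\<phi>' 0) = -1"
      "tE.lin.conc 0 (tE.p2 0) (tE.p2' 0) (tE.\<phi> 0) (tE.\<phi>' 0) = -1" "tE.lin.conc 0 (tE.p2 0) (tE.p2' 0) (tk.\<phi> 0) (tk.\<phi>' 0) = 0"
      using tE.conc_p0 tE.conc_p2 tk.conc_p0 tk.conc_p2 by simp_all
    show "((\<lambda>y. symp (tE.p2 y) (tE.\<phi> y)) has_integral of_real ((\<kappa> * TE - (am p)\<^sup>2 * hE) / 2)) {0..T p}"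
      "((\<lambda>y. symp (tE.p2 y) (tk.\<phi> y)) has_integral of_real ((T p + \<kappa> * Tk - (am p)\<^sup>2 * hk) / 2)) {0..T p}"
      "((\<lambda>y. symp (tE.p2 y) (tw.\<phi> y)) has_integral of_real ((\<kappa> * Tw - (am p)\<^sup>2 * hw) / 2)) {0..T p}"
      using tE.integral_p2 tk.integral_p2 tw.integral_p2 by simp_all
  qed (rule tE.p_periodic tE.\<phi>_shift tk.\<phi>_shift tw.\<phi>_shift tE.conc_p02 tE.integral_p02 tE.integral_p0
      tk.integral_p0 tw.integral_p0 tE.integral_p0s \<sigma>')+
  have L_eq: "L = tE.lin.op" unfolding L by (rule tE.lin_op_eq)
  have sc: "c *\<^sub>R v = of_real c *s v" for c and v :: "complex^2"
    by (simp add: vec_eq_2 scaleR_conv_of_real[where 'a = complex])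
  have dS': "deriv (S p) = tE.\<alpha>" by (rule tE.deriv_S_eq)
  have j: "u0 = J.j0" "u1 = J.j1" "u2 = J.j2" "u3 = J.j3"
    unfolding u0 u1 u2 u3 J.j0_def J.j1_def J.j2_def J.j3_def J.cmb_def[abs_def] J.s1_def J.s2_def
      bracket_def dT d\<eta> dA dS dS' sc tE.p0_def[symmetric] tE.p2_def[symmetric] tE.ps_def[symmetric]
      tE.\<phi>_def[symmetric] tk.\<phi>_def[symmetric] tw.\<phi>_def[symmetric]
    by (auto simp: fun_eq_iff vec_eq_2 algebra_simps)
  note cs = J.csol_j[folded j]
  note inL = cs[THEN tE.lin.csol_op, folded L_eq]
  have per: "u y = u (y + T p)" if "tE.lin.csol u v" for u v y
    using that by (simp add: tE.lin.csol_def)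
  have neg: "tE.lin.csol (- u) 0" if "tE.lin.csol u 0" for u
    using tE.lin.csol_diff[OF tE.lin.csol_0 that] by simp
  have vneg: "(- x) v* Jmat = - (x v* Jmat)" for x :: "complex^2"
    by (simp add: vec_eq_iff vector_matrix_mult_def sum_negf)
  have v0z: "(\<lambda>y. - ((0 :: real \<Rightarrow> complex^2) y v* Jmat)) = 0"
    by (simp add: fun_eq_iff vec_eq_iff vector_matrix_mult_def)
  \<comment> \<open>The rows \<open>v1\<close>, \<open>v3\<close> come from the rule for left
    multiplication applied to \<open>- u0\<close>, \<open>- u2\<close>, which the operator
    annihilates; for \<open>u1\<close>, \<open>u3\<close> the same rule yields \<open>v1\<close>,
    \<open>v3\<close> on the right.\<close>
  have left: "left_mult (T p) v1 L 0" "left_mult (T p) v3 L 0" "left_mult (T p) v0 L v1" "left_mult (T p) v2 L v3"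
    using tE.lin.left_mult_csol[OF neg[OF cs(1)], folded L_eq] tE.lin.left_mult_csol[OF neg[OF cs(3)], folded L_eq]
      tE.lin.left_mult_csol[OF cs(2), folded L_eq] tE.lin.left_mult_csol[OF cs(4), folded L_eq]
    unfolding v0 v1 v2 v3 v0z by (simp_all add: vneg)
  have dom: "\<forall>u\<in>{u0, u1, u2, u3}. u \<in> Domain L \<and> (\<forall>y. u (y + T p) = u y)"
    using inL per[OF cs(1)] per[OF cs(2)] per[OF cs(3)] per[OF cs(4)] by (auto intro: DomainI)
  \<comment> \<open>The symmetry relations rewrite the second row as the defect along
    \<open>p2\<close> and the third as the pairing with \<open>p0\<close>, which is the form used in
    the Jordan chain analysis.\<close>
  have D': "D = vector [vector [- hk, - hE, - hw, T p], vector [Tk, TE, Tw, 0],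
      vector [- Mk / 2, - ME / 2, - Mw / 2, 0], vector [T p, 0, 0, - M p]]"
    unfolding D dK2 sym by simp
  have part1: "\<sigma> \<noteq> 0 \<and> det D \<noteq> 0 \<longrightarrow>
         jordan_chain L [u0, u1] \<and> jordan_chain L [u2, u3] \<and>
         distinct [u0, u1, u2, u3] \<and> cfun.independent {u0, u1, u2, u3} \<and>
         gen_kernel L = cfun.span {u0, u1, u2, u3}"
  proof (intro impI)
    assume nd: "\<sigma> \<noteq> 0 \<and> det D \<noteq> 0"
    note b = J.basis_j[OF conjunct1[OF nd], folded j]
    have "0 \<notin> {u0, u1, u2, u3}" using b(1) cfun.dependent_zero by metis
    then have "u0 \<noteq> 0" "u2 \<noteq> 0" by auto
    then have "jordan_chain L [u0, u1]" "jordan_chain L [u2, u3]"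
      using inL by (auto simp: jordan_chain_def)
    moreover have "gen_kernel L = cfun.span {u0, u1, u2, u3}"
      using J.nondegenerate_kernels(2)[OF _ D'] nd by (simp add: L_eq j)
    ultimately show "jordan_chain L [u0, u1] \<and> jordan_chain L [u2, u3] \<and>
         distinct [u0, u1, u2, u3] \<and> cfun.independent {u0, u1, u2, u3} \<and>
         gen_kernel L = cfun.span {u0, u1, u2, u3}" using b(1,3) by blast
  qed
  let ?B1 = "vector [vector [d\<^sub>E T p, d\<^sub>\<kappa> T p], vector [d\<^sub>E \<eta> p, d\<^sub>\<kappa> \<eta> p]] :: real^2^2"
  let ?B2 = "vector [vector [d\<^sub>E (d\<^sub>E K) p, d\<^sub>E (d\<^sub>\<kappa> K) p], vector [d\<^sub>E (d\<^sub>\<kappa> K) p, d\<^sub>\<kappa> (d\<^sub>\<kappa> K) p]] :: real^2^2"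
  have dim1: "cfun.dim (ker_pow L 1) = 2 + dim (ker_mat ?B1)"
    unfolding L_eq dT d\<eta>
    by (rule J.dim_ker_pow_1) (simp_all add: ker_mat_2 forall_2 sum_2 mult.commute)
  have dim2: "cfun.dim (ker_pow L 1) = 2 + dim (ker_mat ?B2)"
    unfolding L_eq dK2
  \<comment> \<open>Since \<open>T\<^sub>\<kappa> = - \<eta>\<^sub>E\<close>, the Hessian of
    \<open>K\<close> is the Jacobian of \<open>(T, \<eta>)\<close> with its second row negated, so
    the kernels coincide.\<close>
  proof (rule J.dim_ker_pow_1)
    fix x :: "real^2"
    show "x \<in> ker_mat (vector [vector [TE, - hE], vector [- hE, - hk]]) \<longleftrightarrow>
        x $ 1 * TE + x $ 2 * Tk = 0 \<and> x $ 1 * hE + x $ 2 * hk = 0"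
      unfolding ker_mat_2 sym(1) by (auto simp: algebra_simps)
  next
    fix c :: "2 \<Rightarrow> complex"
    assume c: "c 1 * TE + c 2 * Tk = 0" "c 1 * hE + c 2 * hk = 0"
    have "- (c 1 * complex_of_real hE + c 2 * of_real hk) = 0" using c(2) by simp
    then show "\<forall>i. (\<Sum>j\<in>UNIV. of_real ((vector [vector [TE, - hE], vector [- hE, - hk]] :: real^2^2) $ i $ j) * c j) = 0"
      using c(1) by (simp add: forall_2 sum_2 sym(1) mult.commute)
  qed
  have dim_nz: "cfun.dim (ker_pow L 1) = 2" if "\<sigma> \<noteq> 0"
  proof -
    have "ker_pow L 1 = cfun.span {J.cmb 1 0 0 0 0 0, J.cmb 0 1 0 0 0 0}"
      unfolding L_eq J.ker_pow_1_nondegenerate[OF that] J.basis_02(3) ..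
    then show ?thesis
      using cfun.dim_eq_card_independent[OF J.basis_02(1)] J.basis_02(2) by (simp add: cfun.dim_span)
  qed
  have dim_z: "cfun.dim (ker_pow L 1) > 2" if "\<sigma> = 0"
  proof -
    have "det ?B1 = 0" using that by (simp add: det_2 dT d\<eta> \<sigma>')
    from dim_ker_mat_pos[OF this] show ?thesis unfolding dim1 by simp
  qed
  have part3: "\<sigma> \<noteq> 0 \<longrightarrow>
        (det D \<noteq> 0 \<longrightarrow> (\<forall>us. jordan_chain L us \<longrightarrow> length us \<le> 2)) \<and>
        int (cfun.dim (ker_pow L 3)) - int (cfun.dim (ker_pow L 2)) = int (dim (ker_mat D))"
    using J.nondegenerate_kernels(1,3)[OF _ D'] unfolding L_eq by blast
  show ?thesis
    using dom inL left part1 dim1 dim2 dim_nz dim_z part3 by blast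
qed

end
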